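(* Let $M^n$ be a Riemannian manifold, $F^l\subset M^n$ a submanifold, and $\xi$ a vector field on $M^n$ along $F^l$ of constant length. Then $\xi(F^l)$ is a totally geodesic submanifold of $TM^n$ (with the Sasaki metric) if and only if $F^l$ is totally geodesic in $M^n$ and $\xi$ is parallel along $F^l$ (i.e. $\bar\nabla_X\xi=0$ for all $X$ tangent to $F^l$).
   Context: All manifolds and vector fields are smooth; superscripts denote dimensions. $\bar\nabla$ is the Levi-Civita connection of the metric $\bar g$ of $M^n$. Let $\pi:TM^n\to M^n$ be the projection and $K:TTM^n\to TM^n$ the connection map, given in induced coordinates $(x^a,\xi^a)$ by $K(\tilde X^a\partial_{x^a}+\tilde X^{n+a}\partial_{\xi^a})=(\tilde X^{n+a}+\bar\Gamma^a_{bc}\xi^b\tilde X^c)\partial_{x^a}$. The Sasaki metric on $TM^n$ is $g_s(\tilde X,\tilde Y)=\bar g(\pi_*\tilde X,\pi_*\tilde Y)+\bar g(K\tilde X,K\tilde Y)$. A vector field on $M^n$ along $F$ is a smooth map $\xi:F\to TM^n$ with $\pi\circ\xi=\mathrm{Id}_F$ (not necessarily tangent to $F$); $\xi(F)$ is its image. *)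

theory Defs
  imports "HOL-Analysis.Analysis"
begin

section \<open>Smooth maps between Euclidean spaces\<close>

text \<open>Only used on open sets.\<close>

primrec k_smooth_on ::
  "nat \<Rightarrow> 'a::euclidean_space set \<Rightarrow> ('a \<Rightarrow> 'b::euclidean_space) \<Rightarrow> bool" where
  "k_smooth_on 0 S f \<longleftrightarrow> continuous_on S f"
| "k_smooth_on (Suc k) S f \<longleftrightarrow>
     (\<forall>x\<in>S. f differentiable (at x)) \<and>
     (\<forall>v. k_smooth_on k S (\<lambda>x. frechet_derivative f (at x) v))"

definition smooth_on :: "'a::euclidean_space set \<Rightarrow> ('a \<Rightarrow> 'b::euclidean_space) \<Rightarrow> bool" where
  "smooth_on S f \<longleftrightarrow> (\<forall>k. k_smooth_on k S f)"


section \<open>Manifolds\<close>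

text \<open>
  A manifold is given by an atlas: a set of charts, each a pair of a domain and a coordinate map
  into the model space \<open>'e\<close>, so the dimension is \<open>DIM('e)\<close>. Neither the underlying
  set nor its topology is separate data; both are recovered from the atlas. This allows a
  subset of a manifold to carry its own smooth structure.
\<close>

type_synonym ('m, 'e) chart = "'m set \<times> ('m \<Rightarrow> 'e)"

abbreviation cdom :: "('m, 'e) chart \<Rightarrow> 'm set" where
  "cdom c \<equiv> fst c"

abbreviation cmap :: "('m, 'e) chart \<Rightarrow> 'm \<Rightarrow> 'e" where
  "cmap c \<equiv> snd c"

abbreviation cinv :: "('m, 'e) chart \<Rightarrow> 'e \<Rightarrow> 'm" where
  "cinv c \<equiv> inv_into (cdom c) (cmap c)"

definition points :: "('m, 'e) chart set \<Rightarrow> 'm set" where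
  "points A = (\<Union>c\<in>A. cdom c)"

definition transition :: "('m, 'e) chart \<Rightarrow> ('m, 'e) chart \<Rightarrow> 'e \<Rightarrow> 'e" where
  "transition c d = cmap d \<circ> cinv c"

definition smooth_atlas :: "('m, 'e::euclidean_space) chart set \<Rightarrow> bool" where
  "smooth_atlas A \<longleftrightarrow>
     (\<forall>c\<in>A. inj_on (cmap c) (cdom c) \<and> open (cmap c ` cdom c)) \<and>
     (\<forall>c\<in>A. \<forall>d\<in>A. open (cmap c ` (cdom c \<inter> cdom d)) \<and>
        smooth_on (cmap c ` (cdom c \<inter> cdom d)) (transition c d))"

definition atlas_topology :: "('m, 'e::euclidean_space) chart set \<Rightarrow> 'm topology" where
  "atlas_topology A =
     topology (\<lambda>W. W \<subseteq> points A \<and> (\<forall>c\<in>A. open (cmap c ` (W \<inter> cdom c))))"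

lemma openin_atlas_topology:
  assumes "smooth_atlas A"
  shows "openin (atlas_topology A) W \<longleftrightarrow>
           W \<subseteq> points A \<and> (\<forall>c\<in>A. open (cmap c ` (W \<inter> cdom c)))"
proof -
  have "istopology (\<lambda>W. W \<subseteq> points A \<and> (\<forall>c\<in>A. open (cmap c ` (W \<inter> cdom c))))"
    unfolding istopology_def
  proof (intro conjI allI impI ballI)
    fix S T c
    assume S: "S \<subseteq> points A \<and> (\<forall>c\<in>A. open (cmap c ` (S \<inter> cdom c)))"
      and T: "T \<subseteq> points A \<and> (\<forall>c\<in>A. open (cmap c ` (T \<inter> cdom c)))"
    show "S \<inter> T \<subseteq> points A" using S by blast
    assume c: "c \<in> A"
    have "inj_on (cmap c) (cdom c)" using assms c by (simp add: smooth_atlas_def)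
    then have "cmap c ` (S \<inter> T \<inter> cdom c) = cmap c ` (S \<inter> cdom c) \<inter> cmap c ` (T \<inter> cdom c)"
      by (auto simp: inj_on_def)
    then show "open (cmap c ` (S \<inter> T \<inter> cdom c))" using S T c by auto
  next
    fix K c
    assume K: "\<forall>W\<in>K. W \<subseteq> points A \<and> (\<forall>c\<in>A. open (cmap c ` (W \<inter> cdom c)))"
    show "\<Union> K \<subseteq> points A" using K by blast
    assume "c \<in> A"
    moreover have "cmap c ` (\<Union> K \<inter> cdom c) = (\<Union>W\<in>K. cmap c ` (W \<inter> cdom c))" by blast
    ultimately show "open (cmap c ` (\<Union> K \<inter> cdom c))" using K by auto
  qed
  then show ?thesis by (simp add: atlas_topology_def)
qed

definition smooth_manifold :: "('m, 'e::euclidean_space) chart set \<Rightarrow> bool" where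
  "smooth_manifold A \<longleftrightarrow>
     smooth_atlas A \<and> Hausdorff_space (atlas_topology A) \<and> second_countable (atlas_topology A)"

text \<open>
  Smoothness of a map on a subset \<open>W\<close> of the source; openness of the coordinate domains
  encodes that \<open>W\<close> is open and that \<open>f\<close> is continuous on it.
\<close>

definition smooth_map_on ::
  "('m, 'e::euclidean_space) chart set \<Rightarrow> ('k, 'f::euclidean_space) chart set
    \<Rightarrow> 'm set \<Rightarrow> ('m \<Rightarrow> 'k) \<Rightarrow> bool" where
  "smooth_map_on A B W f \<longleftrightarrow>
     W \<subseteq> points A \<and> f ` W \<subseteq> points B \<and>
     (\<forall>c\<in>A. \<forall>d\<in>B.
        open (cmap c ` (cdom c \<inter> W \<inter> f -` cdom d)) \<and>
        smooth_on (cmap c ` (cdom c \<inter> W \<inter> f -` cdom d)) (cmap d \<circ> f \<circ> cinv c))"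


section \<open>Tangent bundle\<close>

text \<open>
  A tangent vector is a base point together with the family of its components in the charts at
  that point, subject to the usual transformation law. To make equality of tangent vectors
  extensional, the family is zero at all other index values.
\<close>

type_synonym ('m, 'e) tvec = "'m \<times> (('m, 'e) chart \<Rightarrow> 'e)"

definition tangent_bundle :: "('m, 'e::euclidean_space) chart set \<Rightarrow> ('m, 'e) tvec set" where
  "tangent_bundle A = {(p, v). p \<in> points A \<and>
     (\<forall>c\<in>A. \<forall>d\<in>A. p \<in> cdom c \<inter> cdom d \<longrightarrow>
        v d = frechet_derivative (transition c d) (at (cmap c p)) (v c)) \<and>
     (\<forall>c. \<not> (c \<in> A \<and> p \<in> cdom c) \<longrightarrow> v c = 0)}"

definition tangent_space ::
  "('m, 'e::euclidean_space) chart set \<Rightarrow> 'm \<Rightarrow> ('m, 'e) tvec set" where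
  "tangent_space A p = {V \<in> tangent_bundle A. fst V = p}"

definition coord_vec ::
  "('m, 'e::euclidean_space) chart set \<Rightarrow> ('m, 'e) chart \<Rightarrow> 'm \<Rightarrow> 'e \<Rightarrow> ('m, 'e) tvec" where
  "coord_vec A c p u =
     (p, \<lambda>d. if d \<in> A \<and> p \<in> cdom d
             then frechet_derivative (transition c d) (at (cmap c p)) u else 0)"

definition zero_vec :: "'m \<Rightarrow> ('m, 'e::euclidean_space) tvec" where
  "zero_vec p = (p, \<lambda>_. 0)"

text \<open>Only used for vectors with the same base point.\<close>

definition add_vec ::
  "('m, 'e::euclidean_space) tvec \<Rightarrow> ('m, 'e) tvec \<Rightarrow> ('m, 'e) tvec" where
  "add_vec V W = (fst V, \<lambda>c. snd V c + snd W c)"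

text \<open>The induced coordinates \<open>(x, \<xi>)\<close>, with values in the model space \<open>'e \<times> 'e\<close>.\<close>

definition tangent_chart ::
  "('m, 'e::euclidean_space) chart set \<Rightarrow> ('m, 'e) chart \<Rightarrow> (('m, 'e) tvec, 'e \<times> 'e) chart" where
  "tangent_chart A c =
     ({V \<in> tangent_bundle A. fst V \<in> cdom c}, \<lambda>V. (cmap c (fst V), snd V c))"

definition tangent_atlas ::
  "('m, 'e::euclidean_space) chart set \<Rightarrow> (('m, 'e) tvec, 'e \<times> 'e) chart set" where
  "tangent_atlas A = tangent_chart A ` A"

text \<open>The differential of \<open>f\<close>; its value does not depend on the choice of the chart \<open>c\<close>.\<close>

definition tangent_map ::
  "('m, 'e::euclidean_space) chart set \<Rightarrow> ('k, 'f::euclidean_space) chart set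
    \<Rightarrow> ('m \<Rightarrow> 'k) \<Rightarrow> ('m, 'e) tvec \<Rightarrow> ('k, 'f) tvec" where
  "tangent_map A B f V =
     (let p = fst V; c = (SOME c. c \<in> A \<and> p \<in> cdom c) in
      (f p, \<lambda>d. if d \<in> B \<and> f p \<in> cdom d
                then frechet_derivative (cmap d \<circ> f \<circ> cinv c) (at (cmap c p)) (snd V c) else 0))"


section \<open>Riemannian metrics and the Levi-Civita connection\<close>

text \<open>A metric is only meaningful on pairs of tangent vectors with the same base point.\<close>

type_synonym ('m, 'e) metric = "('m, 'e) tvec \<Rightarrow> ('m, 'e) tvec \<Rightarrow> real"

definition metric_coord ::
  "('m, 'e::euclidean_space) chart set \<Rightarrow> ('m, 'e) metric \<Rightarrow> ('m, 'e) chart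
    \<Rightarrow> 'e \<Rightarrow> 'e \<Rightarrow> 'e \<Rightarrow> real" where
  "metric_coord A g c x u w = g (coord_vec A c (cinv c x) u) (coord_vec A c (cinv c x) w)"

definition riemannian_metric ::
  "('m, 'e::euclidean_space) chart set \<Rightarrow> ('m, 'e) metric \<Rightarrow> bool" where
  "riemannian_metric A g \<longleftrightarrow>
     (\<forall>c\<in>A. (\<forall>x \<in> cmap c ` cdom c.
               bilinear (metric_coord A g c x) \<and>
               (\<forall>u w. metric_coord A g c x u w = metric_coord A g c x w u) \<and>
               (\<forall>u. u \<noteq> 0 \<longrightarrow> metric_coord A g c x u u > 0)) \<and>
            (\<forall>u w. smooth_on (cmap c ` cdom c) (\<lambda>x. metric_coord A g c x u w)))"

text \<open>
  \<open>christoffel A g c x u w\<close> is the vector with components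
  \<open>\<Gamma>\<^sup>a\<^sub>b\<^sub>c u\<^sup>b w\<^sup>c\<close> of the Levi-Civita connection; lowering the index \<open>a\<close>, the equation is
  \<open>2 g\<^sub>a\<^sub>d \<Gamma>\<^sup>a\<^sub>b\<^sub>c = \<partial>\<^sub>b g\<^sub>c\<^sub>d + \<partial>\<^sub>c g\<^sub>b\<^sub>d - \<partial>\<^sub>d g\<^sub>b\<^sub>c\<close>.
\<close>

definition christoffel ::
  "('m, 'e::euclidean_space) chart set \<Rightarrow> ('m, 'e) metric \<Rightarrow> ('m, 'e) chart
    \<Rightarrow> 'e \<Rightarrow> 'e \<Rightarrow> 'e \<Rightarrow> 'e" where
  "christoffel A g c x u w = (THE z. \<forall>v.
     2 * metric_coord A g c x z v =
       frechet_derivative (\<lambda>y. metric_coord A g c y w v) (at x) u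
     + frechet_derivative (\<lambda>y. metric_coord A g c y u v) (at x) w
     - frechet_derivative (\<lambda>y. metric_coord A g c y u w) (at x) v)"

text \<open>
  The connection map \<open>K : TTM \<rightarrow> TM\<close>: at the point \<open>fst V = (p, \<xi>)\<close> of \<open>TM\<close>, the
  vector \<open>V\<close> has components \<open>(fst w, snd w)\<close> in the induced coordinates of \<open>c\<close>.
\<close>

definition connection_map ::
  "('m, 'e::euclidean_space) chart set \<Rightarrow> ('m, 'e) metric
    \<Rightarrow> (('m, 'e) tvec, 'e \<times> 'e) tvec \<Rightarrow> ('m, 'e) tvec" where
  "connection_map A g V =
     (let p = fst (fst V); \<xi> = snd (fst V) in
      (p, \<lambda>c. if c \<in> A \<and> p \<in> cdom c
              then (let w = snd V (tangent_chart A c) in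
                    snd w + christoffel A g c (cmap c p) (\<xi> c) (fst w))
              else 0))"

definition sasaki_metric ::
  "('m, 'e::euclidean_space) chart set \<Rightarrow> ('m, 'e) metric \<Rightarrow> (('m, 'e) tvec, 'e \<times> 'e) metric" where
  "sasaki_metric A g V W =
     g (tangent_map (tangent_atlas A) A fst V) (tangent_map (tangent_atlas A) A fst W)
   + g (connection_map A g V) (connection_map A g W)"


section \<open>Submanifolds\<close>

text \<open>
  A submanifold is an injectively immersed one: a subset with a manifold structure of its own,
  given by the atlas \<open>B\<close>, whose inclusion is a smooth immersion.
\<close>

definition submanifold ::
  "('m, 'e::euclidean_space) chart set \<Rightarrow> ('m, 'f::euclidean_space) chart set \<Rightarrow> bool" where
  "submanifold A B \<longleftrightarrow>
     smooth_manifold B \<and> smooth_map_on B A (points B) id \<and>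
     (\<forall>p\<in>points B. inj_on (tangent_map B A id) (tangent_space B p))"

definition vector_field_along ::
  "('m, 'e::euclidean_space) chart set \<Rightarrow> ('m, 'f::euclidean_space) chart set
    \<Rightarrow> ('m \<Rightarrow> ('m, 'e) tvec) \<Rightarrow> bool" where
  "vector_field_along A B \<xi> \<longleftrightarrow>
     smooth_map_on B (tangent_atlas A) (points B) \<xi> \<and> (\<forall>p\<in>points B. fst (\<xi> p) = p)"

definition constant_length ::
  "('m, 'e) metric \<Rightarrow> ('m, 'f) chart set \<Rightarrow> ('m \<Rightarrow> ('m, 'e) tvec) \<Rightarrow> bool" where
  "constant_length g B \<xi> \<longleftrightarrow> (\<exists>r. \<forall>p\<in>points B. sqrt (g (\<xi> p) (\<xi> p)) = r)"

text \<open>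
  The covariant derivative of a vector field \<open>\<xi>\<close> of the ambient manifold along the submanifold in
  the direction of \<open>X\<close>. In coordinates, the components of \<open>K (\<xi>\<^sub>* X)\<close> are
  \<open>X(\<xi>\<^sup>a) + \<Gamma>\<^sup>a\<^sub>b\<^sub>c \<xi>\<^sup>b X\<^sup>c\<close>.
\<close>

definition cov_deriv ::
  "('m, 'e::euclidean_space) chart set \<Rightarrow> ('m, 'e) metric \<Rightarrow> ('m, 'f::euclidean_space) chart set
    \<Rightarrow> ('m \<Rightarrow> ('m, 'e) tvec) \<Rightarrow> ('m, 'f) tvec \<Rightarrow> ('m, 'e) tvec" where
  "cov_deriv A g B \<xi> X = connection_map A g (tangent_map B (tangent_atlas A) \<xi> X)"

definition parallel_along ::
  "('m, 'e::euclidean_space) chart set \<Rightarrow> ('m, 'e) metric \<Rightarrow> ('m, 'f::euclidean_space) chart set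
    \<Rightarrow> ('m \<Rightarrow> ('m, 'e) tvec) \<Rightarrow> bool" where
  "parallel_along A g B \<xi> \<longleftrightarrow>
     (\<forall>X\<in>tangent_bundle B. cov_deriv A g B \<xi> X = zero_vec (fst X))"

definition normal_component ::
  "('m, 'e::euclidean_space) chart set \<Rightarrow> ('m, 'e) metric \<Rightarrow> ('m, 'f::euclidean_space) chart set
    \<Rightarrow> ('m, 'e) tvec \<Rightarrow> ('m, 'e) tvec" where
  "normal_component A g B U =
     (let T = tangent_map B A id ` tangent_space B (fst U) in
      THE N. N \<in> tangent_space A (fst U) \<and> (\<forall>V\<in>T. g N V = 0) \<and> (\<exists>V\<in>T. U = add_vec V N))"

text \<open>
  The second fundamental form at the base point of \<open>X\<close>, for a vector \<open>X\<close> and a local vector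
  field \<open>Y\<close> tangent to the submanifold.
\<close>

definition second_fundamental_form ::
  "('m, 'e::euclidean_space) chart set \<Rightarrow> ('m, 'e) metric \<Rightarrow> ('m, 'f::euclidean_space) chart set
    \<Rightarrow> ('m, 'f) tvec \<Rightarrow> ('m \<Rightarrow> ('m, 'f) tvec) \<Rightarrow> ('m, 'e) tvec" where
  "second_fundamental_form A g B X Y =
     normal_component A g B (cov_deriv A g B (tangent_map B A id \<circ> Y) X)"

definition totally_geodesic_submanifold ::
  "('m, 'e::euclidean_space) chart set \<Rightarrow> ('m, 'e) metric \<Rightarrow> ('m, 'f::euclidean_space) chart set
    \<Rightarrow> bool" where
  "totally_geodesic_submanifold A g B \<longleftrightarrow>
     submanifold A B \<and>
     (\<forall>W Y. openin (atlas_topology B) W \<and> smooth_map_on B (tangent_atlas B) W Y \<and>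
            (\<forall>p\<in>W. fst (Y p) = p) \<longrightarrow>
        (\<forall>p\<in>W. \<forall>X\<in>tangent_space B p. second_fundamental_form A g B X Y = zero_vec p))"

text \<open>The image of a manifold under an injective map, with the transported smooth structure.\<close>

definition image_atlas ::
  "('m \<Rightarrow> 'k) \<Rightarrow> ('m, 'f) chart set \<Rightarrow> ('k, 'f) chart set" where
  "image_atlas \<xi> B = (\<lambda>c. (\<xi> ` cdom c, cmap c \<circ> inv_into (points B) \<xi>)) ` B"

end

theory Submission
  imports Defs
begin

text \<open>
  In charts of the two manifolds, \<open>\<xi>\<close> becomes a map \<open>h = (f, \<xi>)\<close> into the induced coordinates of \<open>TM\<close>,
  and an immersed submanifold is totally geodesic iff the covariant Hessian
  \<open>D\<^sup>2h(X,Y) + \<Gamma>(Dh X, Dh Y)\<close> is tangent for all \<open>X\<close>, \<open>Y\<close>. Let \<open>\<kappa>(X)\<close> denote the covariant derivative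
  of \<open>\<xi>\<close> along \<open>X\<close>. The Koszul formula of the Sasaki metric shows that the covariant Hessian of \<open>h\<close> at
  \<open>(X,X)\<close>, paired with the vertical lift of \<open>\<xi>\<close>, equals \<open>- |\<kappa>(X)|\<^sup>2\<close>; if it is tangent, say \<open>Dh Z\<close>, the
  pairing is also \<open>\<langle>\<kappa>(Z), \<xi>\<rangle>\<close>, which vanishes because \<open>\<xi>\<close> has constant length. So \<open>\<kappa> = 0\<close>. Conversely,
  where \<open>\<kappa>\<close> vanishes the covariant Hessian of \<open>h\<close> is the horizontal lift of that of \<open>f\<close>, by the
  product rule and the symmetry of second derivatives; the curvature never enters.
\<close>

section \<open>Smooth maps and second derivatives\<close>

text \<open>No closed formula for the Levi-Civita connection of the Sasaki metric is derived. The
  Hessian of \<open>h\<close> is only ever paired with selected vectors, and each pairing comes from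
  differentiating a scalar function known beforehand. In the first direction that function is
  \<langle>\<kappa>(X), \<xi>\<rangle>, identically 0; what the product rule leaves over is a
  derivative of the metric along the fibre, where only the Christoffel term of the vertical part
  moves. In the converse it is the product of Dh Y with a constant vector.

  Regularity shapes the set-up: Christoffel symbols are coefficients of the Sasaki metric, so one
  derivative of it costs two derivatives of the base metric. The two levels are kept apart, and the
  theory of immersions is developed at the lower one.

  The Hessian criterion itself rests on one observation: extending Y differently near the point
  changes the covariant derivative by a tangent vector only.\<close>

abbreviation FD :: "('a::euclidean_space \<Rightarrow> 'b::euclidean_space) \<Rightarrow> 'a \<Rightarrow> 'a \<Rightarrow> 'b" where
  "FD f x \<equiv> frechet_derivative f (at x)"

lemma FD_works: "f differentiable (at x) \<Longrightarrow> (f has_derivative FD f x) (at x)"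
  using frechet_derivative_works by blast

lemma FD_eqI: "(f has_derivative f') (at x) \<Longrightarrow> FD f x = f'"
  using frechet_derivative_at by metis

lemma linear_FD: "f differentiable (at x) \<Longrightarrow> linear (FD f x)"
  by (simp add: linear_frechet_derivative)

lemma has_derivative_cong_open:
  assumes "open N" "x \<in> N" "\<And>y. y \<in> N \<Longrightarrow> f y = g y"
  shows "(f has_derivative f') (at x) \<longleftrightarrow> (g has_derivative f') (at x)"
  using assms by (metis has_derivative_transform_within_open)

lemma differentiable_cong_open:
  assumes "open N" "x \<in> N" "\<And>y. y \<in> N \<Longrightarrow> f y = g y"
  shows "f differentiable (at x) \<longleftrightarrow> g differentiable (at x)"
  unfolding differentiable_def using has_derivative_cong_open[of N x f g, OF assms] by simp

lemma FD_cong_open: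
  assumes "open N" "x \<in> N" "\<And>y. y \<in> N \<Longrightarrow> f y = g y"
  shows "FD f x = FD g x"
  unfolding frechet_derivative_def using has_derivative_cong_open[of N x f g, OF assms] by simp

section \<open>Closure properties of smooth maps on open sets\<close>

lemma k_smooth_on_cong:
  assumes "open S" "\<And>y. y \<in> S \<Longrightarrow> f y = g y"
  shows "k_smooth_on k S f \<longleftrightarrow> k_smooth_on k S g"
  using assms(2)
proof (induction k arbitrary: f g)
  case 0
  then show ?case using continuous_on_cong[of S S f g] by simp
next
  case (Suc k)
  have "k_smooth_on k S (\<lambda>x. FD f x v) \<longleftrightarrow> k_smooth_on k S (\<lambda>x. FD g x v)" for v
    by (rule Suc.IH) (simp add: FD_cong_open[OF assms(1) _ Suc.prems])
  then show ?case using differentiable_cong_open[OF assms(1) _ Suc.prems] by auto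
qed

lemma smooth_on_cong:
  assumes "open S" "\<And>y. y \<in> S \<Longrightarrow> f y = g y"
  shows "smooth_on S f \<longleftrightarrow> smooth_on S g"
  using k_smooth_on_cong[OF assms] by (simp add: smooth_on_def)

lemma k_smooth_on_subset: "k_smooth_on k S f \<Longrightarrow> T \<subseteq> S \<Longrightarrow> k_smooth_on k T f"
  by (induction k arbitrary: f) (auto intro: continuous_on_subset)

lemma smooth_on_subset: "smooth_on S f \<Longrightarrow> T \<subseteq> S \<Longrightarrow> smooth_on T f"
  by (auto simp: smooth_on_def intro: k_smooth_on_subset)

lemma smooth_on_differentiable: "smooth_on S f \<Longrightarrow> x \<in> S \<Longrightarrow> f differentiable (at x)"
  unfolding smooth_on_def using k_smooth_on.simps(2) by blast

lemma smooth_on_FD: "smooth_on S f \<Longrightarrow> smooth_on S (\<lambda>x. FD f x v)"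
  unfolding smooth_on_def using k_smooth_on.simps(2) by blast

lemma smooth_on_continuous: "smooth_on S f \<Longrightarrow> continuous_on S f"
  unfolding smooth_on_def using k_smooth_on.simps(1) by blast

text \<open>A coinduction principle: differentiability at every point and stability under
  directional derivatives pass through all orders. The invariant \<open>P\<close> may be larger than
  the class of interest, as for linear maps, whose directional derivatives are constants.\<close>

lemma smooth_onI:
  assumes "\<And>f x. P f \<Longrightarrow> x \<in> S \<Longrightarrow> f differentiable (at x)"
    and "\<And>f v. P f \<Longrightarrow> P (\<lambda>x. FD f x v)" and "P f"
  shows "smooth_on S f"
proof -
  have "k_smooth_on k S f" for k
    using assms(3)
  proof (induction k arbitrary: f)
    case 0
    then show ?case
      using assms(1) by (auto intro: differentiable_imp_continuous_within continuous_at_imp_continuous_on)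
  qed (auto simp: assms)
  then show ?thesis by (simp add: smooth_on_def)
qed

lemma k_smooth_on_linear_comp:
  assumes "open S" "bounded_linear L" "k_smooth_on k S f"
  shows "k_smooth_on k S (\<lambda>x. L (f x))"
  using assms(3)
proof (induction k arbitrary: f)
  case 0
  then show ?case using assms(2) by (simp add: bounded_linear.continuous_on)
next
  case (Suc k)
  have hd: "((\<lambda>x. L (f x)) has_derivative (\<lambda>v. L (FD f x v))) (at x)" if "x \<in> S" for x
    using Suc.prems that by (intro bounded_linear.has_derivative[OF assms(2)] FD_works) auto
  have "k_smooth_on k S (\<lambda>x. FD (\<lambda>x. L (f x)) x v)" for v
    by (rule k_smooth_on_cong[THEN iffD1, OF assms(1) _ Suc.IH[of "\<lambda>x. FD f x v"]])
      (use Suc.prems FD_eqI[OF hd] in auto)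
  then show ?case using hd unfolding k_smooth_on.simps differentiable_def by blast
qed

lemma smooth_on_linear_comp:
  "open S \<Longrightarrow> bounded_linear L \<Longrightarrow> smooth_on S f \<Longrightarrow> smooth_on S (\<lambda>x. L (f x))"
  unfolding smooth_on_def using k_smooth_on_linear_comp by blast

lemma k_smooth_on_add:
  assumes "open S" "k_smooth_on k S f" "k_smooth_on k S g"
  shows "k_smooth_on k S (\<lambda>x. f x + g x)"
  using assms(2,3)
proof (induction k arbitrary: f g)
  case 0
  then show ?case by (simp add: continuous_on_add)
next
  case (Suc k)
  have hd: "((\<lambda>x. f x + g x) has_derivative (\<lambda>v. FD f x v + FD g x v)) (at x)" if "x \<in> S" for x
    using Suc.prems that by (intro has_derivative_add FD_works) auto
  have "k_smooth_on k S (\<lambda>x. FD (\<lambda>x. f x + g x) x v)" for v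
    by (rule k_smooth_on_cong[THEN iffD1, OF assms(1) _ Suc.IH[of "\<lambda>x. FD f x v" "\<lambda>x. FD g x v"]])
      (use Suc.prems FD_eqI[OF hd] in auto)
  then show ?case using hd unfolding k_smooth_on.simps differentiable_def by blast
qed

lemma smooth_on_add:
  "open S \<Longrightarrow> smooth_on S f \<Longrightarrow> smooth_on S g \<Longrightarrow> smooth_on S (\<lambda>x. f x + g x)"
  unfolding smooth_on_def using k_smooth_on_add by blast

lemma smooth_on_const: "smooth_on S (\<lambda>x. c)"
proof (rule smooth_onI[where P = "\<lambda>f. \<exists>c. f = (\<lambda>x. c)"])
  fix f :: "'a \<Rightarrow> 'b" and v assume "\<exists>c. f = (\<lambda>x. c)"
  then show "\<exists>c. (\<lambda>x. FD f x v) = (\<lambda>x. c)" using FD_eqI[OF has_derivative_const] by fastforce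
qed auto

lemma smooth_on_Pair:
  assumes "open S" "smooth_on S f" "smooth_on S g"
  shows "smooth_on S (\<lambda>x. (f x, g x))"
proof -
  have "smooth_on S (\<lambda>x. (f x, 0) + (0, g x))"
    by (intro smooth_on_add assms smooth_on_linear_comp[OF _ _ assms(2), of "\<lambda>y. (y, 0)"]
        smooth_on_linear_comp[OF _ _ assms(3), of "\<lambda>y. (0, y)"])
      (auto intro!: bounded_linear_intros)
  then show ?thesis by simp
qed

lemma has_derivative_fst_comp:
  assumes "f differentiable (at (fst p))"
  shows "((\<lambda>p. f (fst p)) has_derivative (\<lambda>v. FD f (fst p) (fst v))) (at p)"
  by (rule has_derivative_compose[of fst fst p UNIV f "FD f (fst p)"])
    (use FD_works[OF assms] in \<open>auto intro: derivative_eq_intros\<close>)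

lemma k_smooth_on_SucD: "k_smooth_on (Suc k) S f \<Longrightarrow> k_smooth_on k S f"
proof (induction k arbitrary: f)
  case 0
  then show ?case
    by (auto intro: continuous_at_imp_continuous_on differentiable_imp_continuous_within)
next
  case (Suc k)
  then have "k_smooth_on (Suc k) S (\<lambda>x. FD f x v)" for v
    using k_smooth_on.simps(2)[of "Suc k" S f] by blast
  with Suc show ?case by (subst k_smooth_on.simps(2)) auto
qed

text \<open>The asymmetric hypotheses suit the induction: at order \<open>Suc k\<close> the product
  rule reuses \<open>f\<close> one order lower and the derivative of \<open>r\<close> at full
  smoothness. In the chain rule \<open>r\<close> is a component of the derivative of the inner map,
  while the other factor is known only up to the order reached so far.\<close>

lemma k_smooth_on_scaleR:
  fixes r :: "'a::euclidean_space \<Rightarrow> real"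
  assumes "open S" "smooth_on S r" "k_smooth_on k S f"
  shows "k_smooth_on k S (\<lambda>x. r x *\<^sub>R f x)"
  using assms(2,3)
proof (induction k arbitrary: r f)
  case 0
  then show ?case using smooth_on_continuous[OF 0(1)] by (simp add: continuous_on_scaleR)
next
  case (Suc k)
  have hd: "((\<lambda>x. r x *\<^sub>R f x) has_derivative (\<lambda>v. r x *\<^sub>R FD f x v + FD r x v *\<^sub>R f x)) (at x)"
    if "x \<in> S" for x
    using Suc.prems(2) smooth_on_differentiable[OF Suc.prems(1)] that
    by (intro has_derivative_scaleR FD_works) auto
  have "k_smooth_on k S (\<lambda>x. FD (\<lambda>x. r x *\<^sub>R f x) x v)" for v
  proof (rule k_smooth_on_cong[THEN iffD1, OF assms(1)])
    show "k_smooth_on k S (\<lambda>x. r x *\<^sub>R FD f x v + FD r x v *\<^sub>R f x)"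
      using Suc.prems k_smooth_on_SucD[OF Suc.prems(2)]
      by (intro k_smooth_on_add assms(1) Suc.IH smooth_on_FD) auto
  qed (simp add: FD_eqI[OF hd])
  then show ?case using hd unfolding k_smooth_on.simps by (blast intro: differentiableI)
qed

lemma k_smooth_on_sum:
  fixes f :: "'i \<Rightarrow> 'a::euclidean_space \<Rightarrow> 'b::euclidean_space"
  assumes "open S" "\<And>i. i \<in> I \<Longrightarrow> k_smooth_on k S (f i)"
  shows "k_smooth_on k S (\<lambda>x. \<Sum>i\<in>I. f i x)"
  using assms(2)
proof (induction I rule: infinite_finite_induct)
  case (insert i I)
  then show ?case using k_smooth_on_add[OF assms(1), of k "f i"] by simp
qed (use smooth_on_const[of S "0 :: 'b"] in \<open>simp_all add: smooth_on_def\<close>)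

text \<open>The recursion in \<open>k_smooth_on\<close> differentiates in constant directions only,
  whereas the chain rule feeds the moving vector \<open>FD f x v\<close> into
  \<open>FD h (f x)\<close>. Expanding that vector in the basis leaves derivatives of
  \<open>h\<close> in constant directions, to which the induction hypothesis applies.\<close>

lemma smooth_on_compose:
  fixes f :: "'a::euclidean_space \<Rightarrow> 'b::euclidean_space" and h :: "'b \<Rightarrow> 'c::euclidean_space"
  assumes "open S" "smooth_on S f" "smooth_on T h" "f ` S \<subseteq> T"
  shows "smooth_on S (\<lambda>x. h (f x))"
proof -
  have "k_smooth_on k S (\<lambda>x. h (f x))" for k
    using assms(3)
  proof (induction k arbitrary: h)
    case 0
    show ?case
      using smooth_on_continuous[OF assms(2)] smooth_on_continuous[OF 0] assms(4)
      by (auto intro: continuous_on_compose2)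
  next
    case (Suc k)
    have hd: "((\<lambda>x. h (f x)) has_derivative (\<lambda>v. \<Sum>b\<in>Basis. (FD f x v \<bullet> b) *\<^sub>R FD h (f x) b)) (at x)"
      if x: "x \<in> S" for x
    proof -
      have f: "(f has_derivative FD f x) (at x)" by (rule FD_works[OF smooth_on_differentiable[OF assms(2) x]])
      have h: "(h has_derivative FD h (f x)) (at (f x))"
        by (rule FD_works[OF smooth_on_differentiable[OF Suc.prems]]) (use x assms(4) in auto)
      interpret linear "FD h (f x)" using h by (rule has_derivative_linear)
      have rep: "FD h (f x) w = (\<Sum>b\<in>Basis. (w \<bullet> b) *\<^sub>R FD h (f x) b)" for w
        by (subst (1) euclidean_representation[symmetric]) (simp add: sum scale)
      show ?thesis by (rule has_derivative_eq_rhs[OF has_derivative_compose[OF f h] ext]) (rule rep)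
    qed
    have "k_smooth_on k S (\<lambda>x. FD (\<lambda>x. h (f x)) x v)" for v
    proof (rule k_smooth_on_cong[THEN iffD1, OF assms(1)])
      have r: "smooth_on S (\<lambda>x. FD f x v \<bullet> b)" for b
        by (rule smooth_on_linear_comp[OF assms(1) bounded_linear_inner_left smooth_on_FD[OF assms(2)]])
      show "k_smooth_on k S (\<lambda>x. \<Sum>b\<in>Basis. (FD f x v \<bullet> b) *\<^sub>R FD h (f x) b)"
        by (intro k_smooth_on_sum k_smooth_on_scaleR assms(1) r Suc.IH smooth_on_FD Suc.prems)
    qed (simp add: FD_eqI[OF hd])
    then show ?case using hd unfolding k_smooth_on.simps by (blast intro: differentiableI)
  qed
  then show ?thesis by (simp add: smooth_on_def)
qed

lemma smooth_on_bounded_linear: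
  assumes "bounded_linear L"
  shows "smooth_on S L"
proof (rule smooth_onI[where P = "\<lambda>f. bounded_linear f \<or> (\<exists>c. f = (\<lambda>x. c))"])
  fix f :: "'a \<Rightarrow> 'b" and v assume "bounded_linear f \<or> (\<exists>c. f = (\<lambda>x. c))"
  then show "bounded_linear (\<lambda>x. FD f x v) \<or> (\<exists>c. (\<lambda>x. FD f x v) = (\<lambda>x. c))"
    using FD_eqI[OF has_derivative_const] FD_eqI[OF bounded_linear_imp_has_derivative] by fastforce
qed (use assms in \<open>auto intro: bounded_linear_imp_differentiable\<close>)

lemma smooth_on_fst_comp:
  assumes "open S" "smooth_on S f"
  shows "smooth_on (S \<times> UNIV) (\<lambda>p. f (fst p))"
  by (rule smooth_on_compose[where f = fst and h = f, OF _ _ assms(2)])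
    (use assms(1) in \<open>auto intro: open_Times smooth_on_bounded_linear bounded_linear_fst\<close>)

text \<open>Joint smoothness in point and vector, again by expanding the vector in the basis. This
  map is the fibre component of a coordinate change of the tangent bundle.\<close>

lemma smooth_on_FD_fst_snd:
  assumes "open S" "smooth_on S f"
  shows "smooth_on (S \<times> UNIV) (\<lambda>p. FD f (fst p) (snd p))"
proof -
  have op: "open (S \<times> (UNIV :: 'a set))" using assms by (simp add: open_Times)
  have "smooth_on (S \<times> UNIV) (\<lambda>p. \<Sum>b\<in>Basis. (snd p \<bullet> b) *\<^sub>R FD f (fst p) b)"
    unfolding smooth_on_def
  proof (intro allI k_smooth_on_sum k_smooth_on_scaleR op)
    show "smooth_on (S \<times> UNIV) (\<lambda>p. snd p \<bullet> b)" for b :: 'a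
      by (intro smooth_on_bounded_linear bounded_linear_compose[OF bounded_linear_inner_left bounded_linear_snd])
    show "k_smooth_on k (S \<times> UNIV) (\<lambda>p. FD f (fst p) b)" for k and b :: 'a
      by (rule smooth_on_fst_comp[OF assms(1) smooth_on_FD[OF assms(2)], unfolded smooth_on_def, rule_format])
  qed
  moreover have "(\<Sum>b\<in>Basis. (snd p \<bullet> b) *\<^sub>R FD f (fst p) b) = FD f (fst p) (snd p)"
    if "p \<in> S \<times> UNIV" for p
  proof -
    interpret linear "FD f (fst p)"
      using that smooth_on_differentiable[OF assms(2)] by (intro linear_FD) auto
    show ?thesis
      by (subst (2) euclidean_representation[symmetric]) (simp add: sum scale)
  qed
  ultimately show ?thesis
    using smooth_on_cong[OF op, of "\<lambda>p. \<Sum>b\<in>Basis. (snd p \<bullet> b) *\<^sub>R FD f (fst p) b" "\<lambda>p. FD f (fst p) (snd p)"]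
    by simp
qed

section \<open>Symmetry of second derivatives\<close>

lemma second_difference_mvt:
  fixes f :: "'a::euclidean_space \<Rightarrow> real"
  assumes "t > 0" and "\<And>s r. 0 \<le> s \<Longrightarrow> s \<le> t \<Longrightarrow> 0 \<le> r \<Longrightarrow> r \<le> t \<Longrightarrow> x + s *\<^sub>R u + r *\<^sub>R v \<in> S"
    and "\<And>y. y \<in> S \<Longrightarrow> f differentiable (at y)"
    and "\<And>y. y \<in> S \<Longrightarrow> (\<lambda>y. FD f y u) differentiable (at y)"
  shows "\<exists>s r. 0 < s \<and> s < t \<and> 0 < r \<and> r < t \<and>
    f (x + t *\<^sub>R u + t *\<^sub>R v) - f (x + t *\<^sub>R u) - f (x + t *\<^sub>R v) + f x
      = t * t * FD (\<lambda>y. FD f y u) (x + s *\<^sub>R u + r *\<^sub>R v) v"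
proof -
  have d1: "((\<lambda>s. f (x + s *\<^sub>R u + r *\<^sub>R v)) has_derivative (\<lambda>h. h * FD f (x + s *\<^sub>R u + r *\<^sub>R v) u)) (at s)"
    if "0 \<le> s" "s \<le> t" "0 \<le> r" "r \<le> t" for s r
  proof -
    have *: "f differentiable at (x + s *\<^sub>R u + r *\<^sub>R v)" using assms that by blast
    have "((\<lambda>s. f (x + s *\<^sub>R u + r *\<^sub>R v)) has_derivative
        (\<lambda>h. FD f (x + s *\<^sub>R u + r *\<^sub>R v) (h *\<^sub>R u))) (at s)"
      by (rule has_derivative_compose[of "\<lambda>s. x + s *\<^sub>R u + r *\<^sub>R v" "\<lambda>h. h *\<^sub>R u" s UNIV f, OF _ FD_works[OF *]]) (auto intro!: derivative_eq_intros)
    then show ?thesis by (simp add: linear_cmul[OF linear_FD[OF *]])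
  qed
  have d2: "((\<lambda>r. FD f (x + s *\<^sub>R u + r *\<^sub>R v) u) has_derivative
      (\<lambda>h. h * FD (\<lambda>y. FD f y u) (x + s *\<^sub>R u + r *\<^sub>R v) v)) (at r)"
    if "0 \<le> s" "s \<le> t" "0 \<le> r" "r \<le> t" for s r
  proof -
    have *: "(\<lambda>y. FD f y u) differentiable at (x + s *\<^sub>R u + r *\<^sub>R v)" using assms that by blast
    have "((\<lambda>r. FD f (x + s *\<^sub>R u + r *\<^sub>R v) u) has_derivative
        (\<lambda>h. FD (\<lambda>y. FD f y u) (x + s *\<^sub>R u + r *\<^sub>R v) (h *\<^sub>R v))) (at r)"
      by (rule has_derivative_compose[of "\<lambda>r. x + s *\<^sub>R u + r *\<^sub>R v" "\<lambda>h. h *\<^sub>R v" r UNIV "\<lambda>y. FD f y u",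
            OF _ FD_works[OF *]]) (auto intro!: derivative_eq_intros)
    then show ?thesis by (simp add: linear_cmul[OF linear_FD[OF *]])
  qed
  \<comment> \<open>The second difference is the increment over [0, t] of this first difference in
    direction \<open>v\<close>. One use of the mean value theorem turns it into a difference of
    first derivatives, a second use into a mixed derivative.\<close>
  define p where "p s = f (x + s *\<^sub>R u + t *\<^sub>R v) - f (x + s *\<^sub>R u + 0 *\<^sub>R v)" for s
  have "(p has_derivative (\<lambda>h. h * FD f (x + s *\<^sub>R u + t *\<^sub>R v) u - h * FD f (x + s *\<^sub>R u + 0 *\<^sub>R v) u)) (at s)"
    if "0 \<le> s" "s \<le> t" for s
    unfolding p_def using that assms(1) by (intro has_derivative_diff d1) auto
  then have "\<exists>s\<in>{0<..<t}. p t - p 0 =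
      (t - 0) * FD f (x + s *\<^sub>R u + t *\<^sub>R v) u - (t - 0) * FD f (x + s *\<^sub>R u + 0 *\<^sub>R v) u"
    using assms(1) by (intro mvt_simple) (auto intro: has_derivative_at_withinI)
  then obtain s where s: "0 < s" "s < t" "p t - p 0 =
      t * (FD f (x + s *\<^sub>R u + t *\<^sub>R v) u - FD f (x + s *\<^sub>R u + 0 *\<^sub>R v) u)"
    by (auto simp: algebra_simps)
  have "\<exists>r\<in>{0<..<t}. FD f (x + s *\<^sub>R u + t *\<^sub>R v) u - FD f (x + s *\<^sub>R u + 0 *\<^sub>R v) u =
      (t - 0) * FD (\<lambda>y. FD f y u) (x + s *\<^sub>R u + r *\<^sub>R v) v"
    using assms(1) d2 s by (intro mvt_simple) (auto intro: has_derivative_at_withinI)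
  then obtain r where "0 < r" "r < t" "FD f (x + s *\<^sub>R u + t *\<^sub>R v) u - FD f (x + s *\<^sub>R u + 0 *\<^sub>R v) u =
      t * FD (\<lambda>y. FD f y u) (x + s *\<^sub>R u + r *\<^sub>R v) v"
    by auto
  with s show ?thesis
    by (intro exI[of _ s] exI[of _ r]) (auto simp: p_def algebra_simps)
qed

text \<open>Exchanging \<open>u\<close> and \<open>v\<close> leaves the second difference unchanged,
  so the two mixed derivatives agree at a pair of points arbitrarily close to \<open>x\<close>;
  continuity of both derivatives does the rest.\<close>

lemma symmetric_second_FD_real:
  fixes f :: "'a::euclidean_space \<Rightarrow> real"
  assumes "open S" "x \<in> S" "smooth_on S f"
  shows "FD (\<lambda>y. FD f y u) x v = FD (\<lambda>y. FD f y v) x u"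
proof (rule ccontr)
  let ?A = "\<lambda>y. FD (\<lambda>y. FD f y u) y v" and ?B = "\<lambda>y. FD (\<lambda>y. FD f y v) y u"
  assume "?A x \<noteq> ?B x"
  define e where "e = \<bar>?A x - ?B x\<bar> / 2"
  have e: "e > 0" using \<open>?A x \<noteq> ?B x\<close> by (simp add: e_def)
  have cA: "continuous_on S ?A" and cB: "continuous_on S ?B"
    using assms(3) by (auto intro!: smooth_on_continuous smooth_on_FD)
  obtain d1 where d1: "d1 > 0" "\<And>y. y \<in> S \<Longrightarrow> dist y x < d1 \<Longrightarrow> \<bar>?A y - ?A x\<bar> < e"
    using cA assms(2) e unfolding continuous_on_iff dist_real_def by blast
  obtain d2 where d2: "d2 > 0" "\<And>y. y \<in> S \<Longrightarrow> dist y x < d2 \<Longrightarrow> \<bar>?B y - ?B x\<bar> < e"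
    using cB assms(2) e unfolding continuous_on_iff dist_real_def by blast
  obtain d3 where d3: "d3 > 0" "ball x d3 \<subseteq> S" using assms openE by blast
  define d where "d = min d1 (min d2 d3)"
  have d: "d > 0" using d1 d2 d3 by (simp add: d_def)
  \<comment> \<open>This keeps the parallelogram spanned at \<open>x\<close> by \<open>t\<close>
    times \<open>u\<close> and \<open>t\<close> times \<open>v\<close> within \<open>d / 2\<close>
    of \<open>x\<close>; the summand 1 keeps the denominator positive when both vectors
    vanish.\<close>
  define t where "t = d / (2 * (norm u + norm v + 1))"
  have n: "norm u + norm v + 1 > 0" by (smt (verit) norm_ge_zero)
  have t: "t > 0" using d n by (simp add: t_def)
  have close: "dist (x + s *\<^sub>R u + r *\<^sub>R v) x < d" if "0 \<le> s" "s \<le> t" "0 \<le> r" "r \<le> t" for s r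
  proof -
    have "dist (x + s *\<^sub>R u + r *\<^sub>R v) x \<le> s * norm u + r * norm v"
      using that norm_triangle_ineq[of "s *\<^sub>R u" "r *\<^sub>R v"] by (simp add: dist_norm add.assoc)
    also have "\<dots> \<le> t * norm u + t * norm v"
      using that by (intro add_mono mult_right_mono) auto
    also have "\<dots> \<le> t * (norm u + norm v + 1)" using t by (simp add: algebra_simps)
    also have "\<dots> = d / 2"
    proof -
      have "d / (2 * N) * N = d / 2" if "N > 0" for N :: real using that by simp
      from this[OF n] show ?thesis by (simp only: t_def)
    qed
    finally show ?thesis using d by simp
  qed
  have inS: "x + s *\<^sub>R u + r *\<^sub>R v \<in> S" if "0 \<le> s" "s \<le> t" "0 \<le> r" "r \<le> t" for s r
    using close[OF that] d3 by (auto simp: d_def dist_commute subset_iff)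
  have df: "f differentiable (at y)" "(\<lambda>y. FD f y w) differentiable (at y)" if "y \<in> S" for y w
    using that assms(3) by (auto intro!: smooth_on_differentiable smooth_on_FD)
  obtain s r where sr: "0 < s" "s < t" "0 < r" "r < t"
    "f (x + t *\<^sub>R u + t *\<^sub>R v) - f (x + t *\<^sub>R u) - f (x + t *\<^sub>R v) + f x
      = t * t * ?A (x + s *\<^sub>R u + r *\<^sub>R v)"
    using second_difference_mvt[of t x u v S f, OF t inS df] by blast
  have inS': "x + s *\<^sub>R v + r *\<^sub>R u \<in> S" if "0 \<le> s" "s \<le> t" "0 \<le> r" "r \<le> t" for s r
    using inS[OF that(3,4,1,2)] by (simp add: algebra_simps)
  obtain s' r' where sr': "0 < s'" "s' < t" "0 < r'" "r' < t"
    "f (x + t *\<^sub>R v + t *\<^sub>R u) - f (x + t *\<^sub>R v) - f (x + t *\<^sub>R u) + f x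
      = t * t * ?B (x + s' *\<^sub>R v + r' *\<^sub>R u)"
    using second_difference_mvt[of t x v u S f, OF t inS' df] by blast
  have eq: "?A (x + s *\<^sub>R u + r *\<^sub>R v) = ?B (x + r' *\<^sub>R u + s' *\<^sub>R v)"
    using sr(5) sr'(5) t by (simp add: algebra_simps)
  have "\<bar>?A (x + s *\<^sub>R u + r *\<^sub>R v) - ?A x\<bar> < e"
    using sr close[of s r] inS[of s r] by (intro d1) (auto simp: d_def)
  moreover have "\<bar>?B (x + r' *\<^sub>R u + s' *\<^sub>R v) - ?B x\<bar> < e"
    using sr' close[of r' s'] inS[of r' s'] by (intro d2) (auto simp: d_def)
  moreover have "\<bar>a - b\<bar> \<le> \<bar>p - a\<bar> + \<bar>p - b\<bar>" for a b p :: real by linarith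
  ultimately show False using eq unfolding e_def by (smt (verit) field_sum_of_halves)
qed

lemma symmetric_second_FD:
  fixes f :: "'a::euclidean_space \<Rightarrow> 'b::euclidean_space"
  assumes "open S" "x \<in> S" "smooth_on S f"
  shows "FD (\<lambda>y. FD f y u) x v = FD (\<lambda>y. FD f y v) x u"
proof (rule euclidean_eqI)
  fix b :: 'b
  have 1: "FD (\<lambda>y. f y \<bullet> b) y w = FD f y w \<bullet> b" if "y \<in> S" for y w
    using smooth_on_differentiable[OF assms(3) that]
    by (intro FD_eqI[THEN fun_cong] has_derivative_inner_left FD_works)
  have 2: "FD (\<lambda>y. FD (\<lambda>y. f y \<bullet> b) y w) x z = FD (\<lambda>y. FD f y w) x z \<bullet> b" for w z
  proof -
    have "FD (\<lambda>y. FD (\<lambda>y. f y \<bullet> b) y w) x = FD (\<lambda>y. FD f y w \<bullet> b) x"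
      by (rule FD_cong_open[OF assms(1,2)]) (rule 1)
    moreover have "FD (\<lambda>y. FD f y w \<bullet> b) x z = FD (\<lambda>y. FD f y w) x z \<bullet> b"
      using smooth_on_differentiable[OF smooth_on_FD[OF assms(3)] assms(2)]
      by (intro FD_eqI[THEN fun_cong] has_derivative_inner_left FD_works)
    ultimately show ?thesis by simp
  qed
  have "smooth_on S (\<lambda>y. f y \<bullet> b)"
    by (rule smooth_on_linear_comp[OF assms(1) _ assms(3)]) (rule bounded_linear_inner_left)
  from symmetric_second_FD_real[OF assms(1,2) this, of u v]
  show "FD (\<lambda>y. FD f y u) x v \<bullet> b = FD (\<lambda>y. FD f y v) x u \<bullet> b"
    by (simp add: 2)
qed

text \<open>A product rule that asks for differentiability of \<open>y \<mapsto> B y w\<close> at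
  each fixed \<open>w\<close> only. As each \<open>B y\<close> is linear on a finite-dimensional
  space, expanding \<open>\<phi> y\<close> in the basis leaves finitely many products of a scalar
  and a vector.\<close>

lemma has_derivative_linear_family:
  fixes B :: "'a::euclidean_space \<Rightarrow> 'b::euclidean_space \<Rightarrow> 'c::euclidean_space"
  assumes "open N" "x \<in> N" and lin: "\<And>y. y \<in> N \<Longrightarrow> linear (B y)"
    and diff: "\<And>w. (\<lambda>y. B y w) differentiable (at x)"
    and phi: "(\<phi> has_derivative \<phi>') (at x)"
  shows "((\<lambda>y. B y (\<phi> y)) has_derivative (\<lambda>u. FD (\<lambda>y. B y (\<phi> x)) x u + B x (\<phi>' u))) (at x)"
proof -
  have rep: "B y w = (\<Sum>b\<in>Basis. (w \<bullet> b) *\<^sub>R B y b)" if "y \<in> N" for y w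
  proof -
    interpret linear "B y" by (rule lin[OF that])
    show ?thesis by (subst (1) euclidean_representation[symmetric]) (simp add: sum scale)
  qed
  have *: "((\<lambda>y. \<Sum>b\<in>Basis. (\<phi> y \<bullet> b) *\<^sub>R B y b) has_derivative
     (\<lambda>u. \<Sum>b\<in>Basis. (\<phi> x \<bullet> b) *\<^sub>R FD (\<lambda>y. B y b) x u + (\<phi>' u \<bullet> b) *\<^sub>R B x b)) (at x)"
    by (intro has_derivative_sum has_derivative_scaleR has_derivative_inner_left phi FD_works diff)
  have "FD (\<lambda>y. B y (\<phi> x)) x = FD (\<lambda>y. \<Sum>b\<in>Basis. (\<phi> x \<bullet> b) *\<^sub>R B y b) x"
    by (rule FD_cong_open[OF assms(1,2)]) (rule rep)
  also have "\<dots> = (\<lambda>u. \<Sum>b\<in>Basis. (\<phi> x \<bullet> b) *\<^sub>R FD (\<lambda>y. B y b) x u)"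
    by (rule FD_eqI, rule has_derivative_sum, rule has_derivative_scaleR_right, rule FD_works, rule diff)
  finally have "(\<lambda>u. \<Sum>b\<in>Basis. (\<phi> x \<bullet> b) *\<^sub>R FD (\<lambda>y. B y b) x u + (\<phi>' u \<bullet> b) *\<^sub>R B x b)
      = (\<lambda>u. FD (\<lambda>y. B y (\<phi> x)) x u + B x (\<phi>' u))"
    using rep[OF assms(2), of "\<phi>' u" for u] by (simp only: sum.distrib fun_eq_iff) simp
  with * have "((\<lambda>y. \<Sum>b\<in>Basis. (\<phi> y \<bullet> b) *\<^sub>R B y b) has_derivative
     (\<lambda>u. FD (\<lambda>y. B y (\<phi> x)) x u + B x (\<phi>' u))) (at x)" by simp
  then show ?thesis
    using has_derivative_cong_open[OF assms(1,2), of "\<lambda>y. B y (\<phi> y)" "\<lambda>y. \<Sum>b\<in>Basis. (\<phi> y \<bullet> b) *\<^sub>R B y b"] rep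
    by blast
qed

text \<open>The linear product rule is used twice on the product of the three argument spaces, and
  the result is composed with \<open>z \<mapsto> (f z, \<phi> z, \<psi> z)\<close>. It serves
  metrics and Christoffel symbols alike.\<close>

lemma has_derivative_bilinear_family:
  fixes B :: "'a::euclidean_space \<Rightarrow> 'b::euclidean_space \<Rightarrow> 'c::euclidean_space \<Rightarrow> 'd::euclidean_space"
    and f :: "'p::euclidean_space \<Rightarrow> 'a"
  assumes "open N" "f y \<in> N" and bil: "\<And>z. z \<in> N \<Longrightarrow> bilinear (B z)"
    and diff: "\<And>u w. (\<lambda>z. B z u w) differentiable (at (f y))"
    and f: "(f has_derivative f') (at y)"
    and phi: "(\<phi> has_derivative \<phi>') (at y)" and psi: "(\<psi> has_derivative \<psi>') (at y)"
  shows "((\<lambda>z. B (f z) (\<phi> z) (\<psi> z)) has_derivative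
     (\<lambda>u. FD (\<lambda>z. B z (\<phi> y) (\<psi> y)) (f y) (f' u) + B (f y) (\<phi>' u) (\<psi> y) + B (f y) (\<phi> y) (\<psi>' u))) (at y)"
proof -
  have d1: "((\<lambda>p. B (fst p) (fst (snd p)) w) has_derivative
     (\<lambda>u. FD (\<lambda>z. B z (fst (snd p)) w) (fst p) (fst u) + B (fst p) (fst (snd u)) w)) (at p)"
    if p: "fst p = f y" for p :: "'a \<times> 'b \<times> 'c" and w
  proof -
    have N: "open (N \<times> (UNIV :: ('b \<times> 'c) set))" "p \<in> N \<times> UNIV"
      using p assms(1,2) by (auto simp: open_Times mem_Times_iff)
    have fs: "(\<lambda>q. B (fst q) v w) differentiable at p" and
      FDfs: "FD (\<lambda>q. B (fst q) v w) p = (\<lambda>u. FD (\<lambda>z. B z v w) (fst p) (fst u))" for v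
    proof -
      have *: "((\<lambda>q. B (fst q) v w) has_derivative (\<lambda>u. FD (\<lambda>z. B z v w) (fst p) (fst u))) (at p)"
        using diff p by (intro has_derivative_fst_comp) auto
      then show "(\<lambda>q. B (fst q) v w) differentiable at p" by (auto simp: differentiable_def)
      show "FD (\<lambda>q. B (fst q) v w) p = (\<lambda>u. FD (\<lambda>z. B z v w) (fst p) (fst u))"
        using * by (rule FD_eqI)
    qed
    have "((\<lambda>p. B (fst p) (fst (snd p)) w) has_derivative
     (\<lambda>u. FD (\<lambda>q. B (fst q) (fst (snd p)) w) p u + B (fst p) (fst (snd u)) w)) (at p)"
      using bil
      by (intro has_derivative_linear_family[OF N, where B = "\<lambda>q v. B (fst q) v w" and \<phi> = "\<lambda>q. fst (snd q)"]
          fs has_derivative_fst has_derivative_snd has_derivative_ident)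
        (auto simp: bilinear_def)
    then show ?thesis by (simp add: FDfs)
  qed
  have d2: "((\<lambda>p. B (fst p) (fst (snd p)) (snd (snd p))) has_derivative
     (\<lambda>u. FD (\<lambda>z. B z (fst (snd p)) (snd (snd p))) (fst p) (fst u) + B (fst p) (fst (snd u)) (snd (snd p))
       + B (fst p) (fst (snd p)) (snd (snd u)))) (at p)"
    if p: "fst p = f y" for p :: "'a \<times> 'b \<times> 'c"
  proof -
    have N: "open (N \<times> (UNIV :: ('b \<times> 'c) set))" "p \<in> N \<times> UNIV"
      using p assms(1,2) by (auto simp: open_Times mem_Times_iff)
    have fs: "(\<lambda>q. B (fst q) (fst (snd q)) w) differentiable at p" for w
      using d1[OF p] by (auto simp: differentiable_def)
    have "((\<lambda>p. B (fst p) (fst (snd p)) (snd (snd p))) has_derivative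
     (\<lambda>u. FD (\<lambda>q. B (fst q) (fst (snd q)) (snd (snd p))) p u + B (fst p) (fst (snd p)) (snd (snd u)))) (at p)"
      using bil
      by (intro has_derivative_linear_family[OF N, where B = "\<lambda>q v. B (fst q) (fst (snd q)) v" and \<phi> = "\<lambda>q. snd (snd q)"]
          fs has_derivative_snd has_derivative_ident)
        (auto simp: bilinear_def)
    then show ?thesis using FD_eqI[OF d1[OF p]] by simp
  qed
  have "((\<lambda>z. (f z, \<phi> z, \<psi> z)) has_derivative (\<lambda>u. (f' u, \<phi>' u, \<psi>' u))) (at y)"
    by (intro has_derivative_Pair f phi psi)
  from has_derivative_compose[OF this d2] show ?thesis by simp
qed

section \<open>Christoffel symbols of a metric in coordinates\<close>

text \<open>Twice the Christoffel symbol of the first kind, i.e. the Koszul expression for constant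
  fields, whose brackets vanish.\<close>

definition koszul :: "('a::euclidean_space \<Rightarrow> 'a \<Rightarrow> 'a \<Rightarrow> real) \<Rightarrow> 'a \<Rightarrow> 'a \<Rightarrow> 'a \<Rightarrow> 'a \<Rightarrow> real" where
  "koszul G x u w v =
     FD (\<lambda>y. G y w v) x u + FD (\<lambda>y. G y u v) x w - FD (\<lambda>y. G y u w) x v"

text \<open>Free of charts, so that it applies both to the base metric in coordinates and to
  \<open>sasaki_form\<close> on the product space.\<close>

definition christoffel_symbol :: "('a::euclidean_space \<Rightarrow> 'a \<Rightarrow> 'a \<Rightarrow> real) \<Rightarrow> 'a \<Rightarrow> 'a \<Rightarrow> 'a \<Rightarrow> 'a" where
  "christoffel_symbol G x u w = (THE z. \<forall>v. 2 * G x z v = koszul G x u w v)"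

lemma christoffel_eq_christoffel_symbol: "christoffel A g c = christoffel_symbol (metric_coord A g c)"
  by (intro ext) (simp add: christoffel_def christoffel_symbol_def koszul_def)

lemma christoffel_symbol_cong:
  assumes "open N" "x \<in> N" "\<And>y. y \<in> N \<Longrightarrow> G y = G' y"
  shows "christoffel_symbol G x = christoffel_symbol G' x"
proof -
  have "FD (\<lambda>y. G y u w) x = FD (\<lambda>y. G' y u w) x" for u w
    by (rule FD_cong_open[OF assms(1,2)]) (simp add: assms(3))
  then show ?thesis
    using assms(2,3) by (intro ext) (simp add: christoffel_symbol_def koszul_def)
qed

locale coord_metric =
  fixes S :: "'a::euclidean_space set" and G :: "'a \<Rightarrow> 'a \<Rightarrow> 'a \<Rightarrow> real"
  assumes open_S: "open S"
    and bil: "x \<in> S \<Longrightarrow> bilinear (G x)"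
    and sym: "x \<in> S \<Longrightarrow> G x u w = G x w u"
    and pos: "x \<in> S \<Longrightarrow> u \<noteq> 0 \<Longrightarrow> G x u u > 0"
    and diff: "x \<in> S \<Longrightarrow> (\<lambda>y. G y u w) differentiable (at x)"
begin

lemmas G_simps = bilinear_ladd[OF bil] bilinear_radd[OF bil] bilinear_lmul[OF bil] bilinear_rmul[OF bil]
  bilinear_lzero[OF bil] bilinear_rzero[OF bil] bilinear_lsub[OF bil] bilinear_rsub[OF bil]
  bilinear_lneg[OF bil] bilinear_rneg[OF bil]

lemma nondegenerate:
  assumes "x \<in> S" "\<And>v. G x a v = G x b v"
  shows "a = b"
proof (rule ccontr)
  assume "a \<noteq> b"
  then have "G x (a - b) (a - b) > 0" using pos assms(1) by simp
  then show False using assms by (simp add: G_simps)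
qed

text \<open>\<open>T z\<close> lists the values of \<open>G x z\<close> on the basis. Positivity
  makes \<open>T\<close> injective, and equality of dimensions then makes it surjective.\<close>

lemma riesz:
  assumes "x \<in> S" "linear l"
  shows "\<exists>z. \<forall>v. G x z v = l v"
proof -
  have rl: "linear (G x z)" for z using bil[OF assms(1)] by (simp add: bilinear_def)
  define T where "T z = (\<Sum>b\<in>Basis. G x z b *\<^sub>R b)" for z
  have TB: "T z \<bullet> b = G x z b" if "b \<in> Basis" for z b
    using that by (simp add: T_def inner_sum_left inner_Basis if_distrib sum.If_cases cong: if_cong)
  have ext_basis: "l1 = l2" if "linear l1" "linear l2" "\<And>b. b \<in> Basis \<Longrightarrow> l1 b = l2 b" for l1 l2 :: "'a \<Rightarrow> real"
    using that by (metis linear_eq_stdbasis)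
  have "linear T"
    unfolding T_def
    by (intro linearI) (simp_all add: G_simps assms(1) sum.distrib scaleR_add_left scaleR_sum_right)
  moreover have "inj T"
  proof (rule injI)
    fix z z' assume "T z = T z'"
    then have "G x z = G x z'" by (intro ext_basis rl) (metis TB)
    then show "z = z'" using nondegenerate[OF assms(1)] by metis
  qed
  ultimately have "surj T" by (rule linear_inj_imp_surj)
  then obtain z where "T z = (\<Sum>b\<in>Basis. l b *\<^sub>R b)" by (metis surjD)
  then have "G x z b = l b" if "b \<in> Basis" for b
    using TB[OF that, of z] that
    by (simp add: inner_sum_left inner_Basis if_distrib sum.If_cases cong: if_cong)
  then have "G x z = l" by (intro ext_basis rl assms(2))
  then show ?thesis by metis
qed

lemma FD_G_linear_left:
  assumes "x \<in> S"
  shows "FD (\<lambda>y. G y (a + b) w) x v = FD (\<lambda>y. G y a w) x v + FD (\<lambda>y. G y b w) x v"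
    and "FD (\<lambda>y. G y (r *\<^sub>R a) w) x v = r * FD (\<lambda>y. G y a w) x v"
proof -
  have "FD (\<lambda>y. G y (a + b) w) x = FD (\<lambda>y. G y a w + G y b w) x"
    by (rule FD_cong_open[OF open_S assms]) (simp add: G_simps)
  also have "\<dots> = (\<lambda>v. FD (\<lambda>y. G y a w) x v + FD (\<lambda>y. G y b w) x v)"
    by (rule FD_eqI, rule has_derivative_add; rule FD_works; rule diff; rule assms)
  finally show "FD (\<lambda>y. G y (a + b) w) x v = FD (\<lambda>y. G y a w) x v + FD (\<lambda>y. G y b w) x v" by simp
  have "FD (\<lambda>y. G y (r *\<^sub>R a) w) x = FD (\<lambda>y. r * G y a w) x"
    by (rule FD_cong_open[OF open_S assms]) (simp add: G_simps)
  also have "\<dots> = (\<lambda>v. r * FD (\<lambda>y. G y a w) x v)"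
    by (rule FD_eqI, rule has_derivative_mult_right, rule FD_works, rule diff, rule assms)
  finally show "FD (\<lambda>y. G y (r *\<^sub>R a) w) x v = r * FD (\<lambda>y. G y a w) x v" by simp
qed

lemma FD_G_sym:
  assumes "x \<in> S"
  shows "FD (\<lambda>y. G y a b) x = FD (\<lambda>y. G y b a) x"
  by (rule FD_cong_open[OF open_S assms]) (rule sym)

lemma FD_G_linear_right:
  assumes "x \<in> S"
  shows "FD (\<lambda>y. G y w (a + b)) x v = FD (\<lambda>y. G y w a) x v + FD (\<lambda>y. G y w b) x v"
    and "FD (\<lambda>y. G y w (r *\<^sub>R a)) x v = r * FD (\<lambda>y. G y w a) x v"
  unfolding FD_G_sym[OF assms, of w] using FD_G_linear_left[OF assms] by auto

lemma FD_G_linear: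
  assumes "x \<in> S"
  shows "FD (\<lambda>y. G y u w) x (a + b) = FD (\<lambda>y. G y u w) x a + FD (\<lambda>y. G y u w) x b"
    and "FD (\<lambda>y. G y u w) x (r *\<^sub>R a) = r * FD (\<lambda>y. G y u w) x a"
  using linear_FD[OF diff[OF assms]] by (auto simp: linear_add linear_cmul)

text \<open>Turns the definite description into a usable equation: \<open>koszul\<close> is linear
  in its last argument, hence represented by a vector, which is unique by nondegeneracy.\<close>

lemma christoffel_symbol_koszul:
  assumes "x \<in> S"
  shows "2 * G x (christoffel_symbol G x u w) v = koszul G x u w v"
proof -
  have "linear (\<lambda>v. koszul G x u w v / 2)"
    unfolding koszul_def
    by (intro linearI)
      (simp_all add: FD_G_linear_right[OF assms] FD_G_linear[OF assms] algebra_simps add_divide_distrib diff_divide_distrib)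
  then obtain z where z: "\<forall>v. G x z v = koszul G x u w v / 2" using riesz[OF assms] by blast
  have "\<forall>v. 2 * G x (christoffel_symbol G x u w) v = koszul G x u w v"
    unfolding christoffel_symbol_def
  proof (rule theI[of _ z])
    show "\<forall>v. 2 * G x z v = koszul G x u w v" by (simp add: z)
    fix z' assume "\<forall>v. 2 * G x z' v = koszul G x u w v"
    then show "z' = z" using z by (intro nondegenerate[OF assms]) (metis nonzero_mult_div_cancel_left zero_neq_numeral)
  qed
  then show ?thesis by blast
qed

lemma christoffel_symbol_eqI:
  assumes "x \<in> S" "\<And>v. 2 * G x z v = koszul G x u w v"
  shows "christoffel_symbol G x u w = z"
proof (rule nondegenerate[OF assms(1)])
  fix v
  show "G x (christoffel_symbol G x u w) v = G x z v" using assms(2)[of v] christoffel_symbol_koszul[OF assms(1), of u w v] by simp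
qed

lemma christoffel_symbol_sym:
  assumes "x \<in> S"
  shows "christoffel_symbol G x u w = christoffel_symbol G x w u"
  by (rule christoffel_symbol_eqI[OF assms])
    (simp add: christoffel_symbol_koszul[OF assms] koszul_def FD_G_sym[OF assms, of u w])

lemma bilinear_christoffel_symbol:
  assumes "x \<in> S"
  shows "bilinear (christoffel_symbol G x)"
proof -
  have 1: "christoffel_symbol G x (a + b) w = christoffel_symbol G x a w + christoffel_symbol G x b w" for a b w
    by (rule christoffel_symbol_eqI[OF assms])
      (simp add: G_simps assms distrib_left christoffel_symbol_koszul,
       simp add: koszul_def FD_G_linear_left[OF assms] FD_G_linear[OF assms])
  have 2: "christoffel_symbol G x (r *\<^sub>R a) w = r *\<^sub>R christoffel_symbol G x a w" for r a w
  proof (rule christoffel_symbol_eqI[OF assms])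
    fix v
    have "2 * G x (r *\<^sub>R christoffel_symbol G x a w) v = r * (2 * G x (christoffel_symbol G x a w) v)"
      by (simp add: G_simps assms)
    also have "\<dots> = koszul G x (r *\<^sub>R a) w v"
      by (simp add: christoffel_symbol_koszul[OF assms] koszul_def FD_G_linear_left[OF assms] FD_G_linear[OF assms]
          algebra_simps)
    finally show "2 * G x (r *\<^sub>R christoffel_symbol G x a w) v = koszul G x (r *\<^sub>R a) w v" .
  qed
  have "christoffel_symbol G x w (a + b) = christoffel_symbol G x w a + christoffel_symbol G x w b" "christoffel_symbol G x w (r *\<^sub>R a) = r *\<^sub>R christoffel_symbol G x w a" for a b w r
    using 1[of a b w] 2[of r a w] by (simp_all add: christoffel_symbol_sym[OF assms, of w])
  then show ?thesis
    unfolding bilinear_def by (auto intro!: linearI simp: 1 2)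
qed

text \<open>Adding the two Koszul expressions with \<open>u\<close> and \<open>w\<close> exchanged
  cancels every derivative of the metric except the one along \<open>v\<close>.\<close>

lemma metric_compatible:
  assumes "x \<in> S"
  shows "FD (\<lambda>y. G y u w) x v = G x (christoffel_symbol G x v u) w + G x u (christoffel_symbol G x v w)"
proof -
  have "2 * G x (christoffel_symbol G x v u) w + 2 * G x (christoffel_symbol G x v w) u = 2 * FD (\<lambda>y. G y u w) x v"
    unfolding christoffel_symbol_koszul[OF assms] koszul_def FD_G_sym[OF assms, of w u] by simp
  then show ?thesis using sym[OF assms] by simp
qed

text \<open>A sum such as \<open>\<phi>' u + christoffel_symbol G (f y) (\<phi> y) (f' u)\<close> is
  the covariant derivative of a field along \<open>f\<close>. So this is metric compatibility for
  fields along a map, whose source may have any dimension.\<close>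

lemma has_derivative_metric:
  fixes f :: "'p::euclidean_space \<Rightarrow> 'a"
  assumes "f y \<in> S" "(f has_derivative f') (at y)"
    "(\<phi> has_derivative \<phi>') (at y)" "(\<psi> has_derivative \<psi>') (at y)"
  shows "((\<lambda>z. G (f z) (\<phi> z) (\<psi> z)) has_derivative
     (\<lambda>u. G (f y) (\<phi>' u + christoffel_symbol G (f y) (\<phi> y) (f' u)) (\<psi> y)
        + G (f y) (\<phi> y) (\<psi>' u + christoffel_symbol G (f y) (\<psi> y) (f' u)))) (at y)"
proof -
  have "((\<lambda>z. G (f z) (\<phi> z) (\<psi> z)) has_derivative
     (\<lambda>u. FD (\<lambda>z. G z (\<phi> y) (\<psi> y)) (f y) (f' u) + G (f y) (\<phi>' u) (\<psi> y) + G (f y) (\<phi> y) (\<psi>' u))) (at y)"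
    by (rule has_derivative_bilinear_family[where B = G, OF open_S assms(1) bil diff[OF assms(1)] assms(2-4)])
  then show ?thesis
    using assms(1)
    by (simp add: metric_compatible G_simps christoffel_symbol_sym[OF assms(1), of "f' u" for u] algebra_simps)
qed

end

text \<open>Differentiating \<open>pull\<close> puts six terms with second derivatives of
  \<open>\<tau>\<close> into the Koszul expression; by symmetry of second derivatives four of them
  cancel and the other two coincide. Surjectivity of the differential allows testing the result
  against every vector.\<close>

lemma christoffel_symbol_transform:
  fixes \<tau> :: "'a::euclidean_space \<Rightarrow> 'a"
  assumes "coord_metric S G" "coord_metric S' G'"
    and "open N" "x \<in> N" "N \<subseteq> S" "\<tau> x \<in> S'"
    and smooth: "smooth_on N \<tau>" and surj: "surj (FD \<tau> x)"
    and pull: "\<And>y u w. y \<in> N \<Longrightarrow> G y u w = G' (\<tau> y) (FD \<tau> y u) (FD \<tau> y w)"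
  shows "FD (\<lambda>y. FD \<tau> y u) x w + christoffel_symbol G' (\<tau> x) (FD \<tau> x u) (FD \<tau> x w) = FD \<tau> x (christoffel_symbol G x u w)"
proof -
  interpret G: coord_metric S G by fact
  interpret G': coord_metric S' G' by fact
  let ?D2 = "\<lambda>u w. FD (\<lambda>y. FD \<tau> y u) x w"
  have D2sym: "?D2 u w = ?D2 w u" for u w by (rule symmetric_second_FD[OF assms(3,4) smooth])
  have x: "x \<in> S" using assms by blast
  have d\<tau>: "(\<tau> has_derivative FD \<tau> x) (at x)" "\<And>u. ((\<lambda>y. FD \<tau> y u) has_derivative ?D2 u) (at x)"
    using smooth_on_differentiable[OF smooth assms(4)] smooth_on_differentiable[OF smooth_on_FD[OF smooth] assms(4)]
    by (auto intro: FD_works)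
  have dG: "FD (\<lambda>y. G y u w) x s =
      FD (\<lambda>y. G' y (FD \<tau> x u) (FD \<tau> x w)) (\<tau> x) (FD \<tau> x s)
      + G' (\<tau> x) (?D2 u s) (FD \<tau> x w) + G' (\<tau> x) (FD \<tau> x u) (?D2 w s)" for u w s
  proof -
    have "FD (\<lambda>y. G y u w) x = FD (\<lambda>y. G' (\<tau> y) (FD \<tau> y u) (FD \<tau> y w)) x"
      by (rule FD_cong_open[OF assms(3,4) pull])
    then show ?thesis
      using FD_eqI[OF has_derivative_bilinear_family[where B = G', OF G'.open_S assms(6) G'.bil G'.diff[OF assms(6)] d\<tau>(1) d\<tau>(2)[of u] d\<tau>(2)[of w]]]
      by simp
  qed
  show ?thesis
  proof (rule G'.nondegenerate[OF assms(6)])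
    fix v
    obtain v' where v: "v = FD \<tau> x v'" using surj by (metis surjD)
    have lin: "linear (FD \<tau> x)" using d\<tau>(1) by (simp add: has_derivative_linear)
    have "2 * G x (christoffel_symbol G x u w) v' = 2 * G' (\<tau> x) (FD \<tau> x (christoffel_symbol G x u w)) v"
      by (simp add: pull[OF assms(4)] v)
    moreover have "2 * G x (christoffel_symbol G x u w) v' = 2 * G' (\<tau> x) (christoffel_symbol G' (\<tau> x) (FD \<tau> x u) (FD \<tau> x w)) v + 2 * G' (\<tau> x) (?D2 u w) v"
      unfolding G.christoffel_symbol_koszul[OF x] G'.christoffel_symbol_koszul[OF assms(6)] koszul_def dG v
      by (simp add: D2sym[of w u] D2sym[of v' u] D2sym[of v' w] G'.sym[OF assms(6)])
    ultimately show "G' (\<tau> x) (?D2 u w + christoffel_symbol G' (\<tau> x) (FD \<tau> x u) (FD \<tau> x w)) v = G' (\<tau> x) (FD \<tau> x (christoffel_symbol G x u w)) v"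
      by (simp add: G'.G_simps[OF assms(6)])
  qed
qed

text \<open>The extra derivative makes the Christoffel symbols differentiable, as they must be when
  they appear as coefficients of the Sasaki metric.\<close>

locale coord_metric2 = coord_metric +
  assumes diff2: "x \<in> S \<Longrightarrow> (\<lambda>y. FD (\<lambda>z. G z u w) y v) differentiable (at x)"
begin

text \<open>Raising an index is the inverse of \<open>(y, z) \<mapsto> (y, G y z)\<close>, hence differentiable by the inverse
  function theorem; this avoids matrix inverses.\<close>

lemma differentiable_christoffel_symbol:
  assumes x: "x \<in> S"
  shows "(\<lambda>y. christoffel_symbol G y u w) differentiable (at x)"
proof -
  define T where "T y z = (\<Sum>b\<in>Basis. G y z b *\<^sub>R b)" for y z
  have TB: "T y z \<bullet> b = G y z b" if "b \<in> Basis" for y z b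
    using that by (simp add: T_def inner_sum_left inner_Basis if_distrib sum.If_cases cong: if_cong)
  have linT: "linear (T y)" if "y \<in> S" for y
    unfolding T_def
    by (intro linearI) (simp_all add: G_simps that sum.distrib scaleR_add_left scaleR_sum_right)
  have injT: "inj (T y)" if y: "y \<in> S" for y
  proof (rule injI)
    fix z z' assume "T y z = T y z'"
    then have "G y z b = G y z' b" if "b \<in> Basis" for b using TB[OF that] by metis
    then have "G y z = G y z'" using bil[OF y] by (intro linear_eq_stdbasis) (auto simp: bilinear_def)
    then show "z = z'" using nondegenerate[OF y] by metis
  qed
  have surjT: "surj (T y)" if "y \<in> S" for y
    by (rule linear_inj_imp_surj[OF linT[OF that] injT[OF that]])
  have dT: "(\<lambda>y. T y z) differentiable (at y)" if "y \<in> S" for y z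
    unfolding T_def by (rule differentiable_sum) (auto intro!: differentiable_scaleR diff that)
  define r where "r y = (\<Sum>b\<in>Basis. (koszul G y u w b / 2) *\<^sub>R b)" for y
  have christoffel_symbol_r: "T y (christoffel_symbol G y u w) = r y" if "y \<in> S" for y
    unfolding T_def r_def by (rule sum.cong[OF refl]) (simp flip: christoffel_symbol_koszul[OF that])
  have dr: "r differentiable (at x)"
    unfolding r_def koszul_def using diff2[OF x]
    by (intro differentiable_sum differentiable_scaleR differentiable_divide differentiable_add differentiable_diff) auto
  define \<Phi> where "\<Phi> p = (fst p, T (fst p) (snd p))" for p
  define \<Psi> where "\<Psi> p = (fst p, inv (T (fst p)) (snd p))" for p
  have d\<Phi>: "(\<Phi> has_derivative (\<lambda>v. (fst v, FD (\<lambda>y. T y (snd p)) (fst p) (fst v) + T (fst p) (snd v)))) (at p)"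
    if p: "p \<in> S \<times> UNIV" for p
  proof -
    have op: "open (S \<times> (UNIV :: 'a set))" using open_S by (simp add: open_Times)
    have c: "((\<lambda>q. T (fst q) z) has_derivative (\<lambda>v. FD (\<lambda>y. T y z) (fst p) (fst v))) (at p)" for z
      using p by (intro has_derivative_fst_comp dT) auto
    have "((\<lambda>q. T (fst q) (snd q)) has_derivative
        (\<lambda>v. FD (\<lambda>q. T (fst q) (snd p)) p v + T (fst p) (snd v))) (at p)"
      using c linT
      by (intro has_derivative_linear_family[OF op p, where B = "\<lambda>q. T (fst q)"])
        (auto simp: differentiable_def intro: derivative_eq_intros)
    then have "((\<lambda>q. T (fst q) (snd q)) has_derivative
        (\<lambda>v. FD (\<lambda>y. T y (snd p)) (fst p) (fst v) + T (fst p) (snd v))) (at p)"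
      by (simp add: FD_eqI[OF c])
    then show ?thesis
      unfolding \<Phi>_def by (intro has_derivative_Pair has_derivative_fst has_derivative_ident)
  qed
  define p where "p = (x, christoffel_symbol G x u w)"
  have p: "p \<in> S \<times> UNIV" using x by (simp add: p_def)
  have \<Phi>p: "\<Phi> p = (x, r x)" using christoffel_symbol_r[OF x] by (simp add: \<Phi>_def p_def)
  \<comment> \<open>The derivative of \<open>\<Phi>\<close> at \<open>p\<close> is block triangular
    with the identity and \<open>T x\<close> on the diagonal; this is its inverse.\<close>
  let ?g = "\<lambda>v. (fst v, inv (T x) (snd v - FD (\<lambda>y. T y (snd p)) x (fst v)))"
  have "(\<Psi> has_derivative ?g) (at (\<Phi> p))"
  proof (rule has_derivative_inverse_strong[OF _ p _ _ d\<Phi>[OF p]])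
    show "open (S \<times> (UNIV :: 'a set))" using open_S by (simp add: open_Times)
    show "continuous_on (S \<times> UNIV) \<Phi>"
      using d\<Phi> by (meson continuous_at_imp_continuous_on has_derivative_continuous)
    show "\<Psi> (\<Phi> q) = q" if "q \<in> S \<times> UNIV" for q
      using that by (auto simp: \<Phi>_def \<Psi>_def inv_f_f[OF injT])
    show "(\<lambda>v. (fst v, FD (\<lambda>y. T y (snd p)) (fst p) (fst v) + T (fst p) (snd v))) \<circ> ?g = id"
      by (auto simp: fun_eq_iff p_def surj_f_inv_f[OF surjT[OF x]])
  qed
  moreover have "((\<lambda>y. (y, r y)) has_derivative (\<lambda>v. (v, FD r x v))) (at x)"
    by (intro has_derivative_Pair has_derivative_ident FD_works dr)
  ultimately have "((\<lambda>y. \<Psi> (y, r y)) has_derivative (\<lambda>v. ?g (v, FD r x v))) (at x)"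
    unfolding \<Phi>p by (intro has_derivative_compose[of "\<lambda>y. (y, r y)" _ x UNIV \<Psi>])
  then have "((\<lambda>y. snd (\<Psi> (y, r y))) has_derivative (\<lambda>v. snd (?g (v, FD r x v)))) (at x)"
    by (rule has_derivative_snd)
  moreover have "snd (\<Psi> (y, r y)) = christoffel_symbol G y u w" if "y \<in> S" for y
    by (simp add: \<Psi>_def inv_f_f[OF injT[OF that]] flip: christoffel_symbol_r[OF that])
  ultimately have "((\<lambda>y. christoffel_symbol G y u w) has_derivative (\<lambda>v. snd (?g (v, FD r x v)))) (at x)"
    by (simp only: has_derivative_cong_open[OF open_S x, of "\<lambda>y. snd (\<Psi> (y, r y))" "\<lambda>y. christoffel_symbol G y u w"])
  then show ?thesis by (auto simp: differentiable_def)
qed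

end

section \<open>The Sasaki metric in coordinates\<close>

text \<open>The connection map \<open>K\<close> in induced coordinates: \<open>p\<close> is a base
  point with a vector, \<open>P\<close> a tangent vector of the tangent bundle at
  \<open>p\<close>.\<close>

definition vertical_part :: "('a::euclidean_space \<Rightarrow> 'a \<Rightarrow> 'a \<Rightarrow> real) \<Rightarrow> 'a \<times> 'a \<Rightarrow> 'a \<times> 'a \<Rightarrow> 'a" where
  "vertical_part G p P = snd P + christoffel_symbol G (fst p) (snd p) (fst P)"

definition sasaki_form :: "('a::euclidean_space \<Rightarrow> 'a \<Rightarrow> 'a \<Rightarrow> real) \<Rightarrow> 'a \<times> 'a \<Rightarrow> 'a \<times> 'a \<Rightarrow> 'a \<times> 'a \<Rightarrow> real" where
  "sasaki_form G p P Q = G (fst p) (fst P) (fst Q) + G (fst p) (vertical_part G p P) (vertical_part G p Q)"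

text \<open>The covariant derivative along \<open>X\<close> of the image under \<open>h\<close> of the constant field \<open>Y\<close>.\<close>

definition covariant_hessian :: "('a::euclidean_space \<Rightarrow> 'a \<Rightarrow> 'a \<Rightarrow> real) \<Rightarrow> ('p::euclidean_space \<Rightarrow> 'a) \<Rightarrow> 'p \<Rightarrow> 'p \<Rightarrow> 'p \<Rightarrow> 'a" where
  "covariant_hessian G h y X Y = FD (\<lambda>z. FD h z Y) y X + christoffel_symbol G (h y) (FD h y Y) (FD h y X)"

text \<open>Metric compatibility along \<open>h\<close> for the image of a constant field. The
  results on lifted maps read the Hessian off from it: \<open>\<phi>\<close> is once the vertical
  lift of the vector field, once a constant.\<close>

lemma (in coord_metric) has_derivative_metric_covariant_hessian:
  assumes "smooth_on V h" "h ` V \<subseteq> S" "y \<in> V" "(\<phi> has_derivative \<phi>') (at y)"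
  shows "((\<lambda>z. G (h z) (FD h z Y) (\<phi> z)) has_derivative
    (\<lambda>X. G (h y) (covariant_hessian G h y X Y) (\<phi> y)
      + G (h y) (FD h y Y) (\<phi>' X + christoffel_symbol G (h y) (\<phi> y) (FD h y X)))) (at y)"
  unfolding covariant_hessian_def using assms
  by (intro has_derivative_metric FD_works smooth_on_differentiable[of V] smooth_on_FD) auto

lemma has_derivative_zeroD: "(f has_derivative f') (at y) \<Longrightarrow> open V \<Longrightarrow> y \<in> V \<Longrightarrow> (\<And>z. z \<in> V \<Longrightarrow> f z = c) \<Longrightarrow> f' X = 0"
  using has_derivative_cong_open[of V y f "\<lambda>_. c" f'] has_derivative_unique[OF _ has_derivative_const] by metis

context coord_metric2
begin

lemma linear_vertical_part: "fst p \<in> S \<Longrightarrow> linear (vertical_part G p)"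
  unfolding vertical_part_def using bilinear_christoffel_symbol[of "fst p"]
  by (intro linearI) (simp_all add: bilinear_radd bilinear_rmul scaleR_add_right)

lemmas vertical_part_simps = linear_add[OF linear_vertical_part] linear_cmul[OF linear_vertical_part] linear_0[OF linear_vertical_part]

lemma has_derivative_vertical_part:
  assumes "fst p \<in> S"
  shows "((\<lambda>q. vertical_part G q P) has_derivative
     (\<lambda>V. FD (\<lambda>x. christoffel_symbol G x (snd p) (fst P)) (fst p) (fst V) + christoffel_symbol G (fst p) (snd V) (fst P))) (at p)"
proof -
  have "((\<lambda>q. christoffel_symbol G (fst q) (snd q) (fst P)) has_derivative
     (\<lambda>V. FD (\<lambda>x. christoffel_symbol G x (snd p) (fst P)) (fst p) (fst V)
       + christoffel_symbol G (fst p) (snd V) (fst P) + christoffel_symbol G (fst p) (snd p) 0)) (at p)"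
    by (rule has_derivative_bilinear_family[where B = "christoffel_symbol G" and f = fst and \<phi> = snd and \<psi> = "\<lambda>_. fst P",
          OF open_S assms bilinear_christoffel_symbol differentiable_christoffel_symbol[OF assms]])
      (auto intro: derivative_eq_intros)
  then show ?thesis
    unfolding vertical_part_def using bilinear_rzero[OF bilinear_christoffel_symbol[OF assms]]
    by (auto intro!: derivative_eq_intros)
qed

lemma differentiable_vertical_part: "fst p \<in> S \<Longrightarrow> (\<lambda>q. vertical_part G q P) differentiable (at p)"
  using has_derivative_vertical_part[of p P] by (blast intro: differentiableI)

text \<open>The derivatives of \<open>vertical_part\<close> stay unevaluated. Written out, they
  contain derivatives of Christoffel symbols, the source of curvature; below they are either
  evaluated along the fibre or cancel by symmetry.\<close>

lemma FD_sasaki_form: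
  assumes "fst p \<in> S"
  shows "((\<lambda>q. sasaki_form G q P Q) has_derivative
     (\<lambda>V. FD (\<lambda>x. G x (fst P) (fst Q)) (fst p) (fst V)
       + (FD (\<lambda>x. G x (vertical_part G p P) (vertical_part G p Q)) (fst p) (fst V)
       + G (fst p) (FD (\<lambda>q. vertical_part G q P) p V) (vertical_part G p Q)
       + G (fst p) (vertical_part G p P) (FD (\<lambda>q. vertical_part G q Q) p V)))) (at p)"
  unfolding sasaki_form_def
proof (rule has_derivative_add)
  show "((\<lambda>q. G (fst q) (fst P) (fst Q)) has_derivative
      (\<lambda>V. FD (\<lambda>x. G x (fst P) (fst Q)) (fst p) (fst V))) (at p)"
    by (rule has_derivative_fst_comp) (rule diff[OF assms])
  have c: "((\<lambda>q. vertical_part G q R) has_derivative FD (\<lambda>q. vertical_part G q R) p) (at p)" for R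
    by (rule FD_works[OF differentiable_vertical_part[OF assms]])
  show "((\<lambda>q. G (fst q) (vertical_part G q P) (vertical_part G q Q)) has_derivative
      (\<lambda>V. FD (\<lambda>x. G x (vertical_part G p P) (vertical_part G p Q)) (fst p) (fst V)
       + G (fst p) (FD (\<lambda>q. vertical_part G q P) p V) (vertical_part G p Q)
       + G (fst p) (vertical_part G p P) (FD (\<lambda>q. vertical_part G q Q) p V))) (at p)"
    by (rule has_derivative_bilinear_family[where B = G and f = fst, OF open_S assms bil diff[OF assms] _ c c])
      (auto intro: derivative_eq_intros)
qed

text \<open>Definiteness holds because a vector is determined by its base component and its vertical
  part: once \<open>fst P\<close> is 0, the vertical part is \<open>snd P\<close>.\<close>

lemma coord_metric_sasaki_form: "coord_metric (S \<times> UNIV) (sasaki_form G)"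
proof
  show "open (S \<times> (UNIV :: 'a set))" using open_S by (simp add: open_Times)
next
  fix p :: "'a \<times> 'a" assume "p \<in> S \<times> UNIV"
  then have p: "fst p \<in> S" by auto
  show "bilinear (sasaki_form G p)"
    unfolding bilinear_def sasaki_form_def
    by (intro conjI allI linearI) (simp_all add: vertical_part_simps[OF p] G_simps[OF p] algebra_simps)
  fix P Q :: "'a \<times> 'a"
  show "sasaki_form G p P Q = sasaki_form G p Q P" by (simp add: sasaki_form_def sym[OF p])
  show "(\<lambda>q. sasaki_form G q P Q) differentiable at p" by (rule differentiableI, rule FD_sasaki_form[OF p])
  have nonneg: "G (fst p) u u \<ge> 0" for u
    using pos[OF p, of u] G_simps[OF p] by (cases "u = 0") auto
  show "0 < sasaki_form G p P P" if "P \<noteq> 0"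
  proof (cases "fst P = 0")
    case True
    then have "vertical_part G p P = snd P" "snd P \<noteq> 0"
      using that bilinear_rzero[OF bilinear_christoffel_symbol[OF p]] by (auto simp: vertical_part_def prod_eq_iff)
    then show ?thesis using nonneg[of "fst P"] pos[OF p, of "snd P"] by (simp add: sasaki_form_def)
  next
    case False
    then show ?thesis using nonneg[of "vertical_part G p P"] pos[OF p, of "fst P"] by (simp add: sasaki_form_def)
  qed
qed

sublocale sasaki_form: coord_metric "S \<times> UNIV" "sasaki_form G" by (rule coord_metric_sasaki_form)

end

section \<open>Covariant Hessians of a map lifted by a vector field\<close>

locale lifted_immersion = coord_metric2 S G for S :: "'a::euclidean_space set" and G +
  fixes V :: "'p::euclidean_space set" and f \<xi> :: "'p \<Rightarrow> 'a" and h :: "'p \<Rightarrow> 'a \<times> 'a"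
  assumes open_V: "open V" and smooth_f: "smooth_on V f" and smooth_xi: "smooth_on V \<xi>"
    and fV: "f ` V \<subseteq> S"
    and h_eq: "\<And>y. h y = (f y, \<xi> y)"
begin

abbreviation \<kappa> :: "'p \<Rightarrow> 'p \<Rightarrow> 'a" where "\<kappa> y X \<equiv> vertical_part G (h y) (FD h y X)"

lemma h_fun: "h = (\<lambda>y. (f y, \<xi> y))" by (rule ext) (rule h_eq)

lemma smooth_h: "smooth_on V h"
  unfolding h_fun by (intro smooth_on_Pair open_V smooth_f smooth_xi)

lemma hV: "h ` V \<subseteq> S \<times> UNIV" using fV by (auto simp: h_eq)

lemma FD_h: "y \<in> V \<Longrightarrow> FD h y X = (FD f y X, FD \<xi> y X)"
  unfolding h_fun
  by (rule FD_eqI[THEN fun_cong])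
    (intro has_derivative_Pair FD_works smooth_on_differentiable[OF smooth_f] smooth_on_differentiable[OF smooth_xi])

lemma kappa_eq: "y \<in> V \<Longrightarrow> \<kappa> y X = FD \<xi> y X + christoffel_symbol G (f y) (\<xi> y) (FD f y X)"
  by (simp add: vertical_part_def FD_h h_eq)

theorem tangent_covariant_hessian_imp_parallel:
  assumes const: "\<And>z. z \<in> V \<Longrightarrow> G (f z) (\<xi> z) (\<xi> z) = r"
    and y: "y \<in> V" and covariant_hessian: "covariant_hessian (sasaki_form G) h y X X = FD h y Z"
  shows "\<kappa> y X = 0"
proof -
  have S: "f z \<in> S" if "z \<in> V" for z using fV that by auto
  have hS: "h y \<in> S \<times> UNIV" using hV y by auto
  \<comment> \<open>Half the derivative of the constant squared length.\<close>
  have orth: "G (f z) (\<kappa> z W) (\<xi> z) = 0" if z: "z \<in> V" for z W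
  proof -
    have "((\<lambda>z. G (f z) (\<xi> z) (\<xi> z)) has_derivative
     (\<lambda>u. G (f z) (FD \<xi> z u + christoffel_symbol G (f z) (\<xi> z) (FD f z u)) (\<xi> z)
        + G (f z) (\<xi> z) (FD \<xi> z u + christoffel_symbol G (f z) (\<xi> z) (FD f z u)))) (at z)"
      using S[OF z] smooth_on_differentiable[OF smooth_f z] smooth_on_differentiable[OF smooth_xi z]
      by (intro has_derivative_metric[of f z "FD f z" \<xi> "FD \<xi> z" \<xi> "FD \<xi> z"] FD_works)
    from has_derivative_zeroD[OF this open_V z const, of W]
    show ?thesis by (simp add: kappa_eq z sym[OF S[OF z], of "\<xi> z"])
  qed
  \<comment> \<open>The vertical lift of \<xi> at \<open>h y\<close>; its Sasaki product with a
    vector involves only the vertical part of that vector.\<close>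
  let ?e = "(0, \<xi> y)"
  have d: "((\<lambda>z. (0 :: 'a, \<xi> z)) has_derivative (\<lambda>X. (0, FD \<xi> y X))) (at y)"
    by (intro has_derivative_Pair has_derivative_const FD_works smooth_on_differentiable[OF smooth_xi y])
  have vertical_part_vert: "vertical_part G (h z) (0, b) = b" if "z \<in> V" for z b
    using bilinear_rzero[OF bilinear_christoffel_symbol[OF S[OF that]]] by (simp add: vertical_part_def h_eq)
  have vert: "sasaki_form G (h z) P (0, b) = G (f z) (vertical_part G (h z) P) b" if "z \<in> V" for z P b
    using G_simps[OF S[OF that]] vertical_part_vert[OF that] by (simp add: sasaki_form_def h_eq)
  \<comment> \<open>By \<open>vert\<close> and \<open>orth\<close> the function
    \<open>z \<mapsto> sasaki_form G (h z) (FD h z X) (0, \<xi> z)\<close> vanishes on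
    \<open>V\<close>; this is its derivative along \<open>X\<close>.\<close>
  have "sasaki_form G (h y) (covariant_hessian (sasaki_form G) h y X X) ?e
      + sasaki_form G (h y) (FD h y X) ((0, FD \<xi> y X) + christoffel_symbol (sasaki_form G) (h y) ?e (FD h y X)) = 0"
    by (rule has_derivative_zeroD[OF sasaki_form.has_derivative_metric_covariant_hessian[OF smooth_h hV y d] open_V y])
      (simp add: vert orth)
  moreover have "sasaki_form G (h y) (covariant_hessian (sasaki_form G) h y X X) ?e = 0"
    by (simp add: covariant_hessian vert[OF y] orth[OF y])
  \<comment> \<open>By metric compatibility the left side is the derivative, in the fibre direction
    \<open>?e\<close>, of the squared Sasaki norm of the fixed vector \<open>FD h y X\<close>.
    Moving along the fibre changes only the Christoffel term of its vertical part, which is linear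
    in the fibre coordinate.\<close>
  moreover have "2 * sasaki_form G (h y) (FD h y X) (christoffel_symbol (sasaki_form G) (h y) ?e (FD h y X))
      = 2 * G (f y) (\<kappa> y X) (christoffel_symbol G (f y) (\<xi> y) (FD f y X))"
  proof -
    have "2 * sasaki_form G (h y) (FD h y X) (christoffel_symbol (sasaki_form G) (h y) ?e (FD h y X)) =
        FD (\<lambda>p. sasaki_form G p (FD h y X) (FD h y X)) (h y) ?e"
      using sasaki_form.metric_compatible[OF hS, of "FD h y X" "FD h y X" ?e] sasaki_form.sym[OF hS] by simp
    also have "\<dots> = 2 * G (f y) (\<kappa> y X) (FD (\<lambda>q. vertical_part G q (FD h y X)) (h y) ?e)"
      using S[OF y] FD_G_linear(2)[OF S[OF y], of _ _ 0 0]
      by (subst FD_eqI[OF FD_sasaki_form]) (auto simp: h_eq sym)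
    also have "FD (\<lambda>q. vertical_part G q (FD h y X)) (h y) ?e = christoffel_symbol G (f y) (\<xi> y) (FD f y X)"
      using S[OF y] linear_0[OF linear_FD[OF differentiable_christoffel_symbol[OF S[OF y]]]]
      by (subst FD_eqI[OF has_derivative_vertical_part]) (auto simp: h_eq FD_h[OF y])
    finally show ?thesis .
  qed
  \<comment> \<open>The right-hand arguments are the two summands of \<open>\<kappa> y X\<close>, so
    together they give its squared length.\<close>
  ultimately have "G (f y) (\<kappa> y X) (FD \<xi> y X) + G (f y) (\<kappa> y X) (christoffel_symbol G (f y) (\<xi> y) (FD f y X)) = 0"
    by (simp add: sasaki_form.G_simps[OF hS] vert[OF y])
  then have "G (f y) (\<kappa> y X) (\<kappa> y X) = 0"
    by (simp only: kappa_eq[OF y, symmetric] flip: G_simps(2)[OF S[OF y]])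
  then show ?thesis using pos[OF S[OF y]] by fastforce
qed

text \<open>For constant \<open>W\<close> the function
  \<open>z \<mapsto> sasaki_form G (h z) (FD h z Y) W\<close> equals
  \<open>G (f z) (FD f z Y) (fst W)\<close>, because \<open>FD h z Y\<close> is horizontal.
  Differentiating it by either connection yields one of the Hessians plus a Christoffel term, and
  the Koszul formula identifies the two Christoffel terms.\<close>

lemma sasaki_form_covariant_hessian:
  assumes par: "\<And>z X. z \<in> V \<Longrightarrow> \<kappa> z X = 0" and y: "y \<in> V"
  shows "sasaki_form G (h y) (covariant_hessian (sasaki_form G) h y X Y) W = G (f y) (covariant_hessian G f y X Y) (fst W)"
proof -
  have S: "f z \<in> S" if "z \<in> V" for z using fV that by auto
  have hS: "h y \<in> S \<times> UNIV" using hV y by auto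
  have hor: "sasaki_form G (h z) (FD h z X) Q = G (f z) (FD f z X) (fst Q)" if "z \<in> V" for z X Q
    unfolding sasaki_form_def par[OF that] using that by (simp add: G_simps[OF S] h_eq FD_h)
  let ?P = "FD h y Y" and ?Q = "FD h y X"
  define dk where "dk R T = FD (\<lambda>q. vertical_part G q R) (h y) T" for R T
  \<comment> \<open>Differentiating the identity \<kappa> = 0 trades the derivative of
    \<open>vertical_part\<close> in its base point for the vertical part of a second derivative of
    \<open>h\<close>.\<close>
  have dk: "dk (FD h y B) (FD h y A) = - vertical_part G (h y) (FD (\<lambda>z. FD h z B) y A)" for A B
  proof -
    have h': "(h has_derivative FD h y) (at y)"
      by (rule FD_works) (rule smooth_on_differentiable[OF smooth_h y])
    have k: "((\<lambda>z. vertical_part G (h z) R) has_derivative (\<lambda>A. dk R (FD h y A))) (at y)" for R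
    proof -
      have "((\<lambda>q. vertical_part G q R) has_derivative dk R) (at (h y))"
        unfolding dk_def using S[OF y] by (intro FD_works differentiable_vertical_part) (simp add: h_eq)
      from has_derivative_compose[OF h' this] show ?thesis .
    qed
    have "((\<lambda>z. vertical_part G (h z) (FD h z B)) has_derivative
        (\<lambda>A. FD (\<lambda>z. vertical_part G (h z) (FD h y B)) y A + vertical_part G (h y) (FD (\<lambda>z. FD h z B) y A))) (at y)"
    proof (rule has_derivative_linear_family[where B = "\<lambda>z. vertical_part G (h z)", OF open_V y])
      show "linear (vertical_part G (h z))" if "z \<in> V" for z using linear_vertical_part S[OF that] by (simp add: h_eq)
      show "(\<lambda>z. vertical_part G (h z) R) differentiable at y" for R by (rule differentiableI, rule k)
      show "((\<lambda>z. FD h z B) has_derivative FD (\<lambda>z. FD h z B) y) (at y)"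
        by (rule FD_works) (rule smooth_on_differentiable[OF smooth_on_FD[OF smooth_h] y])
    qed
    from has_derivative_zeroD[OF this open_V y par, of A] show ?thesis
      by (simp add: FD_eqI[OF k] eq_neg_iff_add_eq_0)
  qed
  \<comment> \<open>The symmetry replaces the curvature term of the Sasaki connection.\<close>
  have dk_sym: "dk ?P ?Q = dk ?Q ?P"
    unfolding dk by (simp add: symmetric_second_FD[OF open_V y smooth_h])
  have FD0: "FD (\<lambda>x. G x 0 u) (f y) v = 0" "FD (\<lambda>x. G x u 0) (f y) v = 0" for u v
    using FD_G_linear_left(2)[OF S[OF y], of 0 0] FD_G_linear_right(2)[OF S[OF y], of _ 0 0] by auto
  have k0: "vertical_part G (h y) ?P = 0" "vertical_part G (h y) ?Q = 0" using par[OF y] by auto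
  have FDs: "FD (\<lambda>q. sasaki_form G q A B) (h y) T =
       FD (\<lambda>x. G x (fst A) (fst B)) (f y) (fst T)
       + (FD (\<lambda>x. G x (vertical_part G (h y) A) (vertical_part G (h y) B)) (f y) (fst T)
       + G (f y) (dk A T) (vertical_part G (h y) B)
       + G (f y) (vertical_part G (h y) A) (dk B T))" for A B T
    using S[OF y] by (subst FD_eqI[OF FD_sasaki_form]) (auto simp: h_eq dk_def)
  have christoffel_symbol: "sasaki_form G (h y) ?P (christoffel_symbol (sasaki_form G) (h y) W ?Q) = G (f y) (FD f y Y) (christoffel_symbol G (f y) (fst W) (FD f y X))"
  proof -
    have "2 * sasaki_form G (h y) (christoffel_symbol (sasaki_form G) (h y) W ?Q) ?P = koszul (sasaki_form G) (h y) W ?Q ?P"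
      by (rule sasaki_form.christoffel_symbol_koszul[OF hS])
    \<comment> \<open>Terms with a vertical part of \<open>?P\<close> or \<open>?Q\<close> vanish.
      Beyond the base metric there remains the vertical part of \<open>W\<close> paired with
      \<open>dk ?P ?Q - dk ?Q ?P\<close>, which is 0 by \<open>dk_sym\<close>.\<close>
    also have "\<dots> = koszul G (f y) (fst W) (FD f y X) (FD f y Y)"
      unfolding koszul_def FDs k0
      by (simp add: FD0 G_simps[OF S[OF y]] FD_h[OF y] dk_sym[unfolded FD_h[OF y]] sym[OF S[OF y]])
    also have "\<dots> = 2 * G (f y) (christoffel_symbol G (f y) (fst W) (FD f y X)) (FD f y Y)"
      by (rule christoffel_symbol_koszul[OF S[OF y], symmetric])
    finally show ?thesis by (simp add: sasaki_form.sym[OF hS, of ?P] sym[OF S[OF y], of "FD f y Y"])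
  qed
  have c: "((\<lambda>z. C) has_derivative (\<lambda>X. 0)) (at y)" for C :: "'a \<times> 'a" by simp
  have c': "((\<lambda>z. C) has_derivative (\<lambda>X. 0)) (at y)" for C :: 'a by simp
  have "((\<lambda>z. sasaki_form G (h z) (FD h z Y) W) has_derivative
     (\<lambda>X. G (f y) (covariant_hessian G f y X Y) (fst W) + G (f y) (FD f y Y) (0 + christoffel_symbol G (f y) (fst W) (FD f y X)))) (at y)"
    using has_derivative_metric_covariant_hessian[OF smooth_f fV y c', of Y "fst W"]
      has_derivative_cong_open[OF open_V y, of "\<lambda>z. sasaki_form G (h z) (FD h z Y) W" "\<lambda>z. G (f z) (FD f z Y) (fst W)"] hor
    by simp
  from has_derivative_unique[OF this sasaki_form.has_derivative_metric_covariant_hessian[OF smooth_h hV y c, of Y W]]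
  have "G (f y) (covariant_hessian G f y X Y) (fst W) + G (f y) (FD f y Y) (0 + christoffel_symbol G (f y) (fst W) (FD f y X))
      = sasaki_form G (h y) (covariant_hessian (sasaki_form G) h y X Y) W + sasaki_form G (h y) ?P (0 + christoffel_symbol (sasaki_form G) (h y) W ?Q)"
    by (rule fun_cong)
  then show ?thesis by (simp add: christoffel_symbol)
qed

text \<open>With \<kappa> = 0 the Hessian and \<open>FD h y Z\<close> are both horizontal, so they
  agree as soon as their base components do, with the same \<open>Z\<close>.\<close>

theorem tangent_covariant_hessian_iff:
  assumes par: "\<And>z X. z \<in> V \<Longrightarrow> \<kappa> z X = 0" and y: "y \<in> V"
  shows "covariant_hessian (sasaki_form G) h y X Y = FD h y Z \<longleftrightarrow> covariant_hessian G f y X Y = FD f y Z"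
proof -
  have S: "f y \<in> S" using fV y by auto
  have hS: "h y \<in> S \<times> UNIV" using hV y by auto
  have hor: "sasaki_form G (h y) (FD h y Z) W = G (f y) (FD f y Z) (fst W)" for W
    unfolding sasaki_form_def par[OF y] by (simp add: G_simps[OF S] h_eq FD_h[OF y])
  show ?thesis
  proof
    assume "covariant_hessian (sasaki_form G) h y X Y = FD h y Z"
    then show "covariant_hessian G f y X Y = FD f y Z"
      using sasaki_form_covariant_hessian[OF par y, of X Y "(v, 0)" for v] hor[of "(v, 0)" for v]
      by (intro nondegenerate[OF S]) auto
  next
    assume "covariant_hessian G f y X Y = FD f y Z"
    then show "covariant_hessian (sasaki_form G) h y X Y = FD h y Z"
      using sasaki_form_covariant_hessian[OF par y, of X Y] hor
      by (intro sasaki_form.nondegenerate[OF hS]) auto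
  qed
qed

end

section \<open>Tangent vectors and differentials in charts\<close>

locale atlas =
  fixes A :: "('m, 'e::euclidean_space) chart set"
  assumes smooth_atlas: "smooth_atlas A"
begin

lemma inj_chart: "c \<in> A \<Longrightarrow> inj_on (cmap c) (cdom c)"
  using smooth_atlas by (simp add: smooth_atlas_def)

lemma open_chart: "c \<in> A \<Longrightarrow> open (cmap c ` cdom c)"
  using smooth_atlas by (simp add: smooth_atlas_def)

lemma open_overlap: "c \<in> A \<Longrightarrow> d \<in> A \<Longrightarrow> open (cmap c ` (cdom c \<inter> cdom d))"
  using smooth_atlas by (simp add: smooth_atlas_def)

lemma smooth_transition: "c \<in> A \<Longrightarrow> d \<in> A \<Longrightarrow> smooth_on (cmap c ` (cdom c \<inter> cdom d)) (transition c d)"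
  using smooth_atlas by (simp add: smooth_atlas_def)

lemma cinv_cmap [simp]: "c \<in> A \<Longrightarrow> p \<in> cdom c \<Longrightarrow> cinv c (cmap c p) = p"
  by (simp add: inj_chart)

lemma transition_cmap: "c \<in> A \<Longrightarrow> p \<in> cdom c \<Longrightarrow> transition c d (cmap c p) = cmap d p"
  by (simp add: transition_def)

lemma differentiable_transition:
  "c \<in> A \<Longrightarrow> d \<in> A \<Longrightarrow> p \<in> cdom c \<Longrightarrow> p \<in> cdom d \<Longrightarrow> transition c d differentiable at (cmap c p)"
  by (rule smooth_on_differentiable[OF smooth_transition]) auto

lemma FD_transition_self:
  assumes "c \<in> A" "p \<in> cdom c"
  shows "FD (transition c c) (cmap c p) = (\<lambda>u. u)"
proof -
  have "FD (transition c c) (cmap c p) = FD (\<lambda>x. x) (cmap c p)"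
    using assms by (intro FD_cong_open[OF open_chart[OF assms(1)]]) (auto simp: transition_cmap)
  then show ?thesis using FD_eqI[OF has_derivative_ident] by metis
qed

lemma FD_transition_trans:
  assumes "c \<in> A" "d \<in> A" "e \<in> A" "p \<in> cdom c" "p \<in> cdom d" "p \<in> cdom e"
  shows "FD (transition d e) (cmap d p) (FD (transition c d) (cmap c p) u) = FD (transition c e) (cmap c p) u"
proof -
  have "((\<lambda>x. transition d e (transition c d x)) has_derivative
      (\<lambda>u. FD (transition d e) (cmap d p) (FD (transition c d) (cmap c p) u))) (at (cmap c p))"
    by (rule has_derivative_compose[of "transition c d" "FD (transition c d) (cmap c p)" "cmap c p" UNIV "transition d e"])
      (use assms in \<open>auto intro!: FD_works differentiable_transition simp: transition_cmap\<close>)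
  moreover have "FD (\<lambda>x. transition d e (transition c d x)) (cmap c p) = FD (transition c e) (cmap c p)"
    using assms
    by (intro FD_cong_open[OF open_overlap[of c d]]) (auto simp: transition_cmap)
  ultimately show ?thesis by (metis FD_eqI)
qed

lemma surj_FD_transition:
  assumes "c \<in> A" "d \<in> A" "p \<in> cdom c" "p \<in> cdom d"
  shows "surj (FD (transition c d) (cmap c p))"
  using assms FD_transition_trans[of d c d p] FD_transition_self[of d p] by (metis surjI)

lemma tangent_spaceD:
  assumes "V \<in> tangent_space A p"
  shows "fst V = p" "p \<in> points A"
    "c \<in> A \<Longrightarrow> d \<in> A \<Longrightarrow> p \<in> cdom c \<Longrightarrow> p \<in> cdom d \<Longrightarrow> snd V d = FD (transition c d) (cmap c p) (snd V c)"
    "\<not> (c \<in> A \<and> p \<in> cdom c) \<Longrightarrow> snd V c = 0"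
proof -
  show p: "fst V = p" using assms unfolding tangent_space_def by blast
  have "V \<in> tangent_bundle A" using assms unfolding tangent_space_def by blast
  note * = this[unfolded tangent_bundle_def case_prod_unfold mem_Collect_eq p]
  show "p \<in> points A"
    "c \<in> A \<Longrightarrow> d \<in> A \<Longrightarrow> p \<in> cdom c \<Longrightarrow> p \<in> cdom d \<Longrightarrow> snd V d = FD (transition c d) (cmap c p) (snd V c)"
    "\<not> (c \<in> A \<and> p \<in> cdom c) \<Longrightarrow> snd V c = 0"
    using * by blast+
qed

lemma tangent_spaceI:
  assumes "fst V = p" "p \<in> points A"
    "\<And>c d. c \<in> A \<Longrightarrow> d \<in> A \<Longrightarrow> p \<in> cdom c \<Longrightarrow> p \<in> cdom d \<Longrightarrow> snd V d = FD (transition c d) (cmap c p) (snd V c)"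
    "\<And>c. \<not> (c \<in> A \<and> p \<in> cdom c) \<Longrightarrow> snd V c = 0"
  shows "V \<in> tangent_space A p"
  unfolding tangent_space_def tangent_bundle_def case_prod_unfold mem_Collect_eq assms(1)
  using assms(2-4) by blast

lemma tangent_space_eqI:
  assumes "V \<in> tangent_space A p" "W \<in> tangent_space A p" "c \<in> A" "p \<in> cdom c" "snd V c = snd W c"
  shows "V = W"
proof (rule prod_eqI)
  show "fst V = fst W" using assms tangent_spaceD(1) by metis
  show "snd V = snd W"
  proof
    fix d
    show "snd V d = snd W d"
      using tangent_spaceD(3)[OF assms(1,3), of d] tangent_spaceD(3)[OF assms(2,3), of d]
        tangent_spaceD(4)[OF assms(1), of d] tangent_spaceD(4)[OF assms(2), of d] assms(4,5)
      by metis
  qed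
qed

lemma coord_vec_in: "c \<in> A \<Longrightarrow> p \<in> cdom c \<Longrightarrow> coord_vec A c p u \<in> tangent_space A p"
  by (rule tangent_spaceI) (auto simp: coord_vec_def points_def FD_transition_trans)

lemma snd_coord_vec: "d \<in> A \<Longrightarrow> p \<in> cdom d \<Longrightarrow> snd (coord_vec A c p u) d = FD (transition c d) (cmap c p) u"
  by (simp add: coord_vec_def)

lemma snd_coord_vec_self [simp]: "c \<in> A \<Longrightarrow> p \<in> cdom c \<Longrightarrow> snd (coord_vec A c p u) c = u"
  by (simp add: snd_coord_vec FD_transition_self)

lemma fst_coord_vec [simp]: "fst (coord_vec A c p u) = p"
  by (simp add: coord_vec_def)

lemma coord_vec_snd: "V \<in> tangent_space A p \<Longrightarrow> c \<in> A \<Longrightarrow> p \<in> cdom c \<Longrightarrow> coord_vec A c p (snd V c) = V"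
  by (rule tangent_space_eqI[OF coord_vec_in]) auto

lemma coord_vec_change:
  assumes "c \<in> A" "d \<in> A" "p \<in> cdom c" "p \<in> cdom d"
  shows "coord_vec A d p (FD (transition c d) (cmap c p) u) = coord_vec A c p u"
  by (rule tangent_space_eqI[of _ p _ d]) (use assms in \<open>auto intro: coord_vec_in simp: snd_coord_vec\<close>)

lemma metric_eq_coord:
  assumes "V \<in> tangent_space A p" "W \<in> tangent_space A p" "c \<in> A" "p \<in> cdom c"
  shows "g V W = metric_coord A g c (cmap c p) (snd V c) (snd W c)"
  using assms by (simp add: metric_coord_def coord_vec_snd)

text \<open>Supplies the hypothesis \<open>pull\<close> of the transformation law for Christoffel
  symbols.\<close>

lemma metric_coord_pullback:
  assumes "c \<in> A" "d \<in> A" "y \<in> cmap c ` (cdom c \<inter> cdom d)"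
  shows "metric_coord A g c y u w =
    metric_coord A g d (transition c d y) (FD (transition c d) y u) (FD (transition c d) y w)"
  using assms by (auto simp: metric_coord_def transition_cmap coord_vec_change)

lemma zero_vec_in: "p \<in> points A \<Longrightarrow> zero_vec p \<in> tangent_space A p"
proof -
  assume p: "p \<in> points A"
  have "FD (transition c d) (cmap c p) 0 = 0" if "c \<in> A" "d \<in> A" "p \<in> cdom c" "p \<in> cdom d" for c d
    by (rule linear_0[OF linear_FD[OF differentiable_transition[OF that]]])
  with p show ?thesis by (intro tangent_spaceI) (simp_all add: zero_vec_def)
qed

lemma add_vec_in:
  assumes "V \<in> tangent_space A p" "W \<in> tangent_space A p"
  shows "add_vec V W \<in> tangent_space A p"
proof -
  note V = tangent_spaceD[OF assms(1)] and W = tangent_spaceD[OF assms(2)]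
  show ?thesis
  proof (rule tangent_spaceI)
    show "snd (add_vec V W) d = FD (transition c d) (cmap c p) (snd (add_vec V W) c)"
      if "c \<in> A" "d \<in> A" "p \<in> cdom c" "p \<in> cdom d" for c d
      using V(3)[OF that] W(3)[OF that] linear_add[OF linear_FD[OF differentiable_transition[OF that]]]
      by (simp add: add_vec_def)
  qed (use V(1,2,4) W(4) in \<open>simp_all add: add_vec_def\<close>)
qed

lemma tangent_bundle_iff: "V \<in> tangent_bundle A \<longleftrightarrow> V \<in> tangent_space A (fst V)"
  by (simp add: tangent_space_def)

end

text \<open>Enough for the chain rule at one point: \<open>N\<close> records that \<open>f\<close>
  stays in the chart domain nearby. The condition can be checked directly for the bundle projection
  and for the image of a tangent field under the inclusion, without proving these maps
  smooth.\<close>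

definition differentiable_map_at where
  "differentiable_map_at A B f p \<longleftrightarrow> (\<forall>c\<in>A. \<forall>d\<in>B. p \<in> cdom c \<longrightarrow> f p \<in> cdom d \<longrightarrow>
     (\<exists>N. open N \<and> cmap c p \<in> N \<and> N \<subseteq> cmap c ` cdom c \<and> (\<forall>x\<in>N. f (cinv c x) \<in> cdom d) \<and>
        (cmap d \<circ> f \<circ> cinv c) differentiable (at (cmap c p))))"

locale two_atlases = A: atlas A + B: atlas B
  for A :: "('m, 'e::euclidean_space) chart set" and B :: "('k, 'f::euclidean_space) chart set"
begin

text \<open>Near \<open>cmap c p\<close> both sides differentiate the same map, with the coordinate
  change inserted either in the source or in the target.\<close>

lemma FD_coord_change:
  assumes f: "differentiable_map_at A B f p" and c: "c \<in> A" "c' \<in> A" "p \<in> cdom c" "p \<in> cdom c'"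
    and d: "d \<in> B" "d' \<in> B" "f p \<in> cdom d" "f p \<in> cdom d'"
  shows "FD (cmap d' \<circ> f \<circ> cinv c') (cmap c' p) (FD (transition c c') (cmap c p) u)
    = FD (transition d d') (cmap d (f p)) (FD (cmap d \<circ> f \<circ> cinv c) (cmap c p) u)"
proof -
  obtain N where N: "open N" "cmap c p \<in> N" "N \<subseteq> cmap c ` cdom c" "\<forall>x\<in>N. f (cinv c x) \<in> cdom d"
    "(cmap d \<circ> f \<circ> cinv c) differentiable (at (cmap c p))"
    using f c d unfolding differentiable_map_at_def by blast
  have diff': "(cmap d' \<circ> f \<circ> cinv c') differentiable (at (cmap c' p))"
    using f c d unfolding differentiable_map_at_def by blast
  let ?F = "cmap d \<circ> f \<circ> cinv c" and ?F' = "cmap d' \<circ> f \<circ> cinv c'"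
  have 1: "((\<lambda>x. ?F' (transition c c' x)) has_derivative
      (\<lambda>u. FD ?F' (cmap c' p) (FD (transition c c') (cmap c p) u))) (at (cmap c p))"
  proof (rule has_derivative_compose[of "transition c c'" "FD (transition c c') (cmap c p)" "cmap c p" UNIV ?F'])
    show "(transition c c' has_derivative FD (transition c c') (cmap c p)) (at (cmap c p))"
      by (rule FD_works[OF A.differentiable_transition[OF c]])
    show "(?F' has_derivative FD ?F' (cmap c' p)) (at (transition c c' (cmap c p)))"
      unfolding A.transition_cmap[OF c(1,3)] by (rule FD_works[OF diff'])
  qed
  have 2: "((\<lambda>x. transition d d' (?F x)) has_derivative
      (\<lambda>u. FD (transition d d') (cmap d (f p)) (FD ?F (cmap c p) u))) (at (cmap c p))"
  proof (rule has_derivative_compose[of ?F "FD ?F (cmap c p)" "cmap c p" UNIV "transition d d'"])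
    show "(?F has_derivative FD ?F (cmap c p)) (at (cmap c p))" by (rule FD_works[OF N(5)])
    have "?F (cmap c p) = cmap d (f p)" using c by simp
    then show "(transition d d' has_derivative FD (transition d d') (cmap d (f p))) (at (?F (cmap c p)))"
      using FD_works[OF B.differentiable_transition[OF d]] by (simp only:)
  qed
  have 3: "FD (\<lambda>x. ?F' (transition c c' x)) (cmap c p) = FD (\<lambda>x. transition d d' (?F x)) (cmap c p)"
  proof (rule FD_cong_open)
    show "open (N \<inter> cmap c ` (cdom c \<inter> cdom c'))" using N A.open_overlap c by blast
    show "cmap c p \<in> N \<inter> cmap c ` (cdom c \<inter> cdom c')" using N c by blast
    fix y assume y: "y \<in> N \<inter> cmap c ` (cdom c \<inter> cdom c')"
    then obtain q where q: "y = cmap c q" "q \<in> cdom c" "q \<in> cdom c'" by blast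
    then have "f q \<in> cdom d" using N(4) y c by auto
    then show "?F' (transition c c' y) = transition d d' (?F y)"
      using q c d by (simp add: A.transition_cmap B.transition_cmap)
  qed
  show ?thesis
    using fun_cong[OF FD_eqI[OF 1], of u] fun_cong[OF FD_eqI[OF 2], of u] unfolding 3 by (rule trans[OF sym])
qed

text \<open>Replaces the chart that \<open>tangent_map\<close> picks by \<open>SOME\<close> with an
  arbitrary chart at the base point.\<close>

lemma snd_tangent_map:
  assumes f: "differentiable_map_at A B f p" and c: "c \<in> A" "p \<in> cdom c" and d: "d \<in> B" "f p \<in> cdom d"
    and V: "V \<in> tangent_space A p"
  shows "snd (tangent_map A B f V) d = FD (cmap d \<circ> f \<circ> cinv c) (cmap c p) (snd V c)"
proof -
  define c0 where "c0 = (SOME c. c \<in> A \<and> p \<in> cdom c)"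
  have c0: "c0 \<in> A" "p \<in> cdom c0" using someI[of "\<lambda>c. c \<in> A \<and> p \<in> cdom c" c] c by (auto simp: c0_def)
  have "snd (tangent_map A B f V) d = FD (cmap d \<circ> f \<circ> cinv c0) (cmap c0 p) (snd V c0)"
    using d A.tangent_spaceD(1)[OF V] by (simp add: tangent_map_def Let_def c0_def)
  also have "\<dots> = FD (cmap d \<circ> f \<circ> cinv c0) (cmap c0 p) (FD (transition c c0) (cmap c p) (snd V c))"
    using A.tangent_spaceD(3)[OF V c(1) c0(1) c(2) c0(2)] by simp
  also have "\<dots> = FD (cmap d \<circ> f \<circ> cinv c) (cmap c p) (snd V c)"
    by (subst FD_coord_change[OF f c(1) c0(1) c(2) c0(2) d(1) d(1) d(2) d(2)]) (simp add: B.FD_transition_self d)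
  finally show ?thesis .
qed

lemma tangent_map_in:
  assumes f: "differentiable_map_at A B f p" and "f p \<in> points B" and V: "V \<in> tangent_space A p"
  shows "tangent_map A B f V \<in> tangent_space B (f p)"
proof -
  obtain c where c: "c \<in> A" "p \<in> cdom c" using A.tangent_spaceD(2)[OF V] by (auto simp: points_def)
  have fst: "fst (tangent_map A B f V) = f p"
    using A.tangent_spaceD(1)[OF V] by (simp add: tangent_map_def Let_def)
  have "snd (tangent_map A B f V) d' = FD (transition d d') (cmap d (f p)) (snd (tangent_map A B f V) d)"
    if d: "d \<in> B" "d' \<in> B" "f p \<in> cdom d" "f p \<in> cdom d'" for d d'
    using FD_coord_change[OF f c(1) c(1) c(2) c(2) d, of "snd V c"]
    by (simp add: snd_tangent_map[OF f c _ _ V] d A.FD_transition_self c)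
  moreover have "snd (tangent_map A B f V) d = 0" if "\<not> (d \<in> B \<and> f p \<in> cdom d)" for d
    using that A.tangent_spaceD(1)[OF V] by (auto simp: tangent_map_def Let_def)
  ultimately show ?thesis
    using assms(2) fst by (intro B.tangent_spaceI) blast+
qed

lemma smooth_map_on_imp_differentiable_map_at:
  assumes "smooth_map_on A B W f" "p \<in> W"
  shows "differentiable_map_at A B f p"
  unfolding differentiable_map_at_def
proof (intro ballI impI)
  fix c d assume c: "c \<in> A" "d \<in> B" "p \<in> cdom c" "f p \<in> cdom d"
  let ?N = "cmap c ` (cdom c \<inter> W \<inter> f -` cdom d)"
  have "open ?N" "smooth_on ?N (cmap d \<circ> f \<circ> cinv c)"
    using assms(1) c by (auto simp: smooth_map_on_def)
  moreover have "cmap c p \<in> ?N" using assms(2) c by blast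
  moreover have "\<forall>x\<in>?N. f (cinv c x) \<in> cdom d" using c by auto
  ultimately show "\<exists>N. open N \<and> cmap c p \<in> N \<and> N \<subseteq> cmap c ` cdom c \<and> (\<forall>x\<in>N. f (cinv c x) \<in> cdom d) \<and>
        (cmap d \<circ> f \<circ> cinv c) differentiable (at (cmap c p))"
    by (intro exI[of _ ?N]) (auto intro: smooth_on_differentiable)
qed

end

section \<open>The atlas of the tangent bundle\<close>

context atlas
begin

lemma cdom_tangent_chart: "cdom (tangent_chart A c) = {V \<in> tangent_bundle A. fst V \<in> cdom c}"
  by (simp add: tangent_chart_def)

lemma cmap_tangent_chart: "cmap (tangent_chart A c) V = (cmap c (fst V), snd V c)"
  by (simp add: tangent_chart_def)

lemma mem_cdom_tangent_chart: "V \<in> tangent_space A p \<Longrightarrow> V \<in> cdom (tangent_chart A c) \<longleftrightarrow> p \<in> cdom c"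
  by (auto simp: cdom_tangent_chart tangent_space_def)

lemma inj_tangent_chart:
  assumes "c \<in> A"
  shows "inj_on (cmap (tangent_chart A c)) (cdom (tangent_chart A c))"
proof (rule inj_onI)
  fix V W assume V: "V \<in> cdom (tangent_chart A c)" "W \<in> cdom (tangent_chart A c)"
    "cmap (tangent_chart A c) V = cmap (tangent_chart A c) W"
  then have "fst V = fst W"
    using inj_chart[OF assms] by (auto simp: cdom_tangent_chart cmap_tangent_chart inj_on_def)
  then show "V = W"
    using V assms
    by (intro tangent_space_eqI[of V "fst V" W c]) (auto simp: cdom_tangent_chart cmap_tangent_chart tangent_bundle_iff)
qed

lemma cinv_tangent_chart:
  assumes "c \<in> A" "x \<in> cmap c ` cdom c"
  shows "cinv (tangent_chart A c) (x, \<eta>) = coord_vec A c (cinv c x) \<eta>"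
proof -
  obtain p where p: "x = cmap c p" "p \<in> cdom c" using assms by blast
  have "coord_vec A c p \<eta> \<in> cdom (tangent_chart A c)"
    using mem_cdom_tangent_chart[OF coord_vec_in] assms p by blast
  moreover have "cmap (tangent_chart A c) (coord_vec A c p \<eta>) = (x, \<eta>)"
    using assms p by (simp add: cmap_tangent_chart)
  ultimately show ?thesis
    using inv_into_f_f[OF inj_tangent_chart[OF assms(1)], of "coord_vec A c p \<eta>"] assms p by simp
qed

lemma tangent_chart_image:
  assumes "c \<in> A"
  shows "cmap (tangent_chart A c) ` {V \<in> tangent_bundle A. fst V \<in> cdom c \<inter> W} = cmap c ` (cdom c \<inter> W) \<times> UNIV"
proof (intro equalityI subsetI)
  fix P assume "P \<in> cmap c ` (cdom c \<inter> W) \<times> (UNIV :: 'e set)"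
  then obtain p \<eta> where p: "P = (cmap c p, \<eta>)" "p \<in> cdom c" "p \<in> W" by auto
  then have "P = cmap (tangent_chart A c) (coord_vec A c p \<eta>)" using assms by (simp add: cmap_tangent_chart)
  then show "P \<in> cmap (tangent_chart A c) ` {V \<in> tangent_bundle A. fst V \<in> cdom c \<inter> W}"
    using coord_vec_in[OF assms p(2)] p by (intro image_eqI) (auto simp: tangent_bundle_iff)
qed (auto simp: cmap_tangent_chart)

lemma tangent_chart_range: "c \<in> A \<Longrightarrow> cmap (tangent_chart A c) ` cdom (tangent_chart A c) = cmap c ` cdom c \<times> UNIV"
  using tangent_chart_image[of c UNIV] by (simp add: cdom_tangent_chart)

lemma tangent_chart_overlap:
  assumes "c \<in> A"
  shows "cmap (tangent_chart A c) ` (cdom (tangent_chart A c) \<inter> cdom (tangent_chart A d))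
    = cmap c ` (cdom c \<inter> cdom d) \<times> UNIV"
proof -
  have "cdom (tangent_chart A c) \<inter> cdom (tangent_chart A d) = {V \<in> tangent_bundle A. fst V \<in> cdom c \<inter> cdom d}"
    by (auto simp: cdom_tangent_chart)
  then show ?thesis using tangent_chart_image[OF assms] by simp
qed

lemma transition_tangent_chart:
  assumes "c \<in> A" "d \<in> A" "P \<in> cmap c ` (cdom c \<inter> cdom d) \<times> UNIV"
  shows "transition (tangent_chart A c) (tangent_chart A d) P =
     (transition c d (fst P), FD (transition c d) (fst P) (snd P))"
proof -
  obtain p where p: "fst P = cmap c p" "p \<in> cdom c" "p \<in> cdom d" using assms by auto
  have "cinv (tangent_chart A c) P = coord_vec A c p (snd P)"
    using cinv_tangent_chart[OF assms(1), of "fst P" "snd P"] p assms by auto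
  then show ?thesis
    using p assms
    by (simp add: transition_def[of "tangent_chart A c"] cmap_tangent_chart transition_cmap snd_coord_vec)
qed

lemma smooth_atlas_tangent: "smooth_atlas (tangent_atlas A)"
proof -
  have "smooth_on (cmap c ` (cdom c \<inter> cdom d) \<times> UNIV) (transition (tangent_chart A c) (tangent_chart A d))"
    if c: "c \<in> A" "d \<in> A" for c d
  proof -
    let ?N = "cmap c ` (cdom c \<inter> cdom d) \<times> (UNIV :: 'e set)"
    have op: "open ?N" using open_overlap[OF c] by (simp add: open_Times)
    have sm: "smooth_on ?N (\<lambda>P. (transition c d (fst P), FD (transition c d) (fst P) (snd P)))"
      using open_overlap[OF c] smooth_transition[OF c]
      by (intro smooth_on_Pair op smooth_on_fst_comp smooth_on_FD_fst_snd)
    show ?thesis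
      by (rule smooth_on_cong[OF op, THEN iffD2, OF _ sm]) (rule transition_tangent_chart[OF c])
  qed
  then show ?thesis
    unfolding smooth_atlas_def tangent_atlas_def
    by (auto simp: inj_tangent_chart tangent_chart_range tangent_chart_overlap open_Times open_chart open_overlap)
qed

text \<open>The second derivative of the transition keeps the fibre components from transforming as
  a vector; it is the term that Christoffel symbols absorb in the connection map.\<close>

lemma FD_transition_tangent_chart:
  assumes "c \<in> A" "d \<in> A" "p \<in> cdom c" "p \<in> cdom d"
  shows "FD (transition (tangent_chart A c) (tangent_chart A d)) (cmap c p, \<eta>) P =
     (FD (transition c d) (cmap c p) (fst P),
      FD (\<lambda>y. FD (transition c d) y \<eta>) (cmap c p) (fst P) + FD (transition c d) (cmap c p) (snd P))"
proof -
  let ?N = "cmap c ` (cdom c \<inter> cdom d)" and ?x = "(cmap c p, \<eta>)" and ?\<tau> = "transition c d"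
  have N: "open (?N \<times> (UNIV :: 'e set))" "?x \<in> ?N \<times> UNIV"
    using open_overlap assms by (auto simp: open_Times)
  note sm = smooth_transition[OF assms(1,2)]
  have c: "((\<lambda>q. FD ?\<tau> (fst q) v) has_derivative (\<lambda>V. FD (\<lambda>y. FD ?\<tau> y v) (cmap c p) (fst V))) (at ?x)" for v
    using has_derivative_fst_comp[of "\<lambda>y. FD ?\<tau> y v" ?x] smooth_on_differentiable[OF smooth_on_FD[OF sm]] assms by auto
  have "((\<lambda>q. FD ?\<tau> (fst q) (snd q)) has_derivative
       (\<lambda>V. FD (\<lambda>q. FD ?\<tau> (fst q) (snd ?x)) ?x V + FD ?\<tau> (fst ?x) (snd V))) (at ?x)"
  proof (rule has_derivative_linear_family[OF N, where B = "\<lambda>q. FD ?\<tau> (fst q)"])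
    show "linear (FD ?\<tau> (fst q))" if "q \<in> ?N \<times> UNIV" for q
      using that smooth_on_differentiable[OF sm] by (intro linear_FD) auto
    show "(\<lambda>q. FD ?\<tau> (fst q) v) differentiable at ?x" for v by (rule differentiableI, rule c)
  qed (auto intro: derivative_eq_intros)
  moreover have "((\<lambda>q. ?\<tau> (fst q)) has_derivative (\<lambda>V. FD ?\<tau> (fst ?x) (fst V))) (at ?x)"
    using differentiable_transition[OF assms] by (intro has_derivative_fst_comp) simp
  ultimately have "((\<lambda>q. (?\<tau> (fst q), FD ?\<tau> (fst q) (snd q))) has_derivative
       (\<lambda>V. (FD ?\<tau> (fst ?x) (fst V), FD (\<lambda>q. FD ?\<tau> (fst q) (snd ?x)) ?x V + FD ?\<tau> (fst ?x) (snd V)))) (at ?x)"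
    by (intro has_derivative_Pair)
  from FD_eqI[OF this] have "FD (\<lambda>q. (?\<tau> (fst q), FD ?\<tau> (fst q) (snd q))) ?x P =
    (FD ?\<tau> (cmap c p) (fst P), FD (\<lambda>y. FD ?\<tau> y \<eta>) (cmap c p) (fst P) + FD ?\<tau> (cmap c p) (snd P))"
    using FD_eqI[OF c] by simp
  then show ?thesis
    using FD_cong_open[OF N transition_tangent_chart[OF assms(1,2)]] by simp
qed

lemma atlas_tangent: "atlas (tangent_atlas A)"
  by unfold_locales (rule smooth_atlas_tangent)

lemma tangent_chart_in: "c \<in> A \<Longrightarrow> tangent_chart A c \<in> tangent_atlas A"
  by (simp add: tangent_atlas_def)

end

section \<open>The connection map and the Sasaki metric on the tangent bundle\<close>

text \<open>Once differentiable coordinate metrics suffice below, so the Sasaki metric need not be shown to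
  be smooth.\<close>

locale c1_riemannian = atlas A for A :: "('m, 'e::euclidean_space) chart set" +
  fixes g :: "('m, 'e) metric"
  assumes coord_metric: "c \<in> A \<Longrightarrow> coord_metric (cmap c ` cdom c) (metric_coord A g c)"
begin

lemma snd_connection_map:
  assumes "V \<in> tangent_space (tangent_atlas A) \<Xi>" "\<Xi> \<in> tangent_space A p" "c \<in> A" "p \<in> cdom c"
  shows "snd (connection_map A g V) c = vertical_part (metric_coord A g c) (cmap c p, snd \<Xi> c) (snd V (tangent_chart A c))"
  using assms tangent_spaceD(1)[OF assms(2)]
  by (simp add: connection_map_def Let_def vertical_part_def christoffel_eq_christoffel_symbol tangent_space_def)

text \<open>Two inhomogeneous terms cancel: the second derivative in the coordinate change of the
  tangent bundle, and the one in the transformation law of the Christoffel symbols.\<close>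

lemma connection_map_in:
  assumes V: "V \<in> tangent_space (tangent_atlas A) \<Xi>" and \<Xi>: "\<Xi> \<in> tangent_space A p"
  shows "connection_map A g V \<in> tangent_space A p"
proof -
  interpret T: atlas "tangent_atlas A" by (rule atlas_tangent)
  show ?thesis
  proof (rule tangent_spaceI)
    show "fst (connection_map A g V) = p"
      using tangent_spaceD(1)[OF \<Xi>] T.tangent_spaceD(1)[OF V] by (simp add: connection_map_def Let_def)
    show "p \<in> points A" by (rule tangent_spaceD(2)[OF \<Xi>])
    show "snd (connection_map A g V) c = 0" if "\<not> (c \<in> A \<and> p \<in> cdom c)" for c
      using that tangent_spaceD(1)[OF \<Xi>] T.tangent_spaceD(1)[OF V] by (auto simp: connection_map_def Let_def)
    fix c d assume c: "c \<in> A" "d \<in> A" "p \<in> cdom c" "p \<in> cdom d"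
    let ?\<tau> = "transition c d" and ?x = "cmap c p"
    have lin: "linear (FD ?\<tau> ?x)" by (rule linear_FD[OF differentiable_transition[OF c]])
    obtain \<eta> where \<eta>: "snd \<Xi> c = \<eta>" "snd \<Xi> d = FD ?\<tau> ?x \<eta>" using tangent_spaceD(3)[OF \<Xi> c] by blast
    obtain w where w: "snd V (tangent_chart A c) = w" by blast
    have w': "snd V (tangent_chart A d) =
        FD (transition (tangent_chart A c) (tangent_chart A d)) (?x, \<eta>) w"
      using T.tangent_spaceD(3)[OF V tangent_chart_in[OF c(1)] tangent_chart_in[OF c(2)]] c w \<eta>(1)
        mem_cdom_tangent_chart[OF \<Xi>] tangent_spaceD(1)[OF \<Xi>]
      by (simp add: cmap_tangent_chart)
    have "FD (\<lambda>y. FD ?\<tau> y \<eta>) ?x (fst w) + christoffel_symbol (metric_coord A g d) (?\<tau> ?x) (FD ?\<tau> ?x \<eta>) (FD ?\<tau> ?x (fst w))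
        = FD ?\<tau> ?x (christoffel_symbol (metric_coord A g c) ?x \<eta> (fst w))"
    proof (rule christoffel_symbol_transform[OF coord_metric[OF c(1)] coord_metric[OF c(2)]
            open_overlap[OF c(1,2)] _ _ _ smooth_transition[OF c(1,2)] surj_FD_transition[OF c]])
      show "?\<tau> ?x \<in> cmap d ` cdom d" using c by (simp add: transition_cmap)
    qed (use c metric_coord_pullback[OF c(1,2)] in auto)
    then show "snd (connection_map A g V) d = FD ?\<tau> ?x (snd (connection_map A g V) c)"
      unfolding snd_connection_map[OF V \<Xi> c(1,3)] snd_connection_map[OF V \<Xi> c(2,4)] w w'
      by (simp add: vertical_part_def FD_transition_tangent_chart[OF c] \<eta> linear_add[OF lin] transition_cmap[OF c(1,3)] algebra_simps)
  qed
qed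

end

lemma coord_metric_cong:
  assumes "coord_metric S G" "\<And>x. x \<in> S \<Longrightarrow> G' x = G x"
  shows "coord_metric S G'"
proof -
  interpret coord_metric S G by fact
  show ?thesis
  proof
    fix x u w assume x: "x \<in> S"
    show "(\<lambda>y. G' y u w) differentiable at x"
      using diff[OF x, of u w] differentiable_cong_open[OF open_S x, of "\<lambda>y. G' y u w" "\<lambda>y. G y u w"] assms(2) by simp
  qed (simp_all add: assms(2) open_S bil sym pos)
qed

locale c2_riemannian = atlas A for A :: "('m, 'e::euclidean_space) chart set" +
  fixes g :: "('m, 'e) metric"
  assumes coord_metric2: "c \<in> A \<Longrightarrow> coord_metric2 (cmap c ` cdom c) (metric_coord A g c)"

sublocale c2_riemannian \<subseteq> c1_riemannian
  by (rule c1_riemannian.intro[OF atlas_axioms], rule c1_riemannian_axioms.intro, rule coord_metric2.axioms(1)[OF coord_metric2])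

lemma riemannian_metric_c2_riemannian:
  assumes "smooth_atlas A" "riemannian_metric A g"
  shows "c2_riemannian A g"
proof -
  interpret atlas A by unfold_locales fact
  show ?thesis
  proof (rule c2_riemannian.intro[OF atlas_axioms], rule c2_riemannian_axioms.intro)
    fix c assume c: "c \<in> A"
    have sm: "smooth_on (cmap c ` cdom c) (\<lambda>x. metric_coord A g c x u w)" for u w
      using assms(2) c by (simp add: riemannian_metric_def)
    show "coord_metric2 (cmap c ` cdom c) (metric_coord A g c)"
    proof
      show "open (cmap c ` cdom c)" by (rule open_chart[OF c])
      fix x assume x: "x \<in> cmap c ` cdom c"
      show "bilinear (metric_coord A g c x)"
        "metric_coord A g c x u w = metric_coord A g c x w u"
        "u \<noteq> 0 \<Longrightarrow> metric_coord A g c x u u > 0" for u w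
        using assms(2) c x unfolding riemannian_metric_def by blast+
      show "(\<lambda>y. metric_coord A g c y u w) differentiable at x" for u w
        by (rule smooth_on_differentiable[OF sm x])
      show "(\<lambda>y. FD (\<lambda>z. metric_coord A g c z u w) y v) differentiable at x" for u w v
        by (rule smooth_on_differentiable[OF smooth_on_FD[OF sm] x])
    qed
  qed
qed

context c2_riemannian
begin

lemma differentiable_map_at_fst:
  assumes "\<Xi> \<in> tangent_bundle A"
  shows "differentiable_map_at (tangent_atlas A) A fst \<Xi>"
    and "c \<in> A \<Longrightarrow> fst \<Xi> \<in> cdom c \<Longrightarrow>
      FD (cmap c \<circ> fst \<circ> cinv (tangent_chart A c)) (cmap (tangent_chart A c) \<Xi>) P = fst P"
proof -
  have eq: "(cmap d \<circ> fst \<circ> cinv (tangent_chart A c)) Q = transition c d (fst Q)"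
    if "c \<in> A" "Q \<in> cmap c ` cdom c \<times> UNIV" for c d Q
    using that cinv_tangent_chart[of c "fst Q" "snd Q"] by (auto simp: transition_cmap)
  have hd: "((cmap d \<circ> fst \<circ> cinv (tangent_chart A c)) has_derivative
      (\<lambda>P. FD (transition c d) (cmap c (fst \<Xi>)) (fst P))) (at (cmap (tangent_chart A c) \<Xi>))"
    if c: "c \<in> A" "d \<in> A" "fst \<Xi> \<in> cdom c" "fst \<Xi> \<in> cdom d" for c d
  proof -
    have *: "((\<lambda>Q. transition c d (fst Q)) has_derivative (\<lambda>P. FD (transition c d) (cmap c (fst \<Xi>)) (fst P)))
      (at (cmap (tangent_chart A c) \<Xi>))"
      using has_derivative_fst_comp[of "transition c d" "cmap (tangent_chart A c) \<Xi>"] differentiable_transition[OF c]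
      by (simp add: cmap_tangent_chart)
    have op: "open (cmap c ` cdom c \<times> (UNIV :: 'e set))" and mem: "cmap (tangent_chart A c) \<Xi> \<in> cmap c ` cdom c \<times> UNIV"
      using open_chart c by (auto simp: open_Times cmap_tangent_chart)
    show ?thesis
      by (rule has_derivative_cong_open[OF op mem, THEN iffD2, OF eq[OF c(1)] *])
  qed
  show "differentiable_map_at (tangent_atlas A) A fst \<Xi>"
    unfolding differentiable_map_at_def
  proof (intro ballI impI)
    fix C d assume C: "C \<in> tangent_atlas A" "d \<in> A" "\<Xi> \<in> cdom C" "fst \<Xi> \<in> cdom d"
    then obtain c where c: "c \<in> A" "C = tangent_chart A c" by (auto simp: tangent_atlas_def)
    then have p: "fst \<Xi> \<in> cdom c" using C by (simp add: cdom_tangent_chart)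
    let ?N = "cmap c ` (cdom c \<inter> cdom d) \<times> (UNIV :: 'e set)"
    have "open ?N" "cmap C \<Xi> \<in> ?N"
      using open_overlap[OF c(1) C(2)] c C p by (auto simp: open_Times cmap_tangent_chart)
    moreover have "?N \<subseteq> cmap C ` cdom C" using tangent_chart_range c by auto
    moreover have "\<forall>Q\<in>?N. fst (cinv C Q) \<in> cdom d"
      using c cinv_tangent_chart[OF c(1)] by auto
    moreover have "(cmap d \<circ> fst \<circ> cinv C) differentiable at (cmap C \<Xi>)"
      unfolding c(2) by (rule differentiableI, rule hd[OF c(1) C(2) p C(4)])
    ultimately show "\<exists>N. open N \<and> cmap C \<Xi> \<in> N \<and> N \<subseteq> cmap C ` cdom C \<and> (\<forall>x\<in>N. fst (cinv C x) \<in> cdom d) \<and>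
        (cmap d \<circ> fst \<circ> cinv C) differentiable at (cmap C \<Xi>)"
      by (intro exI[of _ ?N] conjI)
  qed
  assume c: "c \<in> A" "fst \<Xi> \<in> cdom c"
  show "FD (cmap c \<circ> fst \<circ> cinv (tangent_chart A c)) (cmap (tangent_chart A c) \<Xi>) P = fst P"
    using fun_cong[OF FD_eqI[OF hd[OF c(1) c(1) c(2) c(2)]], of P] by (simp only: FD_transition_self[OF c])
qed

text \<open>On coordinate vectors the differential of the projection picks out the base component,
  and the connection map gives the vertical part. The restriction on \<open>P\<close> is essential
  because \<open>cinv\<close> is arbitrary off the image of the chart.\<close>

lemma metric_coord_sasaki:
  assumes c: "c \<in> A" and P: "P \<in> cmap c ` cdom c \<times> UNIV"
  shows "metric_coord (tangent_atlas A) (sasaki_metric A g) (tangent_chart A c) P = sasaki_form (metric_coord A g c) P"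
proof (intro ext)
  fix Q R
  interpret T: atlas "tangent_atlas A" by (rule atlas_tangent)
  interpret TA: two_atlases "tangent_atlas A" A ..
  obtain p \<eta> where p: "P = (cmap c p, \<eta>)" "p \<in> cdom c" using P by auto
  let ?C = "tangent_chart A c"
  define \<Xi> where "\<Xi> = coord_vec A c p \<eta>"
  have \<Xi>: "\<Xi> \<in> tangent_space A p" unfolding \<Xi>_def by (rule coord_vec_in[OF c p(2)])
  have fst: "fst \<Xi> = p" "snd \<Xi> c = \<eta>" using c p by (auto simp: \<Xi>_def)
  have C: "?C \<in> tangent_atlas A" "\<Xi> \<in> cdom ?C"
    using tangent_chart_in[OF c] mem_cdom_tangent_chart[OF \<Xi>] p by auto
  define V where "V Q = coord_vec (tangent_atlas A) ?C \<Xi> Q" for Q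
  have V: "V Q \<in> tangent_space (tangent_atlas A) \<Xi>" "snd (V Q) ?C = Q" for Q
    unfolding V_def using T.coord_vec_in[OF C] C by auto
  have tb: "\<Xi> \<in> tangent_bundle A" using \<Xi> by (simp add: tangent_space_def)
  have pA: "fst \<Xi> \<in> points A" using c p fst by (auto simp: points_def)
  have H: "tangent_map (tangent_atlas A) A fst (V Q) \<in> tangent_space A p"
    "snd (tangent_map (tangent_atlas A) A fst (V Q)) c = fst Q" for Q
    using TA.tangent_map_in[OF differentiable_map_at_fst(1)[OF tb] pA V(1)]
      TA.snd_tangent_map[OF differentiable_map_at_fst(1)[OF tb] C c _ V(1)] differentiable_map_at_fst(2)[OF tb c] p fst
    by (auto simp: V(2))
  have K: "connection_map A g (V Q) \<in> tangent_space A p"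
    "snd (connection_map A g (V Q)) c = vertical_part (metric_coord A g c) P Q" for Q
    using connection_map_in[OF V(1) \<Xi>] snd_connection_map[OF V(1) \<Xi> c p(2)] by (auto simp: V(2) fst p(1))
  have "cinv ?C P = \<Xi>" using cinv_tangent_chart[OF c, of "cmap c p" \<eta>] c p by (simp add: \<Xi>_def)
  then show "metric_coord (tangent_atlas A) (sasaki_metric A g) ?C P Q R = sasaki_form (metric_coord A g c) P Q R"
    using metric_eq_coord[OF H(1) H(1) c p(2), of g Q R] metric_eq_coord[OF K(1) K(1) c p(2), of g Q R]
    by (simp add: metric_coord_def[of "tangent_atlas A"] V_def[symmetric] sasaki_metric_def sasaki_form_def H(2) K(2))
      (simp add: p(1))
qed

lemma c1_riemannian_sasaki: "c1_riemannian (tangent_atlas A) (sasaki_metric A g)"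
proof -
  interpret T: atlas "tangent_atlas A" by (rule atlas_tangent)
  show ?thesis
  proof (rule c1_riemannian.intro[OF T.atlas_axioms], rule c1_riemannian_axioms.intro)
    fix C assume "C \<in> tangent_atlas A"
    then obtain c where c: "c \<in> A" "C = tangent_chart A c" by (auto simp: tangent_atlas_def)
    interpret c: coord_metric2 "cmap c ` cdom c" "metric_coord A g c" by (rule coord_metric2[OF c(1)])
    show "coord_metric (cmap C ` cdom C) (metric_coord (tangent_atlas A) (sasaki_metric A g) C)"
      unfolding c(2) tangent_chart_range[OF c(1)]
      by (rule coord_metric_cong[OF c.coord_metric_sasaki_form]) (rule metric_coord_sasaki[OF c(1)])
  qed
qed

end

section \<open>Immersed submanifolds and the second fundamental form\<close>

text \<open>The normal equations of the orthogonal projection onto the range of \<open>L\<close>: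
  the Gram map \<open>T\<close> is injective because \<open>L\<close> is and \<open>G x\<close> is
  definite, hence it is surjective.\<close>

lemma (in coord_metric) orthogonal_projection:
  fixes L :: "'f::euclidean_space \<Rightarrow> 'a"
  assumes "x \<in> S" "linear L" "inj L"
  shows "\<exists>Z. \<forall>W. G x (u - L Z) (L W) = 0"
proof -
  have L: "L (a + b) = L a + L b" "L (r *\<^sub>R a) = r *\<^sub>R L a" for a b r
    using assms(2) by (simp_all add: linear_add linear_cmul)
  define T where "T Z = (\<Sum>b\<in>Basis. G x (L Z) (L b) *\<^sub>R b)" for Z
  have TB: "(\<Sum>b\<in>Basis. l b *\<^sub>R b) \<bullet> b = l b" if "b \<in> Basis" for l and b :: 'f
    using that by (simp add: inner_sum_left inner_Basis if_distrib sum.If_cases cong: if_cong)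
  have lin: "linear (\<lambda>W. G x v (L W))" for v
    by (rule linearI) (simp_all add: L G_simps[OF assms(1)])
  have basis: "G x v (L W) = 0" if "\<And>b. b \<in> Basis \<Longrightarrow> G x v (L b) = 0" for v W
  proof -
    have "(\<lambda>W. G x v (L W)) = (\<lambda>W. 0)"
      by (rule linear_eq_stdbasis[OF lin]) (simp_all add: that module_hom_zero linear_zero)
    then show ?thesis by metis
  qed
  have "linear T"
    unfolding T_def
    by (intro linearI) (simp_all add: L G_simps assms(1) sum.distrib scaleR_add_left scaleR_sum_right)
  moreover have "inj T"
  proof (rule injI)
    fix z z' assume eq: "T z = T z'"
    have "G x (L z - L z') (L b) = 0" if "b \<in> Basis" for b
      using TB[OF that, of "\<lambda>b. G x (L z) (L b)"] TB[OF that, of "\<lambda>b. G x (L z') (L b)"] eq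
      by (simp add: T_def G_simps[OF assms(1)])
    then have "G x (L z - L z') (L (z - z')) = 0" by (rule basis)
    then have "L z = L z'" using pos[OF assms(1), of "L z - L z'"] linear_diff[OF assms(2)] by fastforce
    then show "z = z'" using assms(3) by (simp add: inj_eq)
  qed
  ultimately have "surj T" by (rule linear_inj_imp_surj)
  then obtain Z where Z: "T Z = (\<Sum>b\<in>Basis. G x u (L b) *\<^sub>R b)" by (metis surjD)
  have "G x (u - L Z) (L b) = 0" if "b \<in> Basis" for b
    using TB[OF that, of "\<lambda>b. G x (L Z) (L b)"] TB[OF that, of "\<lambda>b. G x u (L b)"] Z
    by (simp add: T_def G_simps[OF assms(1)])
  then show ?thesis using basis by blast
qed

text \<open>The test fields for total geodesy: having constant components in \<open>c\<close>, they
  take every tangent vector at a point of the chart as a value.\<close>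

lemma (in atlas) smooth_coord_field:
  assumes c: "c \<in> A"
  shows "smooth_map_on A (tangent_atlas A) (cdom c) (\<lambda>q. coord_vec A c q Y)"
  unfolding smooth_map_on_def
proof (intro conjI ballI)
  show "cdom c \<subseteq> points A" using c by (auto simp: points_def)
  show "(\<lambda>q. coord_vec A c q Y) ` cdom c \<subseteq> points (tangent_atlas A)"
  proof
    fix V assume "V \<in> (\<lambda>q. coord_vec A c q Y) ` cdom c"
    then have "V \<in> cdom (tangent_chart A c)" using mem_cdom_tangent_chart[OF coord_vec_in[OF c]] by blast
    then show "V \<in> points (tangent_atlas A)" using tangent_chart_in[OF c] unfolding points_def by blast
  qed
  fix c' D assume c': "c' \<in> A" and "D \<in> tangent_atlas A"
  then obtain d where d: "d \<in> A" "D = tangent_chart A d" by (auto simp: tangent_atlas_def)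
  let ?N = "cmap c' ` (cdom c' \<inter> cdom c \<inter> cdom d)"
  have set_eq: "cdom c' \<inter> cdom c \<inter> (\<lambda>q. coord_vec A c q Y) -` cdom D = cdom c' \<inter> cdom c \<inter> cdom d"
    unfolding d(2) using mem_cdom_tangent_chart[OF coord_vec_in[OF c]] by blast
  have "?N = cmap c' ` (cdom c' \<inter> cdom c) \<inter> cmap c' ` (cdom c' \<inter> cdom d)"
    using inj_chart[OF c'] by (auto simp: inj_on_def)
  then have op: "open ?N" using open_Int[OF open_overlap[OF c' c] open_overlap[OF c' d(1)]] by (simp only:)
  then show "open (cmap c' ` (cdom c' \<inter> cdom c \<inter> (\<lambda>q. coord_vec A c q Y) -` cdom D))"
    by (simp only: set_eq)
  have sub: "?N \<subseteq> cmap c' ` (cdom c' \<inter> cdom c)" "?N \<subseteq> cmap c' ` (cdom c' \<inter> cdom d)" by auto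
  have 1: "smooth_on ?N (\<lambda>y. FD (transition c d) (transition c' c y) Y)"
  proof (rule smooth_on_compose[where f = "transition c' c" and h = "\<lambda>x. FD (transition c d) x Y", OF op])
    show "smooth_on ?N (transition c' c)" by (rule smooth_on_subset[OF smooth_transition[OF c' c] sub(1)])
    show "smooth_on (cmap c ` (cdom c \<inter> cdom d)) (\<lambda>x. FD (transition c d) x Y)"
      by (rule smooth_on_FD[OF smooth_transition[OF c d(1)]])
    show "transition c' c ` ?N \<subseteq> cmap c ` (cdom c \<inter> cdom d)"
      using c' by (auto simp: transition_cmap)
  qed
  have 2: "smooth_on ?N (\<lambda>y. (transition c' d y, FD (transition c d) (transition c' c y) Y))"
    by (intro smooth_on_Pair op 1 smooth_on_subset[OF smooth_transition[OF c' d(1)] sub(2)])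
  have "smooth_on ?N (cmap D \<circ> (\<lambda>q. coord_vec A c q Y) \<circ> cinv c')"
    by (rule smooth_on_cong[OF op, THEN iffD2, OF _ 2])
      (use c' c d in \<open>auto simp: cmap_tangent_chart transition_cmap snd_coord_vec\<close>)
  then show "smooth_on (cmap c' ` (cdom c' \<inter> cdom c \<inter> (\<lambda>q. coord_vec A c q Y) -` cdom D))
      (cmap D \<circ> (\<lambda>q. coord_vec A c q Y) \<circ> cinv c')"
    by (simp only: set_eq)
qed

text \<open>The factor \<open>id\<close> is kept so that the term matches literally those in
  \<open>smooth_map_on\<close> and \<open>tangent_map\<close>.\<close>

definition inclusion_coord :: "('m, 'f) chart \<Rightarrow> ('m, 'e) chart \<Rightarrow> 'f \<Rightarrow> 'e" where
  "inclusion_coord c d = cmap d \<circ> id \<circ> cinv c"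

text \<open>Instantiated twice: for F in M, and for \<xi>(F) in the tangent bundle with the Sasaki
  metric.\<close>

locale immersed = c1_riemannian A g + B: atlas B
  for A :: "('m, 'e::euclidean_space) chart set" and g
    and B :: "('m, 'f::euclidean_space) chart set" +
  assumes smooth_id: "smooth_map_on B A (points B) id"
    and immersion: "p \<in> points B \<Longrightarrow> inj_on (tangent_map B A id) (tangent_space B p)"
begin

lemma two_atlases: "two_atlases B A" by (rule two_atlases.intro[OF B.atlas_axioms atlas_axioms])

lemma overlap_eq: "c \<in> B \<Longrightarrow> cdom c \<inter> points B \<inter> id -` cdom d = cdom c \<inter> cdom d"
  by (auto simp: points_def)

lemma open_inclusion_coord: "c \<in> B \<Longrightarrow> d \<in> A \<Longrightarrow> open (cmap c ` (cdom c \<inter> cdom d))"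
  using smooth_id overlap_eq[of c d] unfolding smooth_map_on_def by metis

lemma smooth_inclusion_coord: "c \<in> B \<Longrightarrow> d \<in> A \<Longrightarrow> smooth_on (cmap c ` (cdom c \<inter> cdom d)) (inclusion_coord c d)"
  using smooth_id overlap_eq[of c d] unfolding smooth_map_on_def inclusion_coord_def by metis

lemma inclusion_coord_cmap: "c \<in> B \<Longrightarrow> p \<in> cdom c \<Longrightarrow> inclusion_coord c d (cmap c p) = cmap d p"
  by (simp add: inclusion_coord_def)

lemma points_subset: "p \<in> points B \<Longrightarrow> p \<in> points A"
  using smooth_id by (auto simp: smooth_map_on_def)

lemma differentiable_map_at_id: "p \<in> points B \<Longrightarrow> differentiable_map_at B A id p"
  by (rule two_atlases.smooth_map_on_imp_differentiable_map_at[OF two_atlases smooth_id])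

lemma differentiable_inclusion_coord:
  assumes "c \<in> B" "d \<in> A" "p \<in> cdom c" "p \<in> cdom d"
  shows "inclusion_coord c d differentiable at (cmap c p)"
  by (rule smooth_on_differentiable[OF smooth_inclusion_coord[OF assms(1,2)]]) (use assms in auto)

lemma tangent_id_in:
  assumes "V \<in> tangent_space B p"
  shows "tangent_map B A id V \<in> tangent_space A p"
  using two_atlases.tangent_map_in[OF two_atlases differentiable_map_at_id _ assms] B.tangent_spaceD(2)[OF assms] points_subset
  by simp

lemma snd_tangent_id:
  assumes "V \<in> tangent_space B p" "c \<in> B" "d \<in> A" "p \<in> cdom c" "p \<in> cdom d"
  shows "snd (tangent_map B A id V) d = FD (inclusion_coord c d) (cmap c p) (snd V c)"
  using two_atlases.snd_tangent_map[OF two_atlases differentiable_map_at_id assms(2,4,3) _ assms(1)] assms(5)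
    B.tangent_spaceD(2)[OF assms(1)]
  by (simp add: inclusion_coord_def)

lemma inj_FD_inclusion_coord:
  assumes "c \<in> B" "d \<in> A" "p \<in> cdom c" "p \<in> cdom d"
  shows "inj (FD (inclusion_coord c d) (cmap c p))"
proof (rule injI)
  fix u v assume eq: "FD (inclusion_coord c d) (cmap c p) u = FD (inclusion_coord c d) (cmap c p) v"
  have in_B: "coord_vec B c p w \<in> tangent_space B p" for w by (rule B.coord_vec_in[OF assms(1,3)])
  have "tangent_map B A id (coord_vec B c p u) = tangent_map B A id (coord_vec B c p v)"
    by (rule tangent_space_eqI[OF tangent_id_in[OF in_B] tangent_id_in[OF in_B] assms(2,4)])
      (simp add: snd_tangent_id[OF in_B assms] eq B.snd_coord_vec_self[OF assms(1,3)])
  then have "coord_vec B c p u = coord_vec B c p v"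
    using immersion[of p] in_B B.tangent_spaceD(2)[OF in_B] by (auto simp: inj_on_def)
  then show "u = v" using B.snd_coord_vec_self[OF assms(1,3)] by metis
qed

lemma mem_tangent_image:
  assumes U: "U \<in> tangent_space A p" and c: "c \<in> B" "d \<in> A" "p \<in> cdom c" "p \<in> cdom d"
  shows "U \<in> tangent_map B A id ` tangent_space B p \<longleftrightarrow> (\<exists>Z. snd U d = FD (inclusion_coord c d) (cmap c p) Z)"
proof
  assume "U \<in> tangent_map B A id ` tangent_space B p"
  then show "\<exists>Z. snd U d = FD (inclusion_coord c d) (cmap c p) Z" using snd_tangent_id[OF _ c] by blast
next
  assume "\<exists>Z. snd U d = FD (inclusion_coord c d) (cmap c p) Z"
  then obtain Z where Z: "snd U d = FD (inclusion_coord c d) (cmap c p) Z" by blast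
  have in_B: "coord_vec B c p Z \<in> tangent_space B p" by (rule B.coord_vec_in[OF c(1,3)])
  have "U = tangent_map B A id (coord_vec B c p Z)"
    by (rule tangent_space_eqI[OF U tangent_id_in[OF in_B] c(2,4)])
      (simp add: Z snd_tangent_id[OF in_B c] B.snd_coord_vec_self[OF c(1,3)])
  then show "U \<in> tangent_map B A id ` tangent_space B p" using in_B by blast
qed

text \<open>As \<open>normal_component\<close> is a definite description, existence and uniqueness
  of the orthogonal decomposition come first; afterwards the zero vector can be tested against the
  defining property \<open>P\<close>.\<close>

lemma normal_component_eq_zero_iff:
  assumes U: "U \<in> tangent_space A p" and p: "p \<in> points B"
  shows "normal_component A g B U = zero_vec p \<longleftrightarrow> U \<in> tangent_map B A id ` tangent_space B p"
proof -
  define T where "T = tangent_map B A id ` tangent_space B p"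
  obtain c where c: "c \<in> B" "p \<in> cdom c" using p by (auto simp: points_def)
  obtain d where d: "d \<in> A" "p \<in> cdom d" using points_subset[OF p] by (auto simp: points_def)
  note cd = c(1) d(1) c(2) d(2)
  let ?x = "cmap d p" and ?G = "metric_coord A g d" and ?L = "FD (inclusion_coord c d) (cmap c p)"
  interpret G: coord_metric "cmap d ` cdom d" ?G by (rule coord_metric[OF d(1)])
  have x: "?x \<in> cmap d ` cdom d" using d by blast
  have L: "linear ?L" "inj ?L"
    using linear_FD[OF differentiable_inclusion_coord[OF cd]] inj_FD_inclusion_coord[OF cd] by auto
  have T: "V \<in> T \<longleftrightarrow> V \<in> tangent_space A p \<and> (\<exists>Z. snd V d = ?L Z)" for V
    using mem_tangent_image[OF _ cd, of V] tangent_id_in unfolding T_def by blast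
  define P where "P N \<longleftrightarrow> N \<in> tangent_space A p \<and> (\<forall>V\<in>T. g N V = 0) \<and> (\<exists>V\<in>T. U = add_vec V N)" for N
  have nc: "normal_component A g B U = (THE N. P N)"
    using tangent_spaceD(1)[OF U] by (simp add: normal_component_def P_def T_def Let_def)
  have coordT: "coord_vec A d p (?L Z) \<in> T" for Z
    using T coord_vec_in[OF d] snd_coord_vec_self[OF d] by blast
  have orth: "?G ?x (snd N d) (?L Z) = 0" if "P N" for N Z
    using that metric_eq_coord[OF _ _ d, of N "coord_vec A d p (?L Z)" g] coordT[of Z] coord_vec_in[OF d]
    by (simp add: P_def snd_coord_vec_self[OF d])
  have dec: "\<exists>Z. snd U d = ?L Z + snd N d" if "P N" for N
    using that T unfolding P_def add_vec_def by auto
  \<comment> \<open>The difference of two candidates is tangent and orthogonal to all tangent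
    vectors, hence 0.\<close>
  have uniq: "N = N'" if N: "P N" "P N'" for N N'
  proof -
    obtain Z Z' where Z: "snd U d = ?L Z + snd N d" "snd U d = ?L Z' + snd N' d"
      using dec[OF N(1)] dec[OF N(2)] by blast
    then have eq: "snd N d - snd N' d = ?L (Z' - Z)" by (simp add: linear_diff[OF L(1)] algebra_simps)
    have "?G ?x (snd N d - snd N' d) (?L (Z' - Z)) = 0"
      using orth[OF N(1)] orth[OF N(2)] by (simp add: G.G_simps[OF x])
    then have "snd N d = snd N' d" using G.pos[OF x, of "snd N d - snd N' d"] eq by fastforce
    then show ?thesis using N by (intro tangent_space_eqI[OF _ _ d]) (auto simp: P_def)
  qed
  obtain Z0 where Z0: "\<And>W. ?G ?x (snd U d - ?L Z0) (?L W) = 0"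
    using G.orthogonal_projection[OF x L] by blast
  have ex: "P (coord_vec A d p (snd U d - ?L Z0))"
    unfolding P_def
  proof (intro conjI ballI bexI)
    let ?N = "coord_vec A d p (snd U d - ?L Z0)" and ?V = "coord_vec A d p (?L Z0)"
    show N: "?N \<in> tangent_space A p" by (rule coord_vec_in[OF d])
    show "?V \<in> T" by (rule coordT)
    show "U = add_vec ?V ?N"
      by (rule tangent_space_eqI[OF U add_vec_in[OF coord_vec_in[OF d] coord_vec_in[OF d]] d])
        (simp add: add_vec_def snd_coord_vec_self[OF d])
    fix V assume "V \<in> T"
    then obtain Z where "V \<in> tangent_space A p" "snd V d = ?L Z" using T by blast
    then show "g ?N V = 0"
      using metric_eq_coord[OF N _ d, of V g] Z0 by (simp add: snd_coord_vec_self[OF d])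
  qed
  have THE_P: "P (THE N. P N)"
    by (rule theI[of P "coord_vec A d p (snd U d - ?L Z0)"]) (use ex uniq in blast)+
  have zero: "zero_vec p \<in> tangent_space A p" by (rule zero_vec_in[OF points_subset[OF p]])
  show ?thesis
    unfolding nc T_def[symmetric]
  proof
    assume "(THE N. P N) = zero_vec p"
    then have "P (zero_vec p)" using THE_P by simp
    then obtain Z where "snd U d = ?L Z" using dec[of "zero_vec p"] by (auto simp: zero_vec_def)
    then show "U \<in> T" using T U by blast
  next
    assume UT: "U \<in> T"
    have "P (zero_vec p)"
      unfolding P_def
    proof (intro conjI ballI bexI)
      show "zero_vec p \<in> tangent_space A p" by (rule zero)
      show "U \<in> T" by (rule UT)
      show "U = add_vec U (zero_vec p)"
        by (simp add: add_vec_def zero_vec_def)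
      fix V assume "V \<in> T"
      then have "V \<in> tangent_space A p" using T by blast
      then show "g (zero_vec p) V = 0"
        using metric_eq_coord[OF zero _ d, of V g] by (simp add: zero_vec_def G.G_simps[OF x])
    qed
    then show "(THE N. P N) = zero_vec p" using uniq THE_P by blast
  qed
qed

text \<open>In the chart \<open>c\<close> the field has components \<open>\<phi>\<close>.
  Differentiating \<open>FD f y (\<phi> y)\<close>, with \<open>f\<close> the inclusion in
  coordinates, adds to the Hessian only the image under \<open>FD f\<close> of the derivative of
  \<open>\<phi>\<close>. That is tangent, so the normal part sees \<open>Y\<close> only through its
  value at \<open>p\<close>.\<close>

lemma second_fundamental_form_eq_zero_iff:
  assumes Y: "smooth_map_on B (tangent_atlas B) W Y" "\<And>q. q \<in> W \<Longrightarrow> fst (Y q) = q" and p: "p \<in> W"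
    and X: "X \<in> tangent_space B p" and c: "c \<in> B" "d \<in> A" "p \<in> cdom c" "p \<in> cdom d"
  shows "second_fundamental_form A g B X Y = zero_vec p \<longleftrightarrow>
    (\<exists>Z. covariant_hessian (metric_coord A g d) (inclusion_coord c d) (cmap c p) (snd X c) (snd (Y p) c) = FD (inclusion_coord c d) (cmap c p) Z)"
proof -
  interpret TA: atlas "tangent_atlas A" by (rule atlas_tangent)
  interpret TB: atlas "tangent_atlas B" by (rule B.atlas_tangent)
  interpret BTA: two_atlases B "tangent_atlas A" ..
  interpret BTB: two_atlases B "tangent_atlas B" ..
  define E where "E = tangent_map B A id \<circ> Y"
  have W: "W \<subseteq> points B" using Y(1) by (simp add: smooth_map_on_def)
  have Yin: "Y q \<in> tangent_space B q" if "q \<in> W" for q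
  proof -
    have "Y q \<in> points (tangent_atlas B)" using Y(1) that by (auto simp: smooth_map_on_def)
    then have "Y q \<in> tangent_bundle B" by (auto simp: points_def tangent_atlas_def B.cdom_tangent_chart)
    then show ?thesis using Y(2)[OF that] by (simp add: tangent_space_def)
  qed
  have Ein: "E q \<in> tangent_space A q" if "q \<in> W" for q
    using tangent_id_in[OF Yin[OF that]] by (simp add: E_def)
  \<comment> \<open>Proved for arbitrary charts, shadowing the fixed pair, because
    \<open>differentiable_map_at\<close> quantifies over all of them.\<close>
  have main: "\<exists>N \<phi>'. open N \<and> cmap c p \<in> N \<and> N \<subseteq> cmap c ` cdom c \<and>
       (\<forall>x\<in>N. E (cinv c x) \<in> cdom (tangent_chart A d)) \<and>
       ((cmap (tangent_chart A d) \<circ> E \<circ> cinv c) has_derivative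
         (\<lambda>u. (FD (inclusion_coord c d) (cmap c p) u,
            FD (\<lambda>y. FD (inclusion_coord c d) y (snd (Y p) c)) (cmap c p) u + FD (inclusion_coord c d) (cmap c p) (\<phi>' u)))) (at (cmap c p))"
    if c: "c \<in> B" "d \<in> A" "p \<in> cdom c" "p \<in> cdom d" for c d
  proof -
    let ?x = "cmap c p" and ?f = "inclusion_coord c d"
    let ?N1 = "cmap c ` (cdom c \<inter> W \<inter> Y -` cdom (tangent_chart B c))"
    define N where "N = ?N1 \<inter> cmap c ` (cdom c \<inter> cdom d)"
    have YC: "Y q \<in> cdom (tangent_chart B c)" if "q \<in> W" "q \<in> cdom c" for q
      using B.mem_cdom_tangent_chart[OF Yin[OF that(1)]] that by simp
    have "open ?N1" and smY: "smooth_on ?N1 (cmap (tangent_chart B c) \<circ> Y \<circ> cinv c)"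
      using Y(1) c B.tangent_chart_in[OF c(1)] by (auto simp: smooth_map_on_def)
    then have N: "open N" "?x \<in> N"
      using open_inclusion_coord[OF c(1,2)] c p YC[of p] by (auto simp: N_def)
    have Nq: "\<exists>q. y = cmap c q \<and> q \<in> cdom c \<and> q \<in> cdom d \<and> q \<in> W" if "y \<in> N" for y
      using that B.inj_chart[OF c(1)] by (auto simp: N_def inj_on_def)
    define \<phi> where "\<phi> y = snd (Y (cinv c y)) c" for y
    have "(cmap (tangent_chart B c) \<circ> Y \<circ> cinv c) differentiable at ?x"
      using N by (intro smooth_on_differentiable[OF smY]) (simp add: N_def)
    then have "((cmap (tangent_chart B c) \<circ> Y \<circ> cinv c) has_derivative
        FD (cmap (tangent_chart B c) \<circ> Y \<circ> cinv c) ?x) (at ?x)" by (rule FD_works)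
    from has_derivative_snd[OF this]
    obtain \<phi>' where \<phi>': "(\<phi> has_derivative \<phi>') (at ?x)"
      by (simp add: B.cmap_tangent_chart o_def \<phi>_def[abs_def])
    have sub: "N \<subseteq> cmap c ` (cdom c \<inter> cdom d)" by (auto simp: N_def)
    note sm = smooth_on_subset[OF smooth_inclusion_coord[OF c(1,2)] sub]
    have eq: "(cmap (tangent_chart A d) \<circ> E \<circ> cinv c) y = (?f y, FD ?f y (\<phi> y))" if y: "y \<in> N" for y
    proof -
      obtain q where q: "y = cmap c q" "q \<in> cdom c" "q \<in> cdom d" "q \<in> W" using Nq[OF y] by blast
      then show ?thesis
        using c snd_tangent_id[OF Yin[OF q(4)] c(1,2) q(2,3)] tangent_spaceD(1)[OF tangent_id_in[OF Yin[OF q(4)]]]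
        by (simp add: E_def cmap_tangent_chart inclusion_coord_cmap \<phi>_def)
    qed
    have "((\<lambda>y. FD ?f y (\<phi> y)) has_derivative
        (\<lambda>u. FD (\<lambda>y. FD ?f y (\<phi> ?x)) ?x u + FD ?f ?x (\<phi>' u))) (at ?x)"
      by (rule has_derivative_linear_family[OF N _ _ \<phi>'])
        (auto intro: linear_FD smooth_on_differentiable[OF sm] smooth_on_differentiable[OF smooth_on_FD[OF sm] N(2)])
    then have "((\<lambda>y. (?f y, FD ?f y (\<phi> y))) has_derivative
        (\<lambda>u. (FD ?f ?x u, FD (\<lambda>y. FD ?f y (\<phi> ?x)) ?x u + FD ?f ?x (\<phi>' u)))) (at ?x)"
      by (intro has_derivative_Pair FD_works differentiable_inclusion_coord c)
    moreover have "\<phi> ?x = snd (Y p) c" using c by (simp add: \<phi>_def)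
    ultimately have d: "((\<lambda>y. (?f y, FD ?f y (\<phi> y))) has_derivative
        (\<lambda>u. (FD ?f ?x u, FD (\<lambda>y. FD ?f y (snd (Y p) c)) ?x u + FD ?f ?x (\<phi>' u)))) (at ?x)" by simp
    have hd: "((cmap (tangent_chart A d) \<circ> E \<circ> cinv c) has_derivative
        (\<lambda>u. (FD ?f ?x u, FD (\<lambda>y. FD ?f y (snd (Y p) c)) ?x u + FD ?f ?x (\<phi>' u)))) (at ?x)"
      by (rule has_derivative_cong_open[OF N, THEN iffD2, OF eq d])
    have "\<forall>x\<in>N. E (cinv c x) \<in> cdom (tangent_chart A d)"
    proof
      fix y assume "y \<in> N"
      then obtain q where q: "y = cmap c q" "q \<in> cdom c" "q \<in> cdom d" "q \<in> W" using Nq by blast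
      then show "E (cinv c y) \<in> cdom (tangent_chart A d)"
        using mem_cdom_tangent_chart[OF Ein[OF q(4)]] c by simp
    qed
    then show ?thesis using N sub hd by blast
  qed
  have diffE: "differentiable_map_at B (tangent_atlas A) E p"
    unfolding differentiable_map_at_def
  proof (intro ballI impI)
    fix c D assume c: "c \<in> B" "D \<in> tangent_atlas A" "p \<in> cdom c" "E p \<in> cdom D"
    then obtain d where d: "d \<in> A" "D = tangent_chart A d" by (auto simp: tangent_atlas_def)
    then have "p \<in> cdom d" using mem_cdom_tangent_chart[OF Ein[OF p]] c by simp
    from main[OF c(1) d(1) c(3) this]
    show "\<exists>N. open N \<and> cmap c p \<in> N \<and> N \<subseteq> cmap c ` cdom c \<and> (\<forall>x\<in>N. E (cinv c x) \<in> cdom D) \<and>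
        (cmap D \<circ> E \<circ> cinv c) differentiable at (cmap c p)"
      unfolding d(2) differentiable_def by blast
  qed
  have ED: "tangent_chart A d \<in> tangent_atlas A" "E p \<in> cdom (tangent_chart A d)"
    using tangent_chart_in c mem_cdom_tangent_chart[OF Ein[OF p]] by auto
  have EpA: "E p \<in> points (tangent_atlas A)" using ED by (auto simp: points_def)
  define V where "V = tangent_map B (tangent_atlas A) E X"
  have V: "V \<in> tangent_space (tangent_atlas A) (E p)"
    unfolding V_def by (rule BTA.tangent_map_in[OF diffE EpA X])
  obtain \<phi>' where \<phi>': "((cmap (tangent_chart A d) \<circ> E \<circ> cinv c) has_derivative
         (\<lambda>u. (FD (inclusion_coord c d) (cmap c p) u,
            FD (\<lambda>y. FD (inclusion_coord c d) y (snd (Y p) c)) (cmap c p) u + FD (inclusion_coord c d) (cmap c p) (\<phi>' u)))) (at (cmap c p))"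
    using main[OF c] by blast
  have sV: "snd V (tangent_chart A d) = (FD (inclusion_coord c d) (cmap c p) (snd X c),
      FD (\<lambda>y. FD (inclusion_coord c d) y (snd (Y p) c)) (cmap c p) (snd X c) + FD (inclusion_coord c d) (cmap c p) (\<phi>' (snd X c)))"
    unfolding V_def BTA.snd_tangent_map[OF diffE c(1,3) ED X] FD_eqI[OF \<phi>'] ..
  define U where "U = cov_deriv A g B E X"
  have U_eq: "U = connection_map A g V" by (simp add: U_def V_def cov_deriv_def)
  have Uin: "U \<in> tangent_space A p" unfolding U_eq by (rule connection_map_in[OF V Ein[OF p]])
  have Ep: "snd (E p) d = FD (inclusion_coord c d) (cmap c p) (snd (Y p) c)"
    using snd_tangent_id[OF Yin[OF p] c] by (simp add: E_def)
  have sU: "snd U d = covariant_hessian (metric_coord A g d) (inclusion_coord c d) (cmap c p) (snd X c) (snd (Y p) c)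
      + FD (inclusion_coord c d) (cmap c p) (\<phi>' (snd X c))"
    unfolding U_eq snd_connection_map[OF V Ein[OF p] c(2,4)] sV Ep
    by (simp add: vertical_part_def covariant_hessian_def inclusion_coord_cmap[OF c(1,3)])
  have lin: "linear (FD (inclusion_coord c d) (cmap c p))" by (rule linear_FD[OF differentiable_inclusion_coord[OF c]])
  have "second_fundamental_form A g B X Y = normal_component A g B U"
    by (simp add: second_fundamental_form_def U_def E_def)
  then have "second_fundamental_form A g B X Y = zero_vec p \<longleftrightarrow> (\<exists>Z. snd U d = FD (inclusion_coord c d) (cmap c p) Z)"
    using normal_component_eq_zero_iff[OF Uin] mem_tangent_image[OF Uin c] p W by auto
  \<comment> \<open>By \<open>sU\<close> the two vectors differ by the image of
    \<open>\<phi>' (snd X c)\<close> under the differential of the inclusion, so it is enough to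
    shift \<open>Z\<close>.\<close>
  also have "\<dots> \<longleftrightarrow> (\<exists>Z. covariant_hessian (metric_coord A g d) (inclusion_coord c d) (cmap c p) (snd X c) (snd (Y p) c) = FD (inclusion_coord c d) (cmap c p) Z)"
    (is "?l \<longleftrightarrow> ?r")
  proof
    assume ?l
    then obtain Z where "snd U d = FD (inclusion_coord c d) (cmap c p) Z" by blast
    then show ?r unfolding sU by (intro exI[of _ "Z - \<phi>' (snd X c)"]) (simp add: linear_diff[OF lin] algebra_simps)
  next
    assume ?r
    then obtain Z where "covariant_hessian (metric_coord A g d) (inclusion_coord c d) (cmap c p) (snd X c) (snd (Y p) c) = FD (inclusion_coord c d) (cmap c p) Z"
      by blast
    then show ?l unfolding sU by (intro exI[of _ "Z + \<phi>' (snd X c)"]) (simp add: linear_add[OF lin])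
  qed
  finally show ?thesis .
qed

lemma totally_geodesic_covariant_hessian:
  assumes tg: "totally_geodesic_submanifold A g B" and c: "c \<in> B" "d \<in> A" "p \<in> cdom c" "p \<in> cdom d"
  shows "\<exists>Z. covariant_hessian (metric_coord A g d) (inclusion_coord c d) (cmap c p) X Y = FD (inclusion_coord c d) (cmap c p) Z"
proof -
  let ?Y = "\<lambda>q. coord_vec B c q Y" and ?X = "coord_vec B c p X"
  have Y: "smooth_map_on B (tangent_atlas B) (cdom c) ?Y" by (rule B.smooth_coord_field[OF c(1)])
  have "openin (atlas_topology B) (cdom c)"
    unfolding openin_atlas_topology[OF B.smooth_atlas]
    using c B.open_overlap by (auto simp: points_def Int_commute)
  moreover have X: "?X \<in> tangent_space B p" by (rule B.coord_vec_in[OF c(1,3)])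
  ultimately have "second_fundamental_form A g B ?X ?Y = zero_vec p"
    using tg Y c unfolding totally_geodesic_submanifold_def by force
  then show ?thesis
    using second_fundamental_form_eq_zero_iff[OF Y _ c(3) X c] by (simp add: B.snd_coord_vec_self[OF c(1,3)])
qed

text \<open>\<open>X\<close> and \<open>Y\<close> are functions of the chart because they stand for
  the components of vectors, and the chart is chosen after them. One pair of charts per point
  suffices, since the condition is equivalent to the vanishing of a vector defined without reference
  to that pair.\<close>

lemma totally_geodesicI:
  assumes "submanifold A B"
    and "\<And>p X Y. p \<in> points B \<Longrightarrow> \<exists>c\<in>B. \<exists>d\<in>A. p \<in> cdom c \<and> p \<in> cdom d \<and>
      (\<exists>Z. covariant_hessian (metric_coord A g d) (inclusion_coord c d) (cmap c p) (X c) (Y c) = FD (inclusion_coord c d) (cmap c p) Z)"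
  shows "totally_geodesic_submanifold A g B"
  unfolding totally_geodesic_submanifold_def
proof (intro conjI allI impI ballI)
  fix W Y p X
  assume Y: "openin (atlas_topology B) W \<and> smooth_map_on B (tangent_atlas B) W Y \<and> (\<forall>p\<in>W. fst (Y p) = p)"
    and p: "p \<in> W" and X: "X \<in> tangent_space B p"
  have "p \<in> points B" by (rule B.tangent_spaceD(2)[OF X])
  then obtain c d where c: "c \<in> B" "d \<in> A" "p \<in> cdom c" "p \<in> cdom d"
    "\<exists>Z. covariant_hessian (metric_coord A g d) (inclusion_coord c d) (cmap c p) (snd X c) (snd (Y p) c) = FD (inclusion_coord c d) (cmap c p) Z"
    using assms(2)[of p "snd X" "snd (Y p)"] by blast
  then show "second_fundamental_form A g B X Y = zero_vec p"
    using second_fundamental_form_eq_zero_iff[OF _ _ p X c(1-4), of Y] Y by blast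
qed (rule assms(1))

end

lemma submanifold_immersed:
  assumes "c1_riemannian A g" "submanifold A B"
  shows "immersed A g B"
proof -
  have "atlas B" using assms(2) by (simp add: atlas_def submanifold_def smooth_manifold_def)
  then show ?thesis
    using assms by (simp add: immersed_def immersed_axioms_def submanifold_def)
qed

section \<open>The submanifold traced out by a vector field\<close>

lemma covariant_hessian_cong:
  assumes N: "open N" "y \<in> N" and h: "\<And>z. z \<in> N \<Longrightarrow> h z = h' z"
    and S: "open S" "h' y \<in> S" and G: "\<And>x. x \<in> S \<Longrightarrow> G x = G' x"
  shows "covariant_hessian G h y X Y = covariant_hessian G' h' y X Y"
proof -
  have FD: "FD h z = FD h' z" if "z \<in> N" for z by (rule FD_cong_open[OF N(1) that h])
  have "FD (\<lambda>z. FD h z Y) y = FD (\<lambda>z. FD h' z Y) y" by (rule FD_cong_open[OF N]) (simp add: FD)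
  then show ?thesis by (simp add: covariant_hessian_def FD[OF N(2)] h[OF N(2)] christoffel_symbol_cong[OF S G])
qed

locale field_along = c2_riemannian A g + immersed A g B
  for A :: "('m, 'e::euclidean_space) chart set" and g
    and B :: "('m, 'f::euclidean_space) chart set" +
  fixes \<xi> :: "'m \<Rightarrow> ('m, 'e) tvec"
  assumes field: "vector_field_along A B \<xi>"
begin

lemma smooth_field: "smooth_map_on B (tangent_atlas A) (points B) \<xi>"
  using field by (simp add: vector_field_along_def)

lemma fst_field [simp]: "p \<in> points B \<Longrightarrow> fst (\<xi> p) = p"
  using field by (simp add: vector_field_along_def)

lemma pointsI: "c \<in> B \<Longrightarrow> p \<in> cdom c \<Longrightarrow> p \<in> points B"
  by (auto simp: points_def)

lemma field_in: "p \<in> points B \<Longrightarrow> \<xi> p \<in> tangent_space A p"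
proof -
  assume p: "p \<in> points B"
  then have "\<xi> p \<in> points (tangent_atlas A)" using smooth_field by (auto simp: smooth_map_on_def)
  then have "\<xi> p \<in> tangent_bundle A" by (auto simp: points_def tangent_atlas_def cdom_tangent_chart)
  then show ?thesis using p by (simp add: tangent_space_def)
qed

lemma inj_field: "inj_on \<xi> (points B)"
  by (metis fst_field inj_onI)

lemma field_in_chart: "p \<in> points B \<Longrightarrow> \<xi> p \<in> cdom (tangent_chart A d) \<longleftrightarrow> p \<in> cdom d"
  using mem_cdom_tangent_chart[OF field_in] by blast

text \<open>On \<xi>(F) the map \<open>inv_into (points B) \<xi>\<close> is the bundle projection.
  So \<open>lift c\<close> has the same coordinate image as \<open>c\<close>, and F and \<xi>(F) are
  compared over the same open set of parameters.\<close>

definition lift :: "('m, 'f) chart \<Rightarrow> (('m, 'e) tvec, 'f) chart" where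
  "lift c = (\<xi> ` cdom c, cmap c \<circ> inv_into (points B) \<xi>)"

lemma image_atlas_eq: "image_atlas \<xi> B = lift ` B"
  unfolding image_atlas_def by (rule image_cong[OF refl]) (simp add: lift_def)

lemma cdom_lift: "cdom (lift c) = \<xi> ` cdom c"
  by (simp add: lift_def)

lemma cmap_lift: "p \<in> points B \<Longrightarrow> cmap (lift c) (\<xi> p) = cmap c p"
  by (simp add: lift_def inj_field)

lemma cmap_lift_image: "S \<subseteq> points B \<Longrightarrow> cmap (lift c) ` \<xi> ` S = cmap c ` S"
  by (auto simp: cmap_lift subset_iff image_iff)

lemma lift_Int:
  assumes "c \<in> B" "U \<subseteq> points B"
  shows "\<xi> ` U \<inter> \<xi> ` cdom c = \<xi> ` (U \<inter> cdom c)"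
proof -
  have "cdom c \<subseteq> points B" using assms by (auto simp: points_def)
  then show ?thesis using inj_on_image_Int[OF inj_field assms(2)] by simp
qed

lemma points_lift: "points (lift ` B) = \<xi> ` points B"
  by (auto simp: points_def cdom_lift)

lemma inj_lift: "c \<in> B \<Longrightarrow> inj_on (cmap (lift c)) (cdom (lift c))"
  using B.inj_chart[of c] by (auto simp: cdom_lift inj_on_def cmap_lift[OF pointsI])

lemma cinv_lift: "c \<in> B \<Longrightarrow> p \<in> cdom c \<Longrightarrow> cinv (lift c) (cmap c p) = \<xi> p"
  using inv_into_f_f[OF inj_lift, of c "\<xi> p"] by (simp add: cdom_lift cmap_lift[OF pointsI])

lemma lift_overlap:
  assumes "c \<in> B" "d \<in> B"
  shows "cmap (lift c) ` (cdom (lift c) \<inter> cdom (lift d)) = cmap c ` (cdom c \<inter> cdom d)"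
proof -
  have "cdom c \<subseteq> points B" using assms by (auto simp: points_def)
  then show ?thesis using lift_Int[OF assms(2), of "cdom c"] cmap_lift_image[of "cdom c \<inter> cdom d" c]
    by (auto simp: cdom_lift)
qed

lemma smooth_atlas_lift: "smooth_atlas (lift ` B)"
proof -
  have "smooth_on (cmap c ` (cdom c \<inter> cdom d)) (transition (lift c) (lift d))" if c: "c \<in> B" "d \<in> B" for c d
    by (rule smooth_on_cong[OF B.open_overlap[OF c], THEN iffD2, OF _ B.smooth_transition[OF c]])
      (use c in \<open>auto simp: transition_def[of "lift c"] cinv_lift cmap_lift[OF pointsI] B.transition_cmap\<close>)
  moreover have "cmap (lift c) ` cdom (lift c) = cmap c ` cdom c" if "c \<in> B" for c
    using lift_overlap[OF that that] by simp
  ultimately show ?thesis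
    unfolding smooth_atlas_def by (auto simp: inj_lift lift_overlap B.open_overlap B.open_chart)
qed

lemma openin_lift:
  assumes "U \<subseteq> points B"
  shows "openin (atlas_topology (lift ` B)) (\<xi> ` U) \<longleftrightarrow> openin (atlas_topology B) U"
proof -
  have "cmap (lift c) ` (\<xi> ` U \<inter> cdom (lift c)) = cmap c ` (U \<inter> cdom c)" if "c \<in> B" for c
    using lift_Int[OF that assms] cmap_lift_image[of "U \<inter> cdom c" c] assms by (auto simp: cdom_lift)
  then show ?thesis
    using assms by (auto simp: openin_atlas_topology[OF smooth_atlas_lift] openin_atlas_topology[OF B.smooth_atlas] points_lift)
qed

lemma (in atlas) topspace_atlas: "topspace (atlas_topology A) = points A"
proof -
  have "openin (atlas_topology A) (points A)"
    unfolding openin_atlas_topology[OF smooth_atlas]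
  proof (intro conjI ballI subset_refl)
    fix c assume "c \<in> A"
    then have "points A \<inter> cdom c = cdom c" "open (cmap c ` cdom c)" by (auto simp: points_def open_chart)
    then show "open (cmap c ` (points A \<inter> cdom c))" by simp
  qed
  moreover have "topspace (atlas_topology A) \<subseteq> points A"
    using openin_topspace[of "atlas_topology A"] unfolding openin_atlas_topology[OF smooth_atlas] by blast
  ultimately show ?thesis using openin_subset by blast
qed

text \<open>Carries the Hausdorff property and second countability over to the image. The topology
  is the one of the transported atlas, not the subspace topology of the tangent bundle.\<close>

lemma homeomorphic_lift: "homeomorphic_map (atlas_topology B) (atlas_topology (lift ` B)) \<xi>"
proof (rule bijective_open_imp_homeomorphic_map)
  interpret L: atlas "lift ` B" by unfold_locales (rule smooth_atlas_lift)
  note ts = B.topspace_atlas L.topspace_atlas points_lift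
  show "continuous_map (atlas_topology B) (atlas_topology (lift ` B)) \<xi>"
    unfolding continuous_map ts
  proof (intro conjI allI impI)
    fix U assume U: "openin (atlas_topology (lift ` B)) U"
    then have "U \<subseteq> \<xi> ` points B" using openin_subset ts by blast
    then have "\<xi> ` {x \<in> points B. \<xi> x \<in> U} = U" by blast
    then show "openin (atlas_topology B) {x \<in> points B. \<xi> x \<in> U}"
      using openin_lift[of "{x \<in> points B. \<xi> x \<in> U}"] U by auto
  qed blast
  show "open_map (atlas_topology B) (atlas_topology (lift ` B)) \<xi>"
    unfolding open_map_def using openin_lift openin_subset ts(1) by metis
  show "\<xi> ` topspace (atlas_topology B) = topspace (atlas_topology (lift ` B))"
    "inj_on \<xi> (topspace (atlas_topology B))"
    unfolding ts by (rule refl, rule inj_field)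
qed

section \<open>The image of the field in induced coordinates\<close>

definition vec_coord :: "('m, 'f) chart \<Rightarrow> ('m, 'e) chart \<Rightarrow> 'f \<Rightarrow> 'e" where
  "vec_coord c d y = snd (\<xi> (cinv c y)) d"

definition lift_coord :: "('m, 'f) chart \<Rightarrow> ('m, 'e) chart \<Rightarrow> 'f \<Rightarrow> 'e \<times> 'e" where
  "lift_coord c d y = (inclusion_coord c d y, vec_coord c d y)"

lemma field_coord: "c \<in> B \<Longrightarrow> q \<in> cdom c \<Longrightarrow> cmap (tangent_chart A d) (\<xi> q) = lift_coord c d (cmap c q)"
  by (simp add: cmap_tangent_chart lift_coord_def vec_coord_def inclusion_coord_cmap pointsI)

lemma smooth_vec_coord:
  assumes c: "c \<in> B" "d \<in> A"
  shows "smooth_on (cmap c ` (cdom c \<inter> cdom d)) (vec_coord c d)"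
proof -
  let ?N = "cmap c ` (cdom c \<inter> cdom d)"
  have "cdom c \<inter> points B \<inter> \<xi> -` cdom (tangent_chart A d) = cdom c \<inter> cdom d"
    using field_in_chart pointsI[OF c(1)] by blast
  then have sm: "smooth_on ?N (cmap (tangent_chart A d) \<circ> \<xi> \<circ> cinv c)"
    using smooth_field c(1) tangent_chart_in[OF c(2)] unfolding smooth_map_on_def by metis
  have "smooth_on ?N (\<lambda>y. snd ((cmap (tangent_chart A d) \<circ> \<xi> \<circ> cinv c) y))"
    by (rule smooth_on_linear_comp[OF open_inclusion_coord[OF c] bounded_linear_snd sm])
  then show ?thesis by (simp add: cmap_tangent_chart vec_coord_def[abs_def])
qed

lemma lifted_immersion:
  assumes c: "c \<in> B" "d \<in> A"
  shows "lifted_immersion (cmap d ` cdom d) (metric_coord A g d) (cmap c ` (cdom c \<inter> cdom d))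
    (inclusion_coord c d) (vec_coord c d) (lift_coord c d)"
proof (rule lifted_immersion.intro[OF coord_metric2[OF c(2)]], rule lifted_immersion_axioms.intro)
  show "inclusion_coord c d ` cmap c ` (cdom c \<inter> cdom d) \<subseteq> cmap d ` cdom d" using c by (auto simp: inclusion_coord_cmap)
  show "lift_coord c d y = (inclusion_coord c d y, vec_coord c d y)" for y by (simp add: lift_coord_def)
qed (rule open_inclusion_coord[OF c] smooth_inclusion_coord[OF c] smooth_vec_coord[OF c])+

lemma inclusion_coord_lift:
  assumes "c \<in> B" "y \<in> cmap c ` (cdom c \<inter> cdom d)"
  shows "inclusion_coord (lift c) (tangent_chart A d) y = lift_coord c d y"
  using assms by (auto simp: inclusion_coord_def[of "lift c"] cinv_lift field_coord)

text \<open>The immersion property is inherited: the first component of the differential of the lift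
  is the differential of the inclusion of F, which is injective already.\<close>

lemma submanifold_lift:
  assumes "submanifold A B"
  shows "submanifold (tangent_atlas A) (lift ` B)"
  unfolding submanifold_def
proof (intro conjI ballI)
  interpret L: atlas "lift ` B" by unfold_locales (rule smooth_atlas_lift)
  interpret TA: atlas "tangent_atlas A" by (rule atlas_tangent)
  interpret LT: two_atlases "lift ` B" "tangent_atlas A" ..
  have homeo: "atlas_topology B homeomorphic_space atlas_topology (lift ` B)"
    using homeomorphic_lift homeomorphic_map_imp_homeomorphic_space by blast
  show "smooth_manifold (lift ` B)"
    using assms smooth_atlas_lift homeomorphic_Hausdorff_space[OF homeo] homeomorphic_space_second_countability[OF homeo]
    unfolding submanifold_def smooth_manifold_def by blast
  show smooth: "smooth_map_on (lift ` B) (tangent_atlas A) (points (lift ` B)) id"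
    unfolding smooth_map_on_def
  proof (intro conjI ballI subset_refl)
    show "id ` points (lift ` B) \<subseteq> points (tangent_atlas A)"
      using smooth_field by (auto simp: points_lift smooth_map_on_def)
    fix C D assume "C \<in> lift ` B" "D \<in> tangent_atlas A"
    then obtain c d where c: "c \<in> B" "d \<in> A" "C = lift c" "D = tangent_chart A d"
      by (auto simp: tangent_atlas_def)
    have "cdom C \<inter> points (lift ` B) \<inter> id -` cdom D = \<xi> ` (cdom c \<inter> cdom d)"
    proof -
      have "id -` cdom D = cdom D" by auto
      then show ?thesis unfolding c(3,4) cdom_lift points_lift using field_in_chart pointsI[OF c(1)] by blast
    qed
    moreover have "cdom c \<inter> cdom d \<subseteq> points B" using c(1) by (auto simp: points_def)
    ultimately have eq: "cmap C ` (cdom C \<inter> points (lift ` B) \<inter> id -` cdom D) = cmap c ` (cdom c \<inter> cdom d)"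
      using cmap_lift_image[of "cdom c \<inter> cdom d" c] c(3) by simp
    show "open (cmap C ` (cdom C \<inter> points (lift ` B) \<inter> id -` cdom D))"
      unfolding eq by (rule open_inclusion_coord[OF c(1,2)])
    have "smooth_on (cmap c ` (cdom c \<inter> cdom d)) (inclusion_coord C D)"
      unfolding c(3,4)
      by (rule smooth_on_cong[OF open_inclusion_coord[OF c(1,2)], THEN iffD2, OF inclusion_coord_lift[OF c(1)]
            lifted_immersion.smooth_h[OF lifted_immersion[OF c(1,2)]]])
    then show "smooth_on (cmap C ` (cdom C \<inter> points (lift ` B) \<inter> id -` cdom D)) (cmap D \<circ> id \<circ> cinv C)"
      unfolding eq inclusion_coord_def .
  qed
  fix P assume "P \<in> points (lift ` B)"
  then obtain p where p: "p \<in> points B" "P = \<xi> p" by (auto simp: points_lift)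
  obtain c where c: "c \<in> B" "p \<in> cdom c" using p(1) by (auto simp: points_def)
  obtain d where d: "d \<in> A" "p \<in> cdom d" using points_subset[OF p(1)] by (auto simp: points_def)
  let ?N = "cmap c ` (cdom c \<inter> cdom d)" and ?D = "tangent_chart A d"
  have x: "cmap c p \<in> ?N" using c d by blast
  interpret l: lifted_immersion "cmap d ` cdom d" "metric_coord A g d" ?N "inclusion_coord c d" "vec_coord c d" "lift_coord c d"
    by (rule lifted_immersion[OF c(1) d(1)])
  have diff: "differentiable_map_at (lift ` B) (tangent_atlas A) id P"
    using LT.smooth_map_on_imp_differentiable_map_at[OF smooth] p by (auto simp: points_lift)
  have C: "lift c \<in> lift ` B" "P \<in> cdom (lift c)" using c p by (auto simp: cdom_lift)
  have D: "?D \<in> tangent_atlas A" "id P \<in> cdom ?D"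
    using tangent_chart_in[OF d(1)] field_in_chart[OF p(1)] d p(2) by auto
  have cP: "cmap (lift c) P = cmap c p" using p by (simp add: cmap_lift)
  have FD_eq: "FD (cmap ?D \<circ> id \<circ> cinv (lift c)) (cmap c p) = FD (lift_coord c d) (cmap c p)"
    using FD_cong_open[OF open_inclusion_coord[OF c(1) d(1)] x inclusion_coord_lift[OF c(1)]] by (simp only: inclusion_coord_def)
  show "inj_on (tangent_map (lift ` B) (tangent_atlas A) id) (tangent_space (lift ` B) P)"
  proof (rule inj_onI)
    fix V W assume V: "V \<in> tangent_space (lift ` B) P" and W: "W \<in> tangent_space (lift ` B) P"
      and eq: "tangent_map (lift ` B) (tangent_atlas A) id V = tangent_map (lift ` B) (tangent_atlas A) id W"
    have "FD (lift_coord c d) (cmap c p) (snd V (lift c)) = FD (lift_coord c d) (cmap c p) (snd W (lift c))"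
      using LT.snd_tangent_map[OF diff C D V] LT.snd_tangent_map[OF diff C D W]
      unfolding cP FD_eq eq by (rule trans[OF sym])
    then have "FD (inclusion_coord c d) (cmap c p) (snd V (lift c)) = FD (inclusion_coord c d) (cmap c p) (snd W (lift c))"
      by (simp add: l.FD_h[OF x])
    then have "snd V (lift c) = snd W (lift c)"
      using inj_FD_inclusion_coord[OF c(1) d(1) c(2) d(2)] by (simp add: inj_eq)
    then show "V = W" by (rule L.tangent_space_eqI[OF V W C])
  qed
qed

section \<open>The covariant derivative of the field in coordinates\<close>

lemma cov_deriv_field:
  assumes X: "X \<in> tangent_space B p"
  shows "cov_deriv A g B \<xi> X \<in> tangent_space A p"
    and "c \<in> B \<Longrightarrow> d \<in> A \<Longrightarrow> p \<in> cdom c \<Longrightarrow> p \<in> cdom d \<Longrightarrow>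
      snd (cov_deriv A g B \<xi> X) d =
        vertical_part (metric_coord A g d) (lift_coord c d (cmap c p)) (FD (lift_coord c d) (cmap c p) (snd X c))"
proof -
  interpret TA: atlas "tangent_atlas A" by (rule atlas_tangent)
  interpret BT: two_atlases B "tangent_atlas A" ..
  have p: "p \<in> points B" by (rule B.tangent_spaceD(2)[OF X])
  have diff: "differentiable_map_at B (tangent_atlas A) \<xi> p" by (rule BT.smooth_map_on_imp_differentiable_map_at[OF smooth_field p])
  have \<xi>p: "\<xi> p \<in> points (tangent_atlas A)" using smooth_field p by (auto simp: smooth_map_on_def)
  note V = BT.tangent_map_in[OF diff \<xi>p X]
  show "cov_deriv A g B \<xi> X \<in> tangent_space A p"
    unfolding cov_deriv_def by (rule connection_map_in[OF V field_in[OF p]])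
  assume c: "c \<in> B" "d \<in> A" "p \<in> cdom c" "p \<in> cdom d"
  have D: "tangent_chart A d \<in> tangent_atlas A" "\<xi> p \<in> cdom (tangent_chart A d)"
    using tangent_chart_in[OF c(2)] field_in_chart[OF p] c by auto
  have "FD (cmap (tangent_chart A d) \<circ> \<xi> \<circ> cinv c) (cmap c p) = FD (lift_coord c d) (cmap c p)"
    by (rule FD_cong_open[OF open_inclusion_coord[OF c(1,2)]]) (use c field_coord[OF c(1), of _ d] in auto)
  then show "snd (cov_deriv A g B \<xi> X) d =
        vertical_part (metric_coord A g d) (lift_coord c d (cmap c p)) (FD (lift_coord c d) (cmap c p) (snd X c))"
    unfolding cov_deriv_def snd_connection_map[OF V field_in[OF p] c(2,4)] BT.snd_tangent_map[OF diff c(1,3) D X]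
    using c p by (simp add: lift_coord_def vec_coord_def inclusion_coord_cmap)
qed

lemma parallel_along_iff:
  "parallel_along A g B \<xi> \<longleftrightarrow> (\<forall>c\<in>B. \<forall>d\<in>A. \<forall>y\<in>cmap c ` (cdom c \<inter> cdom d). \<forall>X.
    vertical_part (metric_coord A g d) (lift_coord c d y) (FD (lift_coord c d) y X) = 0)" (is "_ \<longleftrightarrow> ?r")
proof
  assume par: "parallel_along A g B \<xi>"
  show ?r
  proof (intro ballI allI)
    fix c d y X assume c: "c \<in> B" "d \<in> A" and "y \<in> cmap c ` (cdom c \<inter> cdom d)"
    then obtain p where p: "y = cmap c p" "p \<in> cdom c" "p \<in> cdom d" by blast
    have X: "coord_vec B c p X \<in> tangent_space B p" by (rule B.coord_vec_in[OF c(1) p(2)])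
    then have "cov_deriv A g B \<xi> (coord_vec B c p X) = zero_vec p"
      using par by (simp add: parallel_along_def tangent_space_def)
    then show "vertical_part (metric_coord A g d) (lift_coord c d y) (FD (lift_coord c d) y X) = 0"
      using cov_deriv_field(2)[OF X c p(2,3)] by (simp add: p(1) zero_vec_def B.snd_coord_vec_self[OF c(1) p(2)])
  qed
next
  assume r: ?r
  show "parallel_along A g B \<xi>"
    unfolding parallel_along_def
  proof
    fix X assume "X \<in> tangent_bundle B"
    then have X: "X \<in> tangent_space B (fst X)" by (simp add: B.tangent_bundle_iff)
    have p: "fst X \<in> points B" by (rule B.tangent_spaceD(2)[OF X])
    obtain c where c: "c \<in> B" "fst X \<in> cdom c" using p by (auto simp: points_def)
    obtain d where d: "d \<in> A" "fst X \<in> cdom d" using points_subset[OF p] by (auto simp: points_def)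
    have "cmap c (fst X) \<in> cmap c ` (cdom c \<inter> cdom d)" using c d by blast
    then have "snd (cov_deriv A g B \<xi> X) d = snd (zero_vec (fst X)) d"
      using cov_deriv_field(2)[OF X c(1) d(1) c(2) d(2)] r c d by (simp add: zero_vec_def)
    then show "cov_deriv A g B \<xi> X = zero_vec (fst X)"
      by (rule tangent_space_eqI[OF cov_deriv_field(1)[OF X] zero_vec_in[OF points_subset[OF p]] d])
  qed
qed

text \<open>The metric coefficients and the parametrisation agree with their coordinate expressions
  on open sets only, but this determines all derivatives in the Hessian.\<close>

lemma covariant_hessian_lift:
  assumes c: "c \<in> B" "d \<in> A" "y \<in> cmap c ` (cdom c \<inter> cdom d)"
  shows "covariant_hessian (metric_coord (tangent_atlas A) (sasaki_metric A g) (tangent_chart A d))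
      (inclusion_coord (lift c) (tangent_chart A d)) y X Y = covariant_hessian (sasaki_form (metric_coord A g d)) (lift_coord c d) y X Y"
    and "FD (inclusion_coord (lift c) (tangent_chart A d)) y = FD (lift_coord c d) y"
proof -
  interpret l: lifted_immersion "cmap d ` cdom d" "metric_coord A g d" "cmap c ` (cdom c \<inter> cdom d)" "inclusion_coord c d" "vec_coord c d" "lift_coord c d"
    by (rule lifted_immersion[OF c(1,2)])
  show "covariant_hessian (metric_coord (tangent_atlas A) (sasaki_metric A g) (tangent_chart A d))
      (inclusion_coord (lift c) (tangent_chart A d)) y X Y = covariant_hessian (sasaki_form (metric_coord A g d)) (lift_coord c d) y X Y"
  proof (rule covariant_hessian_cong[OF open_inclusion_coord[OF c(1,2)] c(3) _ l.sasaki_form.open_S])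
    show "lift_coord c d y \<in> cmap d ` cdom d \<times> UNIV" by (rule subsetD[OF l.hV imageI[OF c(3)]])
  qed (rule inclusion_coord_lift[OF c(1)], assumption, rule metric_coord_sasaki[OF c(2)])
  show "FD (inclusion_coord (lift c) (tangent_chart A d)) y = FD (lift_coord c d) y"
    by (rule FD_cong_open[OF open_inclusion_coord[OF c(1,2)] c(3) inclusion_coord_lift[OF c(1)]])
qed

theorem totally_geodesic_lift_iff:
  assumes sub: "submanifold A B" and len: "constant_length g B \<xi>"
  shows "totally_geodesic_submanifold (tangent_atlas A) (sasaki_metric A g) (lift ` B)
     \<longleftrightarrow> totally_geodesic_submanifold A g B \<and> parallel_along A g B \<xi>"
proof -
  interpret L: immersed "tangent_atlas A" "sasaki_metric A g" "lift ` B"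
    by (rule submanifold_immersed[OF c1_riemannian_sasaki submanifold_lift[OF sub]])
  have charts: "\<exists>c\<in>B. \<exists>d\<in>A. p \<in> cdom c \<and> p \<in> cdom d" if "p \<in> points B" for p
    using that points_subset[OF that] by (auto simp: points_def)
  have tg_iff: "(\<exists>Z. covariant_hessian (sasaki_form (metric_coord A g d)) (lift_coord c d) y X Y = FD (lift_coord c d) y Z)
      \<longleftrightarrow> (\<exists>Z. covariant_hessian (metric_coord A g d) (inclusion_coord c d) y X Y = FD (inclusion_coord c d) y Z)"
    if par: "parallel_along A g B \<xi>" and c: "c \<in> B" "d \<in> A" "y \<in> cmap c ` (cdom c \<inter> cdom d)" for c d y X Y
    using lifted_immersion.tangent_covariant_hessian_iff[OF lifted_immersion[OF c(1,2)] _ c(3)] par c(1,2)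
    unfolding parallel_along_iff by blast
  show ?thesis
  proof (intro iffI conjI)
    assume tg: "totally_geodesic_submanifold (tangent_atlas A) (sasaki_metric A g) (lift ` B)"
    have covariant_hessian: "\<exists>Z. covariant_hessian (sasaki_form (metric_coord A g d)) (lift_coord c d) y X Y = FD (lift_coord c d) y Z"
      if c: "c \<in> B" "d \<in> A" "y \<in> cmap c ` (cdom c \<inter> cdom d)" for c d y X Y
    proof -
      obtain p where p: "y = cmap c p" "p \<in> cdom c" "p \<in> cdom d" using c by blast
      have "lift c \<in> lift ` B" "\<xi> p \<in> cdom (lift c)" "\<xi> p \<in> cdom (tangent_chart A d)"
        using c p field_in_chart[OF pointsI] by (auto simp: cdom_lift)
      from L.totally_geodesic_covariant_hessian[OF tg this(1) tangent_chart_in[OF c(2)] this(2,3), of X Y]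
      show ?thesis
        using covariant_hessian_lift(1)[OF c, of X Y] covariant_hessian_lift(2)[OF c] p c by (simp add: cmap_lift[OF pointsI[OF c(1) p(2)]])
    qed
    \<comment> \<open>Comes before the other conjunct, which needs it to apply
      \<open>tg_iff\<close>.\<close>
    show par: "parallel_along A g B \<xi>"
      unfolding parallel_along_iff
    proof (intro ballI allI)
      fix c d y X assume c: "c \<in> B" "d \<in> A" and y: "y \<in> cmap c ` (cdom c \<inter> cdom d)"
      interpret l: lifted_immersion "cmap d ` cdom d" "metric_coord A g d" "cmap c ` (cdom c \<inter> cdom d)" "inclusion_coord c d" "vec_coord c d" "lift_coord c d"
        by (rule lifted_immersion[OF c])
      obtain r where r: "\<And>p. p \<in> points B \<Longrightarrow> sqrt (g (\<xi> p) (\<xi> p)) = r"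
        using len by (auto simp: constant_length_def)
      have sq: "sqrt (metric_coord A g d (inclusion_coord c d z) (vec_coord c d z) (vec_coord c d z)) = r"
        if z: "z \<in> cmap c ` (cdom c \<inter> cdom d)" for z
      proof -
        obtain q where q: "z = cmap c q" "q \<in> cdom c" "q \<in> cdom d" using z by blast
        then have "q \<in> points B" using pointsI c by blast
        then show ?thesis
          using r[of q] metric_eq_coord[OF field_in field_in c(2) q(3), of g] q c
          by (simp add: vec_coord_def inclusion_coord_cmap)
      qed
      \<comment> \<open>\<open>constant_length\<close> speaks of the square root, which is
        injective; the value at \<open>y\<close> serves as the constant squared length over this
        pair of charts.\<close>
      have "metric_coord A g d (inclusion_coord c d z) (vec_coord c d z) (vec_coord c d z)
          = metric_coord A g d (inclusion_coord c d y) (vec_coord c d y) (vec_coord c d y)"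
        if "z \<in> cmap c ` (cdom c \<inter> cdom d)" for z
        using sq[OF that] sq[OF y] by (metis real_sqrt_eq_iff)
      moreover obtain Z where "covariant_hessian (sasaki_form (metric_coord A g d)) (lift_coord c d) y X X = FD (lift_coord c d) y Z"
        using covariant_hessian[OF c y] by blast
      ultimately show "vertical_part (metric_coord A g d) (lift_coord c d y) (FD (lift_coord c d) y X) = 0"
        using l.tangent_covariant_hessian_imp_parallel[OF _ y] by blast
    qed
    show "totally_geodesic_submanifold A g B"
    proof (rule totally_geodesicI[OF sub])
      fix p X Y assume "p \<in> points B"
      then obtain c d where c: "c \<in> B" "d \<in> A" "p \<in> cdom c" "p \<in> cdom d" using charts by blast
      then have y: "cmap c p \<in> cmap c ` (cdom c \<inter> cdom d)" by blast
      show "\<exists>c\<in>B. \<exists>d\<in>A. p \<in> cdom c \<and> p \<in> cdom d \<and>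
        (\<exists>Z. covariant_hessian (metric_coord A g d) (inclusion_coord c d) (cmap c p) (X c) (Y c) = FD (inclusion_coord c d) (cmap c p) Z)"
        using c tg_iff[OF par c(1,2) y] covariant_hessian[OF c(1,2) y] by blast
    qed
  next
    assume "totally_geodesic_submanifold A g B \<and> parallel_along A g B \<xi>"
    then have tg: "totally_geodesic_submanifold A g B" and par: "parallel_along A g B \<xi>" by auto
    show "totally_geodesic_submanifold (tangent_atlas A) (sasaki_metric A g) (lift ` B)"
    proof (rule L.totally_geodesicI[OF submanifold_lift[OF sub]])
      fix P X Y assume "P \<in> points (lift ` B)"
      then obtain p where p: "p \<in> points B" "P = \<xi> p" by (auto simp: points_lift)
      then obtain c d where c: "c \<in> B" "d \<in> A" "p \<in> cdom c" "p \<in> cdom d" using charts by blast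
      then have y: "cmap c p \<in> cmap c ` (cdom c \<inter> cdom d)" by blast
      have "\<exists>Z. covariant_hessian (metric_coord (tangent_atlas A) (sasaki_metric A g) (tangent_chart A d))
          (inclusion_coord (lift c) (tangent_chart A d)) (cmap (lift c) P) (X (lift c)) (Y (lift c))
          = FD (inclusion_coord (lift c) (tangent_chart A d)) (cmap (lift c) P) Z"
        using totally_geodesic_covariant_hessian[OF tg c] tg_iff[OF par c(1,2) y]
        unfolding p(2) cmap_lift[OF p(1)] covariant_hessian_lift[OF c(1,2) y] by blast
      moreover have "P \<in> cdom (lift c)" "P \<in> cdom (tangent_chart A d)"
        using c p field_in_chart by (auto simp: cdom_lift)
      ultimately show "\<exists>C\<in>lift ` B. \<exists>D\<in>tangent_atlas A. P \<in> cdom C \<and> P \<in> cdom D \<and>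
        (\<exists>Z. covariant_hessian (metric_coord (tangent_atlas A) (sasaki_metric A g) D) (inclusion_coord C D) (cmap C P) (X C) (Y C) = FD (inclusion_coord C D) (cmap C P) Z)"
        using c(1) tangent_chart_in[OF c(2)] by blast
    qed
  qed
qed

end

theorem theorem3p2:
  fixes M :: "('m, 'e::euclidean_space) chart set"
    and g :: "('m, 'e) metric"
    and F :: "('m, 'f::euclidean_space) chart set"
    and \<xi> :: "'m \<Rightarrow> ('m, 'e) tvec"
  assumes "smooth_manifold M"
    and "riemannian_metric M g"
    and "submanifold M F"
    and "vector_field_along M F \<xi>"
    and "constant_length g F \<xi>"
  shows "totally_geodesic_submanifold (tangent_atlas M) (sasaki_metric M g) (image_atlas \<xi> F)
     \<longleftrightarrow> totally_geodesic_submanifold M g F \<and> parallel_along M g F \<xi>"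
proof -
  interpret M: c2_riemannian M g
    using assms(1,2) by (intro riemannian_metric_c2_riemannian) (auto simp: smooth_manifold_def)
  interpret immersed M g F by (rule submanifold_immersed[OF M.c1_riemannian_axioms assms(3)])
  interpret field_along M g F \<xi> by unfold_locales (rule assms(4))
  show ?thesis
    unfolding image_atlas_eq by (rule totally_geodesic_lift_iff[OF assms(3,5)])
qed

end
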